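(* Assume $L(s)=1$ for all $s\in S$. Let $J\subseteq S$ be arbitrary and let $M$ be a $k\Omega_J$-module with a $k$-basis $\mathfrak{C}\subseteq M$ with respect to which $e_s$ acts diagonally for all $s\in J$ (i.e. a module given by a $W_J$-graph). Let $c:\mathrm{Res}_H^\Omega(\mathrm{HY}_J^S(M))\to\mathrm{Ind}_{H_J}^H(\mathrm{Res}_{H_J}^{\Omega_J}(M))$ be the canonicalisation isomorphism. Then $c(x|\mathfrak{x})=C_{x,\mathfrak{x}}$ for all $x\in D_J$, $\mathfrak{x}\in\mathfrak{C}$, where $C_{x,\mathfrak{x}}$ denotes the Howlett–Yin canonical basis of $\mathrm{Ind}_{H_J}^H(\mathrm{Res}_{H_J}^{\Omega_J}(M))$. The $W$-graph given by the basis $\{x|\mathfrak{x}\mid x\in D_J,\mathfrak{x}\in\mathfrak{C}\}$ of $\mathrm{HY}_J^S(M)$ and the (Howlett–Yin) $W$-graph given by the basis $\{C_{x,\mathfrak{x}}\mid x\in D_J,\mathfrak{x}\in\mathfrak{C}\}$ are the same.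
   Context: Setting. $k$ is a commutative ring; $(W,S)$ is a (not necessarily finite) Coxeter group with length function $l$ and Bruhat–Chevalley order $\le$; $m_{st}$ is the order of $st$. $\Gamma=\mathbb{Z}$, and $L:W\to\Gamma$ is a weight function ($L(xy)=L(x)+L(y)$ whenever $l(xy)=l(x)+l(y)$) with $L(s)>0$ for all $s\in S$. $\mathbb{Z}[\Gamma]$, $k[\Gamma]$ are the Laurent polynomial rings in $v$ (the group element $\gamma$ is written $v^\gamma$), $v_s:=v^{L(s)}$. For a ring or module $A$, $\mathbb{Z}[\Gamma]A:=\mathbb{Z}[\Gamma]\otimes_{\mathbb{Z}}A$ (similarly $k[\Gamma]A=k[\Gamma]\otimes_kA$ for $k$-modules), $\mathbb{Z}[\Gamma_{>0}]A$ (resp. $\mathbb{Z}[\Gamma_{\ge0}]A$) is the subgroup of elements involving only exponents $>0$ (resp. $\ge0$), similarly $k[\Gamma_{>0}]A$, and $\overline{\phantom{m}}$ is the map $v^\gamma\otimes a\mapsto v^{-\gamma}\otimes a$. Hecke algebra. $H$ is the $\mathbb{Z}[\Gamma]$-algebra generated by $T_s$ ($s\in S$) with relations $T_s^2=1+(v_s-v_s^{-1})T_s$ and the braid relations $T_sT_tT_s\cdots=T_tT_sT_t\cdots$ ($m_{st}$ factors, $m_{st}<\infty$); $T_w=T_{s_1}\cdots T_{s_l}$ for a reduced expression $w=s_1\cdots s_l$. For $J\subseteq S$, $W_J=\langle J\rangle$ and $H_J=\mathrm{span}\{T_w\mid w\in W_J\}$, the Hecke algebra of $(W_J,J,L|_{W_J})$.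 $k[\Gamma]H:=k[\Gamma]\otimes_{\mathbb{Z}[\Gamma]}H$. $W$-graph algebra. In $\mathbb{Z}[\Gamma]\otimes\mathbb{Z}\langle e_s,x_{s,\gamma}\mid s\in S,-L(s)<\gamma<L(s)\rangle$ (free algebra) put $j(T_s)=-v_s^{-1}e_s+v_s(1-e_s)+\sum_{\gamma}v^\gamma x_{s,\gamma}$ and write $j(T_s)j(T_t)j(T_s)\cdots-j(T_t)j(T_s)j(T_t)\cdots=\sum_\gamma v^\gamma\otimes y^\gamma(s,t)$ ($m_{st}$ factors each, $m_{st}<\infty$). $\Omega$ is the quotient of the free algebra by the relations $e_s^2=e_s$, $e_se_t=e_te_s$, $e_sx_{s,\gamma}=x_{s,\gamma}$, $x_{s,\gamma}e_s=0$, $x_{s,\gamma}=x_{s,-\gamma}$, $y^\gamma(s,t)=0$. Put $x_s=\sum_\gamma v^\gamma x_{s,\gamma}\in\mathbb{Z}[\Gamma]\Omega$. $T_s\mapsto j(T_s)$ defines an embedding $H\hookrightarrow\mathbb{Z}[\Gamma]\Omega$, regarded as an inclusion; $C_s:=T_s-v_s=-(v_s+v_s^{-1})e_s+x_s$. $\Omega_J$ is the algebra $\Omega$ for $(W_J,J,L|_{W_J})$; $k\Omega=k\otimes_{\mathbb Z}\Omega$. For a $k\Omega$-module $N$, $\mathrm{Res}_H^\Omega N$ is $k[\Gamma]\otimes_kN$ viewed as a $k[\Gamma]H$-module; similarly $\mathrm{Res}_{H_J}^{\Omega_J}$. $\mathrm{Ind}_{H_J}^H(V)=H\otimes_{H_J}V$;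 for $V=k[\Gamma]\otimes_kM$ it carries the semilinear involution $\iota(h\otimes x)=\iota(h)\otimes\iota(x)$, where $\iota$ on $H$ is the $\overline{\phantom m}$-semilinear ring involution with $\iota(T_s)=T_s^{-1}$ and $\iota(a\otimes m)=\overline a\otimes m$ on $V$. $W$-graph of a basis. If a $k\Omega$-module has a $k$-basis $\mathfrak{B}$ on which all $e_s$ act diagonally (by $0$ or $1$), its $W$-graph has vertex set $\mathfrak{B}$, vertex labels $I(\mathfrak{z})=\{s\in S\mid e_s\mathfrak{z}=\mathfrak{z}\}$, and edge weight matrices $m^s$ = matrix of $x_s$ with respect to $\mathfrak{B}$ (equivalently the off-diagonal entries of the matrix of $T_s$); likewise for $\Omega_J$. Cosets. $D_J=\{x\in W\mid l(xs)>l(x)\ \forall s\in J\}$. For $s\in S$: $D_{J,s}^+=\{w\in D_J\mid sw>w,\ sw\in D_J\}$, $D_{J,s}^0=\{w\in D_J\mid sw>w,\ sw\notin D_J\}$, $D_{J,s}^-=\{w\in D_J\mid sw<w\}$; these partition $D_J$. For $w\in D_{J,s}^0$ one has $s^w:=w^{-1}sw\in J$. Elements $p_{x,z}$. Write $\iota(T_z)=\sum_wR_{w,z}T_w$. For $x,z\in D_J$ put $r_{x,z}=\sum_{y\in W_J}R_{xy,z}T_y\in H_J\subseteq\mathbb{Z}[\Gamma]\Omega_J$. Then $(p_{x,z})_{x,z\in D_J}$ is the unique family in $\mathbb{Z}[\Gamma_{\ge0}]\Omega_J$ with $p_{z,z}=1$, $p_{x,z}=0$ unless $x\le z$, $p_{x,z}\in\mathbb{Z}[\Gamma_{>0}]\Omega_J$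 for $x<z$, and $p_{x,z}=\sum_{x\le y\le z}r_{x,y}\overline{p_{y,z}}$. Elements $\mu_{x,z}^s$. $(\mu_{x,z}^s)_{x,z\in D_J,s\in S}$ is the unique family in $\mathbb{Z}[\Gamma]\Omega_J$ such that (i) $\mu_{x,z}^s=0$ unless $x<z$, $z\in D_{J,s}^+\cup D_{J,s}^0$ and $x\in D_{J,s}^0\cup D_{J,s}^-$; (ii) $\overline{\mu_{x,z}^s}=\mu_{x,z}^s$; (iii) if $z\in D_{J,s}^+\cup D_{J,s}^0$ and $x\in D_{J,s}^0\cup D_{J,s}^-$ then $\mu_{x,z}^s+R+\sum_{x<y<z}p_{x,y}\mu_{y,z}^s\in\mathbb{Z}[\Gamma_{>0}]\Omega_J$, where $R=-C_{s^x}p_{x,z}$ if $z\in D_{J,s}^+,x\in D_{J,s}^0$; $R=v_s^{-1}p_{x,z}$ if $z\in D_{J,s}^+,x\in D_{J,s}^-$; $R=p_{x,z}C_{s^z}-C_{s^x}p_{x,z}$ if $z\in D_{J,s}^0,x\in D_{J,s}^0$; $R=p_{x,z}C_{s^z}+v_s^{-1}p_{x,z}$ if $z\in D_{J,s}^0,x\in D_{J,s}^-$. Write $\mu^s_{x,z}=\sum_{-L(s)<\gamma<L(s)}\mu^{s,\gamma}_{x,z}v^\gamma$ with $\mu_{x,z}^{s,\gamma}\in\Omega_J$ (no other exponents occur). Howlett–Yin induction functor. For a $k\Omega_J$-module $M$, $\mathrm{HY}_J^S(M)=\bigoplus_{w\in D_J}M$ as a $k$-module, with elements of the $w$-component written $w|m$,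 and with $k\Omega$-module structure: $e_s\cdot z|m=0$, $z|e_{s^z}m$, $z|m$ for $z\in D_{J,s}^+,D_{J,s}^0,D_{J,s}^-$ respectively; $x_{s,\gamma}\cdot z|m=\sum_{x<z}x|\mu_{x,z}^{s,\gamma}m+\delta_{\gamma,0}\,sz|m$ for $z\in D_{J,s}^+$, $=\sum_{x<z}x|\mu_{x,z}^{s,\gamma}m+z|x_{s^z,\gamma}m$ for $z\in D_{J,s}^0$, and $=0$ for $z\in D_{J,s}^-$. The canonicalisation $c$ is the $k[\Gamma]H$-linear isomorphism $z|m\mapsto\sum_{y\in D_J}T_y\otimes p_{y,z}m$. Howlett–Yin basis and $W$-graph. The Howlett–Yin basis $(C_{x,\mathfrak{x}})_{x\in D_J,\mathfrak{x}\in\mathfrak{C}}$ is the unique $k[\Gamma]$-basis of $\mathrm{Ind}_{H_J}^H(\mathrm{Res}_{H_J}^{\Omega_J}(M))$ with $\iota(C_{x,\mathfrak{x}})=C_{x,\mathfrak{x}}$ and $C_{x,\mathfrak{x}}\in T_x\otimes\mathfrak{x}+\sum_{w\in D_J,w<x}T_w\otimes k[\Gamma_{>0}]M$. The Howlett–Yin $W$-graph on this basis has vertex labels $I(C_{x,\mathfrak{x}})=\{s\in S\mid sx<x,\text{ or }(sx>x,\ sx\notin D_J\text{ and }s^x\in I(\mathfrak{x}))\}$, where $I(\mathfrak{x})=\{t\in J\mid e_t\mathfrak{x}=\mathfrak{x}\}$, and edge weights $m^s$ given by the off-diagonal entries of the matrix of $T_s$ with respect to this basis. *)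

theory Defs
  imports
    "HOL-Library.Poly_Mapping"
    "HOL-Algebra.Multiplicative_Group"
    "HOL-Algebra.Generated_Groups"
begin

text \<open>
  HOL has no types depending on parameters such as \<open>J\<close>. Algebras given by generators and
  relations and tensor products are therefore treated up to isomorphism: a type together with
  structure maps is required to be a model of the presentation, i.e. the canonical map from the free
  object is onto and its kernel is generated by the defining relations. Likewise, objects that are
  characterised uniquely (such as the families \<open>p\<close> and \<open>\<mu>\<close>, or the involution on the Hecke
  algebra) are described by the predicate that characterises them.

  HOL-Algebra also has a locale called module; below \<open>Modules.module\<close> is the one of HOL.
\<close>

section \<open>Coxeter groups\<close>

definition word_prod :: "('w, 'c) monoid_scheme \<Rightarrow> 'w list \<Rightarrow> 'w" where
  "word_prod G u = foldr (\<lambda>a b. a \<otimes>\<^bsub>G\<^esub> b) u \<one>\<^bsub>G\<^esub>"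

definition alt_list :: "nat \<Rightarrow> 'a \<Rightarrow> 'a \<Rightarrow> 'a list" where
  "alt_list n a b = map (\<lambda>i. if even i then a else b) [0..<n]"

text \<open>The order \<open>m\<^sub>s\<^sub>t\<close> of \<open>st\<close>; the value 0 encodes infinite order.\<close>
definition cox_m :: "('w, 'c) monoid_scheme \<Rightarrow> 'w \<Rightarrow> 'w \<Rightarrow> nat" where
  "cox_m G s t = group.ord G (s \<otimes>\<^bsub>G\<^esub> t)"

text \<open>The monoid congruence on words generated by the relators \<open>(st)\<^sup>m\<close>. The case \<open>s = t\<close> (where
  \<open>m = 1\<close>) gives \<open>ss = 1\<close>, so no formal inverses are needed.\<close>
inductive cox_cong :: "('w, 'c) monoid_scheme \<Rightarrow> 'w set \<Rightarrow> 'w list \<Rightarrow> 'w list \<Rightarrow> bool" for G S where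
  refl: "cox_cong G S u u"
| sym: "cox_cong G S u v \<Longrightarrow> cox_cong G S v u"
| trans: "cox_cong G S u v \<Longrightarrow> cox_cong G S v w \<Longrightarrow> cox_cong G S u w"
| relator: "s \<in> S \<Longrightarrow> t \<in> S \<Longrightarrow> cox_cong G S (u @ alt_list (2 * cox_m G s t) s t @ v) (u @ v)"

definition coxeter_system :: "('w, 'c) monoid_scheme \<Rightarrow> 'w set \<Rightarrow> bool" where
  "coxeter_system G S \<longleftrightarrow>
     group G \<and> S \<subseteq> carrier G \<and> generate G S = carrier G \<and>
     (\<forall>s\<in>S. s \<noteq> \<one>\<^bsub>G\<^esub> \<and> s \<otimes>\<^bsub>G\<^esub> s = \<one>\<^bsub>G\<^esub>) \<and>
     (\<forall>u\<in>lists S. word_prod G u = \<one>\<^bsub>G\<^esub> \<longrightarrow> cox_cong G S u [])"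

definition len :: "('w, 'c) monoid_scheme \<Rightarrow> 'w set \<Rightarrow> 'w \<Rightarrow> nat" where
  "len G S w = (LEAST n. \<exists>u\<in>lists S. length u = n \<and> word_prod G u = w)"

definition reduced_word :: "('w, 'c) monoid_scheme \<Rightarrow> 'w set \<Rightarrow> 'w \<Rightarrow> 'w list" where
  "reduced_word G S w = (SOME u. u \<in> lists S \<and> word_prod G u = w \<and> length u = len G S w)"

definition reflections :: "('w, 'c) monoid_scheme \<Rightarrow> 'w set \<Rightarrow> 'w set" where
  "reflections G S = {g \<otimes>\<^bsub>G\<^esub> s \<otimes>\<^bsub>G\<^esub> inv\<^bsub>G\<^esub> g | g s. g \<in> carrier G \<and> s \<in> S}"

definition bruhat_le :: "('w, 'c) monoid_scheme \<Rightarrow> 'w set \<Rightarrow> 'w \<Rightarrow> 'w \<Rightarrow> bool" where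
  "bruhat_le G S = (\<lambda>x y. x \<in> carrier G \<and> (\<exists>t\<in>reflections G S. y = x \<otimes>\<^bsub>G\<^esub> t) \<and> len G S x < len G S y)\<^sup>*\<^sup>*"

definition bruhat_less :: "('w, 'c) monoid_scheme \<Rightarrow> 'w set \<Rightarrow> 'w \<Rightarrow> 'w \<Rightarrow> bool" where
  "bruhat_less G S x y \<longleftrightarrow> bruhat_le G S x y \<and> x \<noteq> y"

definition weight_function :: "('w, 'c) monoid_scheme \<Rightarrow> 'w set \<Rightarrow> ('w \<Rightarrow> int) \<Rightarrow> bool" where
  "weight_function G S L \<longleftrightarrow>
     (\<forall>x\<in>carrier G. \<forall>y\<in>carrier G.
        len G S (x \<otimes>\<^bsub>G\<^esub> y) = len G S x + len G S y \<longrightarrow> L (x \<otimes>\<^bsub>G\<^esub> y) = L x + L y) \<and>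
     (\<forall>s\<in>S. L s > 0)"

definition DJ :: "('w, 'c) monoid_scheme \<Rightarrow> 'w set \<Rightarrow> 'w set \<Rightarrow> 'w set" where
  "DJ G S J = {x \<in> carrier G. \<forall>s\<in>J. len G S (x \<otimes>\<^bsub>G\<^esub> s) > len G S x}"

definition DJ_plus :: "('w, 'c) monoid_scheme \<Rightarrow> 'w set \<Rightarrow> 'w set \<Rightarrow> 'w \<Rightarrow> 'w set" where
  "DJ_plus G S J s = {w \<in> DJ G S J. bruhat_less G S w (s \<otimes>\<^bsub>G\<^esub> w) \<and> s \<otimes>\<^bsub>G\<^esub> w \<in> DJ G S J}"

definition DJ_zero :: "('w, 'c) monoid_scheme \<Rightarrow> 'w set \<Rightarrow> 'w set \<Rightarrow> 'w \<Rightarrow> 'w set" where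
  "DJ_zero G S J s = {w \<in> DJ G S J. bruhat_less G S w (s \<otimes>\<^bsub>G\<^esub> w) \<and> s \<otimes>\<^bsub>G\<^esub> w \<notin> DJ G S J}"

definition DJ_minus :: "('w, 'c) monoid_scheme \<Rightarrow> 'w set \<Rightarrow> 'w set \<Rightarrow> 'w \<Rightarrow> 'w set" where
  "DJ_minus G S J s = {w \<in> DJ G S J. bruhat_less G S (s \<otimes>\<^bsub>G\<^esub> w) w}"

text \<open>\<open>s\<^sup>w = w\<^sup>-\<^sup>1sw\<close>\<close>
definition conj_by :: "('w, 'c) monoid_scheme \<Rightarrow> 'w \<Rightarrow> 'w \<Rightarrow> 'w" where
  "conj_by G s w = inv\<^bsub>G\<^esub> w \<otimes>\<^bsub>G\<^esub> s \<otimes>\<^bsub>G\<^esub> w"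

section \<open>Laurent polynomials and free algebras\<close>

text \<open>\<open>\<int>[\<Gamma>]A = \<int>[\<Gamma>] \<otimes> A\<close> is the type of finitely supported functions \<open>\<int> \<rightarrow> A\<close>; the element
  \<open>v\<^sup>\<gamma> \<otimes> a\<close> is \<open>single \<gamma> a\<close>. If \<open>A\<close> is a ring, then the library's multiplication is convolution.\<close>
type_synonym 'a laurent = "int \<Rightarrow>\<^sub>0 'a"

abbreviation vpow :: "int \<Rightarrow> 'a::zero_neq_one laurent" where
  "vpow \<gamma> \<equiv> Poly_Mapping.single \<gamma> 1"

definition lbar :: "'a::zero laurent \<Rightarrow> 'a laurent" where
  "lbar f = Poly_Mapping.map_key uminus f"

text \<open>The action of \<open>A[\<Gamma>]\<close> on \<open>N[\<Gamma>]\<close> induced by a biadditive action of \<open>A\<close> on \<open>N\<close>.\<close>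
definition lact :: "('a::zero \<Rightarrow> 'n \<Rightarrow> 'n) \<Rightarrow> 'a laurent \<Rightarrow> 'n laurent \<Rightarrow> 'n::ab_group_add laurent" where
  "lact act a n = (\<Sum>i\<in>Poly_Mapping.keys a. \<Sum>j\<in>Poly_Mapping.keys n.
     Poly_Mapping.single (i + j) (act (Poly_Mapping.lookup a i) (Poly_Mapping.lookup n j)))"

text \<open>A copy of the type of lists, made an additively written monoid under concatenation, so that
  \<open>'g fword \<Rightarrow>\<^sub>0 'r\<close> is the free associative \<open>'r\<close>-algebra on \<open>'g\<close>.\<close>
datatype 'g fword = FWord (letters: "'g list")

instantiation fword :: (type) monoid_add
begin
definition "0 = FWord []"
definition "u + w = FWord (letters u @ letters w)"
instance
  by standard (auto simp: zero_fword_def plus_fword_def)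
end

definition free_gen :: "'g \<Rightarrow> ('g fword \<Rightarrow>\<^sub>0 'r::zero_neq_one)" where
  "free_gen g = Poly_Mapping.single (FWord [g]) 1"

definition free_alg :: "'g set \<Rightarrow> ('g fword \<Rightarrow>\<^sub>0 'r::zero) set" where
  "free_alg Y = {f. \<forall>u\<in>Poly_Mapping.keys f. set (letters u) \<subseteq> Y}"

definition free_eval :: "('r::zero \<Rightarrow> 'a) \<Rightarrow> ('g \<Rightarrow> 'a) \<Rightarrow> ('g fword \<Rightarrow>\<^sub>0 'r) \<Rightarrow> 'a::ring_1" where
  "free_eval sc g f = (\<Sum>u\<in>Poly_Mapping.keys f. sc (Poly_Mapping.lookup f u) * prod_list (map g (letters u)))"

inductive_set two_sided_ideal :: "'a::ring_1 set \<Rightarrow> 'a set \<Rightarrow> 'a set" for A R where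
  zero: "0 \<in> two_sided_ideal A R"
| gen: "r \<in> R \<Longrightarrow> a \<in> A \<Longrightarrow> b \<in> A \<Longrightarrow> a * r * b \<in> two_sided_ideal A R"
| add: "f \<in> two_sided_ideal A R \<Longrightarrow> g \<in> two_sided_ideal A R \<Longrightarrow> f + g \<in> two_sided_ideal A R"

text \<open>The ring \<open>'a\<close>, with structure map \<open>sc\<close>, is the \<open>'r\<close>-algebra generated by the \<open>g y\<close> for
  \<open>y \<in> Y\<close> subject to the relations \<open>f = 0\<close> for \<open>f \<in> R\<close>.\<close>
definition presented_algebra ::
  "('r::comm_ring_1 \<Rightarrow> 'a::ring_1) \<Rightarrow> ('g \<Rightarrow> 'a) \<Rightarrow> 'g set \<Rightarrow> ('g fword \<Rightarrow>\<^sub>0 'r) set \<Rightarrow> bool" where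
  "presented_algebra sc g Y R \<longleftrightarrow>
     sc 1 = 1 \<and> (\<forall>a b. sc (a + b) = sc a + sc b) \<and> (\<forall>a b. sc (a * b) = sc a * sc b) \<and>
     (\<forall>a h. sc a * h = h * sc a) \<and>
     free_eval sc g ` free_alg Y = UNIV \<and>
     (\<forall>f\<in>free_alg Y. free_eval sc g f = 0 \<longleftrightarrow> f \<in> two_sided_ideal (free_alg Y) R)"

section \<open>Hecke algebras\<close>

definition hecke_rels :: "('w, 'c) monoid_scheme \<Rightarrow> 'w set \<Rightarrow> ('w \<Rightarrow> int) \<Rightarrow>
    ('w fword \<Rightarrow>\<^sub>0 int laurent) set" where
  "hecke_rels G S L =
     {free_gen s * free_gen s
        - (1 + Poly_Mapping.single 0 (vpow (L s) - vpow (- L s)) * free_gen s) | s. s \<in> S}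
   \<union> {prod_list (alt_list (cox_m G s t) (free_gen s) (free_gen t))
        - prod_list (alt_list (cox_m G s t) (free_gen t) (free_gen s)) | s t.
        s \<in> S \<and> t \<in> S \<and> cox_m G s t \<noteq> 0}"

definition hecke_algebra :: "('w, 'c) monoid_scheme \<Rightarrow> 'w set \<Rightarrow> ('w \<Rightarrow> int) \<Rightarrow>
    (int laurent \<Rightarrow> 'h::ring_1) \<Rightarrow> ('w \<Rightarrow> 'h) \<Rightarrow> bool" where
  "hecke_algebra G S L sc T \<longleftrightarrow> presented_algebra sc T S (hecke_rels G S L)"

definition hecke_T :: "('w, 'c) monoid_scheme \<Rightarrow> 'w set \<Rightarrow> ('w \<Rightarrow> 'h::ring_1) \<Rightarrow> 'w \<Rightarrow> 'h" where
  "hecke_T G S T w = prod_list (map T (reduced_word G S w))"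

text \<open>The coefficient of \<open>T\<^sub>w\<close> in \<open>h\<close>.\<close>
definition hecke_coeff :: "('w, 'c) monoid_scheme \<Rightarrow> 'w set \<Rightarrow> (int laurent \<Rightarrow> 'h::ring_1) \<Rightarrow>
    ('w \<Rightarrow> 'h) \<Rightarrow> 'h \<Rightarrow> 'w \<Rightarrow> int laurent" where
  "hecke_coeff G S sc T h w =
     Modules.module.representation (\<lambda>a h. sc a * h) (hecke_T G S T ` carrier G) h (hecke_T G S T w)"

definition hecke_par :: "('w, 'c) monoid_scheme \<Rightarrow> 'w set \<Rightarrow> 'w set \<Rightarrow> (int laurent \<Rightarrow> 'h::ring_1) \<Rightarrow>
    ('w \<Rightarrow> 'h) \<Rightarrow> 'h set" where
  "hecke_par G S J sc T = Modules.module.span (\<lambda>a h. sc a * h) (hecke_T G S T ` generate G J)"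

definition hecke_bar :: "'w set \<Rightarrow> (int laurent \<Rightarrow> 'h::ring_1) \<Rightarrow> ('w \<Rightarrow> 'h) \<Rightarrow> ('h \<Rightarrow> 'h) \<Rightarrow> bool" where
  "hecke_bar S sc T \<iota> \<longleftrightarrow>
     \<iota> 1 = 1 \<and> (\<forall>g h. \<iota> (g + h) = \<iota> g + \<iota> h) \<and> (\<forall>g h. \<iota> (g * h) = \<iota> g * \<iota> h) \<and>
     (\<forall>a h. \<iota> (sc a * h) = sc (lbar a) * \<iota> h) \<and> (\<forall>h. \<iota> (\<iota> h) = h) \<and>
     (\<forall>s\<in>S. \<iota> (T s) * T s = 1 \<and> T s * \<iota> (T s) = 1)"

text \<open>\<open>R\<^sub>w\<^sub>,\<^sub>z\<close>\<close>
definition R_poly :: "('w, 'c) monoid_scheme \<Rightarrow> 'w set \<Rightarrow> (int laurent \<Rightarrow> 'h::ring_1) \<Rightarrow>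
    ('w \<Rightarrow> 'h) \<Rightarrow> ('h \<Rightarrow> 'h) \<Rightarrow> 'w \<Rightarrow> 'w \<Rightarrow> int laurent" where
  "R_poly G S sc T \<iota> w z = hecke_coeff G S sc T (\<iota> (hecke_T G S T z)) w"

section \<open>W-graph algebras\<close>

text \<open>\<open>-v\<^sub>s\<^sup>-\<^sup>1e\<^sub>s + v\<^sub>s(1 - e\<^sub>s) + \<Sum>\<^sub>\<gamma> v\<^sup>\<gamma>x\<^sub>s\<^sub>,\<^sub>\<gamma>\<close> with \<open>n = L(s)\<close>, over any ring.\<close>
definition j_T :: "int \<Rightarrow> 'a::ring_1 \<Rightarrow> (int \<Rightarrow> 'a) \<Rightarrow> 'a laurent" where
  "j_T n e x = - Poly_Mapping.single (- n) e + Poly_Mapping.single n (1 - e)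
     + (\<Sum>\<gamma>\<in>{-n<..<n}. Poly_Mapping.single \<gamma> (x \<gamma>))"

datatype 'w wgen = Evar 'w | Xvar 'w int

definition wgens :: "'w set \<Rightarrow> ('w \<Rightarrow> int) \<Rightarrow> 'w wgen set" where
  "wgens J L = {Evar s | s. s \<in> J} \<union> {Xvar s \<gamma> | s \<gamma>. s \<in> J \<and> - L s < \<gamma> \<and> \<gamma> < L s}"

definition free_E :: "'w \<Rightarrow> ('w wgen fword \<Rightarrow>\<^sub>0 int)" where
  "free_E s = free_gen (Evar s)"

definition free_X :: "'w \<Rightarrow> int \<Rightarrow> ('w wgen fword \<Rightarrow>\<^sub>0 int)" where
  "free_X s \<gamma> = free_gen (Xvar s \<gamma>)"

definition free_jT :: "('w \<Rightarrow> int) \<Rightarrow> 'w \<Rightarrow> ('w wgen fword \<Rightarrow>\<^sub>0 int) laurent" where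
  "free_jT L s = j_T (L s) (free_E s) (free_X s)"

text \<open>\<open>y\<^sup>\<gamma>(s,t)\<close>\<close>
definition free_y :: "('w, 'c) monoid_scheme \<Rightarrow> ('w \<Rightarrow> int) \<Rightarrow> 'w \<Rightarrow> 'w \<Rightarrow> int \<Rightarrow>
    ('w wgen fword \<Rightarrow>\<^sub>0 int)" where
  "free_y G L s t \<gamma> = Poly_Mapping.lookup
     (prod_list (alt_list (cox_m G s t) (free_jT L s) (free_jT L t))
      - prod_list (alt_list (cox_m G s t) (free_jT L t) (free_jT L s))) \<gamma>"

text \<open>The relations of \<open>\<Omega>\<^sub>J\<close>. The order of \<open>st\<close> is the same in \<open>W\<^sub>J\<close> and in \<open>W\<close>.\<close>
definition omega_rels :: "('w, 'c) monoid_scheme \<Rightarrow> 'w set \<Rightarrow> ('w \<Rightarrow> int) \<Rightarrow>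
    ('w wgen fword \<Rightarrow>\<^sub>0 int) set" where
  "omega_rels G J L =
     {free_E s * free_E s - free_E s | s. s \<in> J}
   \<union> {free_E s * free_E t - free_E t * free_E s | s t. s \<in> J \<and> t \<in> J}
   \<union> {free_E s * free_X s \<gamma> - free_X s \<gamma> | s \<gamma>. s \<in> J \<and> - L s < \<gamma> \<and> \<gamma> < L s}
   \<union> {free_X s \<gamma> * free_E s | s \<gamma>. s \<in> J \<and> - L s < \<gamma> \<and> \<gamma> < L s}
   \<union> {free_X s \<gamma> - free_X s (- \<gamma>) | s \<gamma>. s \<in> J \<and> - L s < \<gamma> \<and> \<gamma> < L s}
   \<union> {free_y G L s t \<gamma> | s t \<gamma>. s \<in> J \<and> t \<in> J \<and> cox_m G s t \<noteq> 0}"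

definition omega_algebra :: "('w, 'c) monoid_scheme \<Rightarrow> 'w set \<Rightarrow> ('w \<Rightarrow> int) \<Rightarrow>
    ('w \<Rightarrow> 'o::ring_1) \<Rightarrow> ('w \<Rightarrow> int \<Rightarrow> 'o) \<Rightarrow> bool" where
  "omega_algebra G J L E X \<longleftrightarrow>
     presented_algebra (of_int :: int \<Rightarrow> 'o) (\<lambda>g. case g of Evar s \<Rightarrow> E s | Xvar s \<gamma> \<Rightarrow> X s \<gamma>)
       (wgens J L) (omega_rels G J L)"

definition omega_T :: "('w \<Rightarrow> int) \<Rightarrow> ('w \<Rightarrow> 'o::ring_1) \<Rightarrow> ('w \<Rightarrow> int \<Rightarrow> 'o) \<Rightarrow> 'w \<Rightarrow> 'o laurent" where
  "omega_T L E X s = j_T (L s) (E s) (X s)"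

text \<open>\<open>C\<^sub>s = T\<^sub>s - v\<^sub>s\<close> in \<open>\<int>[\<Gamma>]\<Omega>\<close>\<close>
definition omega_C :: "('w \<Rightarrow> int) \<Rightarrow> ('w \<Rightarrow> 'o::ring_1) \<Rightarrow> ('w \<Rightarrow> int \<Rightarrow> 'o) \<Rightarrow> 'w \<Rightarrow> 'o laurent" where
  "omega_C L E X s = omega_T L E X s - vpow (L s)"

text \<open>The embedding \<open>H\<^sub>J \<rightarrow> \<int>[\<Gamma>]\<Omega>\<^sub>J\<close>, \<open>T\<^sub>s \<mapsto> j(T\<^sub>s)\<close>, computed on the basis \<open>(T\<^sub>w)\<close> of \<open>H\<^sub>J\<close>;
  only meaningful on \<^const>\<open>hecke_par\<close>.\<close>
definition hecke_embed :: "('w, 'c) monoid_scheme \<Rightarrow> 'w set \<Rightarrow> ('w \<Rightarrow> int) \<Rightarrow> 'w set \<Rightarrow>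
    (int laurent \<Rightarrow> 'h::ring_1) \<Rightarrow> ('w \<Rightarrow> 'h) \<Rightarrow>
    ('w \<Rightarrow> 'o::ring_1) \<Rightarrow> ('w \<Rightarrow> int \<Rightarrow> 'o) \<Rightarrow> 'h \<Rightarrow> 'o laurent" where
  "hecke_embed G S L J sc T E X h =
     Sum_any (\<lambda>w. if w \<in> generate G J
       then Poly_Mapping.map of_int (hecke_coeff G S sc T h w)
              * prod_list (map (omega_T L E X) (reduced_word G S w))
       else 0)"

section \<open>The elements p and mu\<close>

definition r_elem :: "('w, 'c) monoid_scheme \<Rightarrow> 'w set \<Rightarrow> ('w \<Rightarrow> int) \<Rightarrow> 'w set \<Rightarrow>
    (int laurent \<Rightarrow> 'h::ring_1) \<Rightarrow> ('w \<Rightarrow> 'h) \<Rightarrow> ('h \<Rightarrow> 'h) \<Rightarrow>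
    ('w \<Rightarrow> 'o::ring_1) \<Rightarrow> ('w \<Rightarrow> int \<Rightarrow> 'o) \<Rightarrow> 'w \<Rightarrow> 'w \<Rightarrow> 'o laurent" where
  "r_elem G S L J sc T \<iota> E X x z =
     hecke_embed G S L J sc T E X
       (Sum_any (\<lambda>y. if y \<in> generate G J
          then sc (R_poly G S sc T \<iota> (x \<otimes>\<^bsub>G\<^esub> y) z) * hecke_T G S T y
          else 0))"

definition p_family :: "('w, 'c) monoid_scheme \<Rightarrow> 'w set \<Rightarrow> ('w \<Rightarrow> int) \<Rightarrow> 'w set \<Rightarrow>
    (int laurent \<Rightarrow> 'h::ring_1) \<Rightarrow> ('w \<Rightarrow> 'h) \<Rightarrow> ('h \<Rightarrow> 'h) \<Rightarrow>
    ('w \<Rightarrow> 'o::ring_1) \<Rightarrow> ('w \<Rightarrow> int \<Rightarrow> 'o) \<Rightarrow> ('w \<Rightarrow> 'w \<Rightarrow> 'o laurent) \<Rightarrow> bool" where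
  "p_family G S L J sc T \<iota> E X p \<longleftrightarrow>
     (\<forall>x\<in>DJ G S J. \<forall>z\<in>DJ G S J.
        Poly_Mapping.keys (p x z) \<subseteq> {0..} \<and>
        p z z = 1 \<and>
        (\<not> bruhat_le G S x z \<longrightarrow> p x z = 0) \<and>
        (bruhat_less G S x z \<longrightarrow> Poly_Mapping.keys (p x z) \<subseteq> {0<..}) \<and>
        p x z = (\<Sum>y\<in>{y \<in> DJ G S J. bruhat_le G S x y \<and> bruhat_le G S y z}.
                   r_elem G S L J sc T \<iota> E X x y * lbar (p y z)))"

text \<open>The term called \<open>R\<close> in condition (iii) of the characterisation of the \<open>\<mu>\<close>; the four cases
  arise from \<open>z\<close> in \<open>D\<^sup>+\<close> or \<open>D\<^sup>0\<close>, and \<open>x\<close> in \<open>D\<^sup>0\<close> or \<open>D\<^sup>-\<close>.\<close>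
definition mu_R :: "('w, 'c) monoid_scheme \<Rightarrow> 'w set \<Rightarrow> ('w \<Rightarrow> int) \<Rightarrow> 'w set \<Rightarrow>
    ('w \<Rightarrow> 'o::ring_1) \<Rightarrow> ('w \<Rightarrow> int \<Rightarrow> 'o) \<Rightarrow> ('w \<Rightarrow> 'w \<Rightarrow> 'o laurent) \<Rightarrow>
    'w \<Rightarrow> 'w \<Rightarrow> 'w \<Rightarrow> 'o laurent" where
  "mu_R G S L J E X p s x z =
     (if z \<in> DJ_plus G S J s
      then (if x \<in> DJ_zero G S J s
            then - (omega_C L E X (conj_by G s x) * p x z)
            else vpow (- L s) * p x z)
      else (if x \<in> DJ_zero G S J s
            then p x z * omega_C L E X (conj_by G s z) - omega_C L E X (conj_by G s x) * p x z
            else p x z * omega_C L E X (conj_by G s z) + vpow (- L s) * p x z))"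

definition mu_family :: "('w, 'c) monoid_scheme \<Rightarrow> 'w set \<Rightarrow> ('w \<Rightarrow> int) \<Rightarrow> 'w set \<Rightarrow>
    ('w \<Rightarrow> 'o::ring_1) \<Rightarrow> ('w \<Rightarrow> int \<Rightarrow> 'o) \<Rightarrow> ('w \<Rightarrow> 'w \<Rightarrow> 'o laurent) \<Rightarrow>
    ('w \<Rightarrow> 'w \<Rightarrow> 'w \<Rightarrow> 'o laurent) \<Rightarrow> bool" where
  "mu_family G S L J E X p \<mu> \<longleftrightarrow>
     (\<forall>s\<in>S. \<forall>x\<in>DJ G S J. \<forall>z\<in>DJ G S J.
        (\<not> (bruhat_less G S x z \<and> z \<in> DJ_plus G S J s \<union> DJ_zero G S J s
             \<and> x \<in> DJ_zero G S J s \<union> DJ_minus G S J s) \<longrightarrow> \<mu> s x z = 0) \<and>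
        lbar (\<mu> s x z) = \<mu> s x z \<and>
        (z \<in> DJ_plus G S J s \<union> DJ_zero G S J s \<longrightarrow> x \<in> DJ_zero G S J s \<union> DJ_minus G S J s \<longrightarrow>
           Poly_Mapping.keys (\<mu> s x z + mu_R G S L J E X p s x z
             + (\<Sum>y\<in>{y \<in> DJ G S J. bruhat_less G S x y \<and> bruhat_less G S y z}. p x y * \<mu> s y z))
             \<subseteq> {0<..}))"

section \<open>Modules\<close>

text \<open>A \<open>k\<Omega>\<^sub>J\<close>-module, as a \<open>k\<close>-module with a ring homomorphism from \<open>\<Omega>\<^sub>J\<close> to its
  \<open>k\<close>-linear endomorphisms.\<close>
definition omega_module :: "('k::comm_ring_1 \<Rightarrow> 'm::ab_group_add \<Rightarrow> 'm) \<Rightarrow>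
    ('o::ring_1 \<Rightarrow> 'm \<Rightarrow> 'm) \<Rightarrow> bool" where
  "omega_module sM act \<longleftrightarrow>
     Modules.module sM \<and> (\<forall>a. Modules.module_hom sM sM (act a)) \<and>
     (\<forall>m. act 1 m = m) \<and> (\<forall>a b m. act (a + b) m = act a m + act b m) \<and>
     (\<forall>a b m. act (a * b) m = act a (act b m))"

definition basis_of :: "('k::comm_ring_1 \<Rightarrow> 'm::ab_group_add \<Rightarrow> 'm) \<Rightarrow> 'm set \<Rightarrow> 'm set \<Rightarrow> bool" where
  "basis_of sc N B \<longleftrightarrow> \<not> Modules.module.dependent sc B \<and> Modules.module.span sc B = N"

text \<open>The entry in row \<open>a\<close>, column \<open>b\<close> of the matrix of \<open>f\<close> with respect to the basis \<open>B\<close>.\<close>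
definition mat_entry :: "('k::comm_ring_1 \<Rightarrow> 'm::ab_group_add \<Rightarrow> 'm) \<Rightarrow> 'm set \<Rightarrow> ('m \<Rightarrow> 'm) \<Rightarrow>
    'm \<Rightarrow> 'm \<Rightarrow> 'k" where
  "mat_entry sc B f a b = Modules.module.representation sc B (f b) a"

definition zmul :: "int \<Rightarrow> 'a::ab_group_add \<Rightarrow> 'a" where
  "zmul n x = (\<Sum>i<nat n. x) - (\<Sum>i<nat (- n). x)"

definition frag_lift :: "('b \<Rightarrow> 'a::ab_group_add) \<Rightarrow> ('b \<Rightarrow>\<^sub>0 int) \<Rightarrow> 'a" where
  "frag_lift t f = (\<Sum>b\<in>Poly_Mapping.keys f. zmul (Poly_Mapping.lookup f b) (t b))"

inductive_set tensor_rels :: "'h::ring_1 set \<Rightarrow> ('h \<Rightarrow> 'v::ab_group_add \<Rightarrow> 'v) \<Rightarrow>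
    (('h \<times> 'v) \<Rightarrow>\<^sub>0 int) set" for A actV where
  zero: "0 \<in> tensor_rels A actV"
| addl: "frag_of (g + h, u) - frag_of (g, u) - frag_of (h, u) \<in> tensor_rels A actV"
| addr: "frag_of (h, u + w) - frag_of (h, u) - frag_of (h, w) \<in> tensor_rels A actV"
| bal: "c \<in> A \<Longrightarrow> frag_of (h * c, u) - frag_of (h, actV c u) \<in> tensor_rels A actV"
| add: "f \<in> tensor_rels A actV \<Longrightarrow> g \<in> tensor_rels A actV \<Longrightarrow> f + g \<in> tensor_rels A actV"
| neg: "f \<in> tensor_rels A actV \<Longrightarrow> - f \<in> tensor_rels A actV"

text \<open>The group \<open>'i\<close> is the tensor product of the ring \<open>'h\<close> and \<open>'v\<close> over the subring \<open>A\<close> of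
  \<open>'h\<close>, with \<open>t h u\<close> being \<open>h \<otimes> u\<close>.\<close>
definition tensor_product :: "'h::ring_1 set \<Rightarrow> ('h \<Rightarrow> 'v::ab_group_add \<Rightarrow> 'v) \<Rightarrow>
    ('h \<Rightarrow> 'v \<Rightarrow> 'i::ab_group_add) \<Rightarrow> bool" where
  "tensor_product A actV t \<longleftrightarrow>
     (\<forall>i. \<exists>f. frag_lift (case_prod t) f = i) \<and>
     (\<forall>f. frag_lift (case_prod t) f = 0 \<longleftrightarrow> f \<in> tensor_rels A actV)"

definition add_hom :: "('a::ab_group_add \<Rightarrow> 'b::ab_group_add) \<Rightarrow> bool" where
  "add_hom f \<longleftrightarrow> (\<forall>x y. f (x + y) = f x + f y)"

text \<open>\<open>Ind(V) = H \<otimes> V\<close> over \<open>H\<^sub>J\<close> for \<open>V = k[\<Gamma>] \<otimes> M\<close>, with its actions \<open>scI\<close> of \<open>k[\<Gamma>]\<close> and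
  \<open>actI\<close> of \<open>H\<close>, and its semilinear involution \<open>\<iota>I\<close>.\<close>
definition induced_module :: "('w, 'c) monoid_scheme \<Rightarrow> 'w set \<Rightarrow> ('w \<Rightarrow> int) \<Rightarrow> 'w set \<Rightarrow>
    (int laurent \<Rightarrow> 'h::ring_1) \<Rightarrow> ('w \<Rightarrow> 'h) \<Rightarrow> ('h \<Rightarrow> 'h) \<Rightarrow>
    ('w \<Rightarrow> 'o::ring_1) \<Rightarrow> ('w \<Rightarrow> int \<Rightarrow> 'o) \<Rightarrow>
    ('k::comm_ring_1 \<Rightarrow> 'm::ab_group_add \<Rightarrow> 'm) \<Rightarrow> ('o \<Rightarrow> 'm \<Rightarrow> 'm) \<Rightarrow>
    ('h \<Rightarrow> 'm laurent \<Rightarrow> 'i::ab_group_add) \<Rightarrow> ('k laurent \<Rightarrow> 'i \<Rightarrow> 'i) \<Rightarrow> ('h \<Rightarrow> 'i \<Rightarrow> 'i) \<Rightarrow>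
    ('i \<Rightarrow> 'i) \<Rightarrow> bool" where
  "induced_module G S L J sc T \<iota> E X sM act tens scI actI \<iota>I \<longleftrightarrow>
     tensor_product (hecke_par G S J sc T)
       (\<lambda>h u. lact act (hecke_embed G S L J sc T E X h) u) tens \<and>
     (\<forall>a. add_hom (scI a) \<and> (\<forall>h u. scI a (tens h u) = tens h (lact sM a u))) \<and>
     (\<forall>g. add_hom (actI g) \<and> (\<forall>h u. actI g (tens h u) = tens (g * h) u)) \<and>
     add_hom \<iota>I \<and> (\<forall>h u. \<iota>I (tens h u) = tens (\<iota> h) (lbar u))"

section \<open>Howlett--Yin induction\<close>

text \<open>\<open>HY(M)\<close> consists of the finitely supported functions \<open>'w \<Rightarrow>\<^sub>0 'm\<close> supported in \<open>D\<^sub>J\<close>;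
  the element \<open>z|m\<close> is \<open>single z m\<close>. The maps below are the actions of \<open>k\<close>, of \<open>e\<^sub>s\<close> and of
  \<open>x\<^sub>s\<^sub>,\<^sub>\<gamma>\<close>.\<close>

definition hy_scale :: "('k \<Rightarrow> 'm \<Rightarrow> 'm) \<Rightarrow> 'k \<Rightarrow> ('w \<Rightarrow>\<^sub>0 'm) \<Rightarrow> ('w \<Rightarrow>\<^sub>0 'm::ab_group_add)" where
  "hy_scale sM c f = Poly_Mapping.map (sM c) f"

definition hy_e :: "('w, 'c) monoid_scheme \<Rightarrow> 'w set \<Rightarrow> 'w set \<Rightarrow> ('w \<Rightarrow> 'o) \<Rightarrow>
    ('o \<Rightarrow> 'm \<Rightarrow> 'm) \<Rightarrow> 'w \<Rightarrow> ('w \<Rightarrow>\<^sub>0 'm) \<Rightarrow> ('w \<Rightarrow>\<^sub>0 'm::ab_group_add)" where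
  "hy_e G S J E act s f = (\<Sum>z\<in>Poly_Mapping.keys f. let m = Poly_Mapping.lookup f z in
     if z \<in> DJ_plus G S J s then 0
     else if z \<in> DJ_zero G S J s then Poly_Mapping.single z (act (E (conj_by G s z)) m)
     else Poly_Mapping.single z m)"

definition hy_x :: "('w, 'c) monoid_scheme \<Rightarrow> 'w set \<Rightarrow> 'w set \<Rightarrow> ('w \<Rightarrow> int \<Rightarrow> 'o::zero) \<Rightarrow>
    ('w \<Rightarrow> 'w \<Rightarrow> 'w \<Rightarrow> 'o laurent) \<Rightarrow> ('o \<Rightarrow> 'm \<Rightarrow> 'm) \<Rightarrow> 'w \<Rightarrow> int \<Rightarrow>
    ('w \<Rightarrow>\<^sub>0 'm) \<Rightarrow> ('w \<Rightarrow>\<^sub>0 'm::ab_group_add)" where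
  "hy_x G S J X \<mu> act s \<gamma> f = (\<Sum>z\<in>Poly_Mapping.keys f. let m = Poly_Mapping.lookup f z;
       q = (\<Sum>x\<in>{x \<in> DJ G S J. bruhat_less G S x z}.
              Poly_Mapping.single x (act (Poly_Mapping.lookup (\<mu> s x z) \<gamma>) m)) in
     if z \<in> DJ_plus G S J s then q + (if \<gamma> = 0 then Poly_Mapping.single (s \<otimes>\<^bsub>G\<^esub> z) m else 0)
     else if z \<in> DJ_zero G S J s then q + Poly_Mapping.single z (act (X (conj_by G s z) \<gamma>) m)
     else 0)"

text \<open>The action of \<open>x\<^sub>s = \<Sum>\<^sub>\<gamma> v\<^sup>\<gamma>x\<^sub>s\<^sub>,\<^sub>\<gamma>\<close> on \<open>k[\<Gamma>] \<otimes> N\<close>, where \<open>xop \<gamma>\<close> is the action of \<open>x\<^sub>s\<^sub>,\<^sub>\<gamma>\<close> on \<open>N\<close>.\<close>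
definition x_total :: "int \<Rightarrow> (int \<Rightarrow> 'n \<Rightarrow> 'n) \<Rightarrow> 'n laurent \<Rightarrow> 'n::ab_group_add laurent" where
  "x_total n xop F = (\<Sum>\<gamma>\<in>{-n<..<n}. \<Sum>j\<in>Poly_Mapping.keys F.
     Poly_Mapping.single (\<gamma> + j) (xop \<gamma> (Poly_Mapping.lookup F j)))"

text \<open>The canonicalisation, i.e. the \<open>k[\<Gamma>]\<close>-linear map with \<open>z|m \<mapsto> \<Sum>\<^sub>y T\<^sub>y \<otimes> p\<^sub>y\<^sub>,\<^sub>zm\<close>.\<close>
definition canonicalisation :: "('w, 'c) monoid_scheme \<Rightarrow> 'w set \<Rightarrow> 'w set \<Rightarrow> ('w \<Rightarrow> 'h::ring_1) \<Rightarrow>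
    ('w \<Rightarrow> 'w \<Rightarrow> 'o::ring_1 laurent) \<Rightarrow> ('o \<Rightarrow> 'm::ab_group_add \<Rightarrow> 'm) \<Rightarrow>
    ('h \<Rightarrow> 'm laurent \<Rightarrow> 'i::ab_group_add) \<Rightarrow> ('k::comm_ring_1 laurent \<Rightarrow> 'i \<Rightarrow> 'i) \<Rightarrow>
    ('w \<Rightarrow>\<^sub>0 'm) laurent \<Rightarrow> 'i" where
  "canonicalisation G S J T p act tens scI F =
     (\<Sum>\<gamma>\<in>Poly_Mapping.keys F. scI (vpow \<gamma>) (\<Sum>z\<in>Poly_Mapping.keys (Poly_Mapping.lookup F \<gamma>).
        Sum_any (\<lambda>y. if y \<in> DJ G S J
          then tens (hecke_T G S T y)
                 (lact act (p y z) (Poly_Mapping.single 0 (Poly_Mapping.lookup (Poly_Mapping.lookup F \<gamma>) z)))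
          else 0)))"

definition hy_basis :: "('w, 'c) monoid_scheme \<Rightarrow> 'w set \<Rightarrow> 'w set \<Rightarrow> ('w \<Rightarrow> 'h::ring_1) \<Rightarrow> 'm set \<Rightarrow>
    ('h \<Rightarrow> 'm::ab_group_add laurent \<Rightarrow> 'i::ab_group_add) \<Rightarrow> ('k::comm_ring_1 laurent \<Rightarrow> 'i \<Rightarrow> 'i) \<Rightarrow>
    ('i \<Rightarrow> 'i) \<Rightarrow> ('w \<Rightarrow> 'm \<Rightarrow> 'i) \<Rightarrow> bool" where
  "hy_basis G S J T B tens scI \<iota>I C \<longleftrightarrow>
     inj_on (case_prod C) (DJ G S J \<times> B) \<and>
     basis_of scI UNIV (case_prod C ` (DJ G S J \<times> B)) \<and>
     (\<forall>x\<in>DJ G S J. \<forall>b\<in>B.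
        \<iota>I (C x b) = C x b \<and>
        (\<exists>f. (\<forall>w. Poly_Mapping.keys (f w) \<subseteq> {0<..}) \<and>
             C x b = tens (hecke_T G S T x) (Poly_Mapping.single 0 b)
               + (\<Sum>w\<in>{w \<in> DJ G S J. bruhat_less G S w x}. tens (hecke_T G S T w) (f w))))"

section \<open>W-graphs\<close>

record ('v, 'w, 'r) wgraph =
  verts :: "'v set"
  vlabel :: "'v \<Rightarrow> 'w set"
  weight :: "'w \<Rightarrow> 'v \<Rightarrow> 'v \<Rightarrow> 'r"

text \<open>The W-graph of a \<open>k\<Omega>\<close>-module with basis \<open>B\<close>, given by the actions \<open>e\<close>, \<open>x\<close> of the generators.\<close>
definition module_wgraph :: "'w set \<Rightarrow> ('w \<Rightarrow> int) \<Rightarrow> ('k::comm_ring_1 \<Rightarrow> 'n::ab_group_add \<Rightarrow> 'n) \<Rightarrow>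
    ('w \<Rightarrow> 'n \<Rightarrow> 'n) \<Rightarrow> ('w \<Rightarrow> int \<Rightarrow> 'n \<Rightarrow> 'n) \<Rightarrow> 'n set \<Rightarrow> ('n, 'w, 'k laurent) wgraph" where
  "module_wgraph S L sN e x B =
     \<lparr>verts = B,
      vlabel = (\<lambda>b. {s \<in> S. e s b = b}),
      weight = (\<lambda>s a b. mat_entry (lact sN) (Poly_Mapping.single 0 ` B) (x_total (L s) (x s))
                  (Poly_Mapping.single 0 a) (Poly_Mapping.single 0 b))\<rparr>"

definition hy_wgraph :: "('w, 'c) monoid_scheme \<Rightarrow> 'w set \<Rightarrow> 'w set \<Rightarrow> ('w \<Rightarrow> 'h) \<Rightarrow> ('w \<Rightarrow> 'o) \<Rightarrow>
    ('o \<Rightarrow> 'm \<Rightarrow> 'm) \<Rightarrow> 'm set \<Rightarrow> ('k::comm_ring_1 laurent \<Rightarrow> 'i::ab_group_add \<Rightarrow> 'i) \<Rightarrow>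
    ('h \<Rightarrow> 'i \<Rightarrow> 'i) \<Rightarrow> ('w \<Rightarrow> 'm \<Rightarrow> 'i) \<Rightarrow> ('i, 'w, 'k laurent) wgraph" where
  "hy_wgraph G S J T E act B scI actI C =
     \<lparr>verts = case_prod C ` (DJ G S J \<times> B),
      vlabel = (\<lambda>c. {s \<in> S. \<exists>x\<in>DJ G S J. \<exists>b\<in>B. c = C x b \<and>
         (bruhat_less G S (s \<otimes>\<^bsub>G\<^esub> x) x \<or>
          (bruhat_less G S x (s \<otimes>\<^bsub>G\<^esub> x) \<and> s \<otimes>\<^bsub>G\<^esub> x \<notin> DJ G S J \<and>
           conj_by G s x \<in> {t \<in> J. act (E t) b = b}))}),
      weight = (\<lambda>s c d. if c = d then 0
         else mat_entry scI (case_prod C ` (DJ G S J \<times> B)) (actI (T s)) c d)\<rparr>"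

text \<open>Two W-graphs (over the same set \<open>S\<close>) are the same after identifying vertices via \<open>\<phi>\<close>.\<close>
definition same_wgraph_via :: "'w set \<Rightarrow> ('v \<Rightarrow> 'u) \<Rightarrow> ('v, 'w, 'r) wgraph \<Rightarrow> ('u, 'w, 'r) wgraph \<Rightarrow> bool" where
  "same_wgraph_via S \<phi> A B \<longleftrightarrow>
     bij_betw \<phi> (verts A) (verts B) \<and>
     (\<forall>b\<in>verts A. vlabel B (\<phi> b) = vlabel A b) \<and>
     (\<forall>s\<in>S. \<forall>a\<in>verts A. \<forall>b\<in>verts A. weight B s (\<phi> a) (\<phi> b) = weight A s a b)"

end

theory Submission
  imports Defs
begin

text \<open>
  The subgroups \<open>T\<^sub>y \<otimes> V\<close> of the induced module, for \<open>y \<in> D\<^sub>J\<close> and \<open>V = k[\<Gamma>]M\<close>, form a direct sum on which the involution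
  acts unitriangularly, with matrix \<open>r\<close>. Hence an invariant element whose coefficients involve only positive
  exponents vanishes: its topmost coefficient is fixed by the bar map. The recursion for \<open>p\<close> says that \<open>c(z|m)\<close> is
  invariant, so \<open>c(x|b)\<close> and \<open>C\<^sub>x\<^sub>,\<^sub>b\<close> agree.

  For the W-graphs one has to expand \<open>T\<^sub>sc(z|b)\<close>. As \<open>L(s) = 1\<close>, the elements \<open>\<mu>\<close> involve only the exponent 0, and
  the same vanishing principle shows that \<open>T\<^sub>sc(z|b) - vc(z|b)\<close> is the image under \<open>c\<close> of \<open>x\<^sub>s\<cdot>z|b\<close> whenever
  \<open>e\<^sub>s\<cdot>z|b = 0\<close>. If instead \<open>e\<^sub>s\<cdot>z|b = z|b\<close>, a variant of the principle gives \<open>T\<^sub>sc(z|b) = -v\<^sup>-\<^sup>1c(z|b)\<close>, and this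
  in turn forces \<open>\<mu>\<^sub>x\<^sub>,\<^sub>zb = 0\<close> for all \<open>x\<close>, so that \<open>x\<^sub>s\<cdot>z|b = 0\<close>.

  The bookkeeping in the Hecke algebra rests on its basis \<open>T\<^sub>w\<close>, and the combinatorics of the Coxeter group on the
  cocycle \<open>w \<mapsto> {t | l(wt) < l(w)}\<close> with values in the sets of reflections, which exists because the
  defining relators are sent to the empty set.
\<close>

section \<open>Coxeter groups\<close>

text \<open>Why the vanishing principle needs a variant: all coefficients of \<open>c(z|m)\<close>
  except the top one have positive exponents, but \<open>T_s + v^-1\<close> lowers exponents by up
  to one. On D^0 an invariant coefficient may therefore keep a constant term, which positivity alone
  cannot exclude. The way out is that \<open>T_t + v^-1 = (v + v^-1)(1 - e_t) + x_t\<close> is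
  controlled by the idempotent \<open>1 - e_t\<close>. The hypothesis L(s) = 1 acts in two places.
  The loss of one power of v is made up for by the positivity of p, which confines \<mu> to exponent
  0; and x_t has exponent 0 only, so x_t m lies in M and \<open>c(z|x_t m)\<close> makes sense. The
  two W-graphs define their weights differently, by the whole matrix of x_s and by the off-diagonal
  part of the matrix of T_s. They match because x_s has zero diagonal, which for z in D^0 rests on
  e_t x_t = x_t and x_t e_t = 0.\<close>

lemma alt_list_Suc: "alt_list (Suc n) a b = a # alt_list n b a"
proof -
  have "alt_list (Suc n) a b = a # map (\<lambda>i. if even (Suc i) then a else b) [0..<n]"
    unfolding alt_list_def by (simp only: upt_conv_Cons map_Suc_upt[symmetric] zero_less_Suc) (simp del: upt_Suc)
  also have "map (\<lambda>i. if even (Suc i) then a else b) [0..<n] = alt_list n b a"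
    by (auto simp: alt_list_def)
  finally show ?thesis .
qed

lemma alt_list_0 [simp]: "alt_list 0 a b = []"
  by (simp add: alt_list_def)

lemma length_alt_list [simp]: "length (alt_list n a b) = n"
  by (simp add: alt_list_def)

lemma set_alt_list: "set (alt_list n a b) \<subseteq> {a, b}"
  by (auto simp: alt_list_def)

lemma rev_alt_list: "rev (alt_list n a b) = (if even n then alt_list n b a else alt_list n a b)"
proof (rule nth_equalityI)
  fix i assume i: "i < length (rev (alt_list n a b))"
  then have "even (n - Suc i) \<longleftrightarrow> (even n \<longleftrightarrow> odd i)"
    by auto
  then show "rev (alt_list n a b) ! i = (if even n then alt_list n b a else alt_list n a b) ! i"
    using i by (auto simp: alt_list_def rev_nth)
qed simp

text \<open>Letters of S are involutions, so this writes the relator \<open>(st)^n\<close> as one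
  side of the braid relation times the inverse of the other.\<close>

lemma alt_list_double: "alt_list (2 * n) a b = alt_list n a b @ rev (alt_list n b a)"
proof (rule nth_equalityI)
  fix i assume "i < length (alt_list (2 * n) a b)"
  moreover have "even (i - n) \<longleftrightarrow> (even i \<longleftrightarrow> even n)" if "i \<ge> n"
    using that by auto
  ultimately show "alt_list (2 * n) a b ! i = (alt_list n a b @ rev (alt_list n b a)) ! i"
    unfolding rev_alt_list by (auto simp: alt_list_def nth_append)
qed simp

section \<open>Words in the generators\<close>

locale coxeter =
  fixes G :: "('w, 'c) monoid_scheme" (structure) and S :: "'w set"
  assumes coxeter_system: "coxeter_system G S"
begin

sublocale group G
  using coxeter_system by (simp add: coxeter_system_def)

lemma S_carrier: "s \<in> S \<Longrightarrow> s \<in> carrier G"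
  and S_square [simp]: "s \<in> S \<Longrightarrow> s \<otimes> s = \<one>"
  and generate_S: "generate G S = carrier G"
  and cong_Nil: "u \<in> lists S \<Longrightarrow> word_prod G u = \<one> \<Longrightarrow> cox_cong G S u []"
  using coxeter_system by (auto simp: coxeter_system_def)

lemma S_inv [simp]: "s \<in> S \<Longrightarrow> inv s = s"
  by (simp add: S_carrier inv_equality)

lemma S_square_left [simp]: "s \<in> S \<Longrightarrow> w \<in> carrier G \<Longrightarrow> s \<otimes> (s \<otimes> w) = w"
  by (simp add: S_carrier m_assoc[symmetric])

lemma S_square_right [simp]: "s \<in> S \<Longrightarrow> w \<in> carrier G \<Longrightarrow> w \<otimes> s \<otimes> s = w"
  by (simp add: S_carrier m_assoc)

lemma inv_cancel_left [simp]:
  assumes "a \<in> carrier G" "b \<in> carrier G"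
  shows "inv a \<otimes> (a \<otimes> b) = b" "a \<otimes> (inv a \<otimes> b) = b"
  using assms by (simp_all flip: m_assoc)

abbreviation wp :: "'w list \<Rightarrow> 'w" where "wp \<equiv> word_prod G"

lemma wp_Nil [simp]: "wp [] = \<one>" and wp_Cons [simp]: "wp (a # u) = a \<otimes> wp u"
  by (simp_all add: word_prod_def)

lemma wp_carrier: "set u \<subseteq> carrier G \<Longrightarrow> wp u \<in> carrier G"
  by (induction u) auto

lemma wp_S [simp]: "u \<in> lists S \<Longrightarrow> wp u \<in> carrier G"
  by (rule wp_carrier) (auto intro: S_carrier)

lemma wp_append: "set u \<subseteq> carrier G \<Longrightarrow> set v \<subseteq> carrier G \<Longrightarrow> wp (u @ v) = wp u \<otimes> wp v"
  by (induction u) (auto simp: wp_carrier m_assoc)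

lemma lists_S_carrier: "u \<in> lists S \<Longrightarrow> set u \<subseteq> carrier G"
  by (auto intro: S_carrier)

lemma wp_append_S [simp]: "u \<in> lists S \<Longrightarrow> v \<in> lists S \<Longrightarrow> wp (u @ v) = wp u \<otimes> wp v"
  by (simp add: wp_append lists_S_carrier)

lemma wp_rev [simp]: "u \<in> lists S \<Longrightarrow> wp (rev u) = inv (wp u)"
proof (induction u)
  case (Cons a u)
  then have "wp (rev u @ [a]) = wp (rev u) \<otimes> a"
    by (subst wp_append_S) (auto simp: S_carrier)
  with Cons show ?case by (simp add: inv_mult_group S_carrier)
qed simp

lemma ex_word_parabolic:
  assumes "J \<subseteq> S" "w \<in> generate G J"
  shows "\<exists>u\<in>lists J. wp u = w"
  using assms(2)
proof induction
  case (eng h1 h2)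
  then obtain u v where "u \<in> lists J" "wp u = h1" "v \<in> lists J" "wp v = h2" by blast
  then show ?case using assms(1) by (intro bexI[of _ "u @ v"]) (auto simp: wp_append_S in_lists_conv_set subset_iff)
next
  case one
  then show ?case by (intro bexI[of _ "[]"]) auto
next
  case (incl h)
  then show ?case using assms(1) by (intro bexI[of _ "[h]"]) (auto simp: S_carrier)
next
  case (inv h)
  then show ?case using assms(1) by (intro bexI[of _ "[h]"]) (auto simp: S_carrier subset_iff)
qed

lemma ex_word: "w \<in> carrier G \<Longrightarrow> \<exists>u\<in>lists S. wp u = w"
  using ex_word_parabolic[of S w] by (simp add: generate_S)

lemma wp_parabolic: "J \<subseteq> S \<Longrightarrow> u \<in> lists J \<Longrightarrow> wp u \<in> generate G J"
  by (induction u) (auto intro: generate.intros)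


section \<open>The reflection cocycle on words\<close>

lemma reflections_carrier: "t \<in> reflections G S \<Longrightarrow> t \<in> carrier G"
  by (auto simp: reflections_def S_carrier)

lemma S_reflections: "s \<in> S \<Longrightarrow> s \<in> reflections G S"
  unfolding reflections_def by (rule CollectI, rule exI[of _ \<one>], rule exI[of _ s]) (auto simp: S_carrier)

lemma reflection_square [simp]: assumes "t \<in> reflections G S" shows "t \<otimes> t = \<one>"
proof -
  from assms obtain g s where "g \<in> carrier G" "s \<in> S" "t = g \<otimes> s \<otimes> inv g"
    by (auto simp: reflections_def)
  then show ?thesis
    by (simp add: S_carrier m_assoc inv_solve_left' flip: m_assoc[of "inv g" g])
qed

lemma conj_reflections:
  assumes "t \<in> reflections G S" "h \<in> carrier G" shows "inv h \<otimes> t \<otimes> h \<in> reflections G S"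
proof -
  from assms obtain g s where "g \<in> carrier G" "s \<in> S" "t = g \<otimes> s \<otimes> inv g"
    by (auto simp: reflections_def)
  then have "inv h \<otimes> t \<otimes> h = (inv h \<otimes> g) \<otimes> s \<otimes> inv (inv h \<otimes> g)"
    using assms by (simp add: S_carrier m_assoc inv_mult_group)
  then show ?thesis using assms \<open>s \<in> S\<close> \<open>g \<in> carrier G\<close> by (auto simp: reflections_def)
qed

lemma conj_eq_iff:
  assumes "a \<in> carrier G" "b \<in> carrier G" "h \<in> carrier G"
  shows "h \<otimes> a \<otimes> inv h = b \<longleftrightarrow> a = inv h \<otimes> b \<otimes> h"
  using assms by (metis inv_solve_left inv_solve_right m_assoc m_closed inv_closed)

text \<open>The reflections \<open>s\<^sub>k \<dots> s\<^sub>i \<dots> s\<^sub>k\<close> of a word \<open>s\<^sub>1 \<dots> s\<^sub>k\<close> that occur an odd number of times.\<close>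
primrec odd_refl :: "'w list \<Rightarrow> 'w set" where
  "odd_refl [] = {}"
| "odd_refl (s # u) = sym_diff (odd_refl u) {inv (wp u) \<otimes> s \<otimes> wp u}"

lemma odd_refl_reflections: "u \<in> lists S \<Longrightarrow> odd_refl u \<subseteq> reflections G S"
proof (induction u)
  case (Cons s u)
  then show ?case
    using conj_reflections[of s "wp u"] by (auto simp: S_reflections)
qed simp

text \<open>Appending v conjugates the reflections of u by v and leaves those of v alone. This is
  the cocycle rule N(uv) = N(v) + v^-1 N(u) v, with symmetric difference as addition.\<close>

lemma odd_refl_append:
  assumes "u \<in> lists S" "v \<in> lists S" "r \<in> carrier G"
  shows "r \<in> odd_refl (u @ v) \<longleftrightarrow> (r \<in> odd_refl v) \<noteq> (wp v \<otimes> r \<otimes> inv (wp v) \<in> odd_refl u)"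
  using assms(1)
proof (induction u)
  case (Cons s u)
  have "r = inv (wp (u @ v)) \<otimes> s \<otimes> wp (u @ v) \<longleftrightarrow> wp v \<otimes> r \<otimes> inv (wp v) = inv (wp u) \<otimes> s \<otimes> wp u"
    using Cons assms by (subst conj_eq_iff) (auto simp: S_carrier m_assoc inv_mult_group)
  with Cons show ?case by auto
qed simp

text \<open>In the dihedral group of s and t the involution t inverts \<open>c = st\<close>, so
  conjugating t by a power of c doubles the exponent.\<close>

lemma alt_conj:
  assumes "s \<in> S" "t \<in> S"
  defines "c \<equiv> s \<otimes> t"
  shows "inv (c [^] (k::nat)) \<otimes> t \<otimes> c [^] k = t \<otimes> c [^] (2 * k)"
proof -
  have c: "c \<in> carrier G" using assms by (simp add: S_carrier)
  have *: "c [^] k \<otimes> t \<otimes> c [^] k = t"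
  proof (induction k)
    case (Suc k)
    have "c [^] Suc k = c \<otimes> c [^] k"
      using c nat_pow_comm[of c 1 k] by simp
    then have "c [^] Suc k \<otimes> t \<otimes> c [^] Suc k = (c [^] k \<otimes> c) \<otimes> t \<otimes> (c \<otimes> c [^] k)"
      by (metis nat_pow_Suc)
    also have "\<dots> = c [^] k \<otimes> (c \<otimes> t \<otimes> c) \<otimes> c [^] k"
      using c assms(1,2) S_carrier[OF assms(2)] by (simp add: m_assoc del: c_def)
    also have "c \<otimes> t \<otimes> c = t"
      using assms by (simp add: c_def S_carrier m_assoc)
    finally show ?case using Suc by simp
  qed (use assms in \<open>simp add: S_carrier\<close>)
  have "inv (c [^] k) \<otimes> t = t \<otimes> c [^] k"
    using * c assms by (metis S_carrier inv_closed inv_solve_left m_assoc m_closed nat_pow_closed)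
  then show ?thesis using c assms by (simp add: S_carrier m_assoc nat_pow_mult mult_2)
qed

text \<open>Alternating words with prescribed last letter t. Unlike those with prescribed first
  letter they are suffixes of one another, which fits the recursion of \<open>odd_refl\<close> on
  the head.\<close>

primrec alt_end :: "nat \<Rightarrow> 'w \<Rightarrow> 'w \<Rightarrow> 'w list" where
  "alt_end 0 s t = []"
| "alt_end (Suc k) s t = (if even k then t else s) # alt_end k s t"

lemma alt_list_eq_alt_end: "alt_list k s t = (if even k then alt_end k s t else alt_end k t s)"
  by (induction k arbitrary: s t) (auto simp: alt_list_Suc)

lemma alt_end_S: "s \<in> S \<Longrightarrow> t \<in> S \<Longrightarrow> alt_end k s t \<in> lists S"
  by (induction k) auto

lemma wp_alt_end:
  assumes "s \<in> S" "t \<in> S"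
  shows "wp (alt_end (2 * k) s t) = (s \<otimes> t) [^] k" "wp (alt_end (Suc (2 * k)) s t) = t \<otimes> (s \<otimes> t) [^] k"
proof -
  have "wp (alt_end (2 * k) s t) = (s \<otimes> t) [^] k" for k
  proof (induction k)
    case (Suc k)
    then have "wp (alt_end (2 * Suc k) s t) = (s \<otimes> t) \<otimes> (s \<otimes> t) [^] k"
      using assms by (simp add: S_carrier m_assoc)
    then show ?case
      using assms nat_pow_comm[of "s \<otimes> t" 1 k] by (simp add: S_carrier)
  qed simp
  then show "wp (alt_end (2 * k) s t) = (s \<otimes> t) [^] k" "wp (alt_end (Suc (2 * k)) s t) = t \<otimes> (s \<otimes> t) [^] k"
    by auto
qed

text \<open>This is the reflection of the letter put in front of \<open>alt_end k s t\<close>: a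
  conjugate of t for even k and of s for odd k, with the same form \<open>t c^k\<close> for
  \<open>c = st\<close> in both cases.\<close>

lemma alt_end_refl:
  assumes "s \<in> S" "t \<in> S"
  shows "inv (wp (alt_end k s t)) \<otimes> (if even k then t else s) \<otimes> wp (alt_end k s t) = t \<otimes> (s \<otimes> t) [^] k"
proof (cases "even k")
  case True
  then obtain j where "k = 2 * j" by (elim evenE)
  then show ?thesis using assms by (simp add: wp_alt_end alt_conj)
next
  case False
  then obtain j where k: "k = 2 * j + 1" by (elim oddE)
  let ?c = "s \<otimes> t"
  have c: "?c \<in> carrier G" using assms by (simp add: S_carrier)
  have "inv (t \<otimes> ?c [^] j) \<otimes> s \<otimes> (t \<otimes> ?c [^] j) = inv (?c [^] j) \<otimes> t \<otimes> (?c \<otimes> ?c [^] j)"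
    using c assms by (simp add: S_carrier m_assoc inv_mult_group)
  also have "?c \<otimes> ?c [^] j = ?c [^] j \<otimes> ?c"
    using c nat_pow_comm[of ?c 1 j] by simp
  also have "inv (?c [^] j) \<otimes> t \<otimes> (?c [^] j \<otimes> ?c) = (inv (?c [^] j) \<otimes> t \<otimes> ?c [^] j) \<otimes> ?c"
    using c assms by (simp add: S_carrier m_assoc)
  also have "\<dots> = t \<otimes> ?c [^] (2 * j) \<otimes> ?c" using assms by (simp add: alt_conj)
  finally show ?thesis using k c assms wp_alt_end(2)[OF assms, of j] by (simp add: S_carrier m_assoc)
qed

lemma odd_refl_alt_end:
  assumes "s \<in> S" "t \<in> S"
  shows "r \<in> odd_refl (alt_end k s t) \<longleftrightarrow> odd (card {i. i < k \<and> t \<otimes> (s \<otimes> t) [^] i = r})"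
proof (induction k)
  case (Suc k)
  have *: "{i. i < Suc k \<and> t \<otimes> (s \<otimes> t) [^] i = r} =
    {i. i < k \<and> t \<otimes> (s \<otimes> t) [^] i = r} \<union> (if t \<otimes> (s \<otimes> t) [^] k = r then {k} else {})"
    by (auto simp: less_Suc_eq)
  have "card {i. i < Suc k \<and> t \<otimes> (s \<otimes> t) [^] i = r} =
    card {i. i < k \<and> t \<otimes> (s \<otimes> t) [^] i = r} + (if t \<otimes> (s \<otimes> t) [^] k = r then 1 else 0)"
    unfolding * by (subst card_Un_disjoint) auto
  with Suc alt_end_refl[OF assms, of k] show ?case by (auto split: if_splits)
qed simp

text \<open>Counted from the right, the reflections of \<open>(st)^m\<close> are
  \<open>t c^i\<close> for i < 2m, with \<open>c = st\<close>. As \<open>c^m = 1\<close>, the same m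
  values are run through twice, so every multiplicity is even. For infinite order the relator is the
  empty word.\<close>

lemma odd_refl_relator:
  assumes "s \<in> S" "t \<in> S"
  shows "odd_refl (alt_list (2 * cox_m G s t) s t) = {}" "wp (alt_list (2 * cox_m G s t) s t) = \<one>"
proof -
  let ?m = "cox_m G s t" and ?c = "s \<otimes> t"
  have c: "?c \<in> carrier G" using assms by (simp add: S_carrier)
  have cm: "?c [^] ?m = \<one>" using c by (simp add: cox_m_def)
  have per: "?c [^] (i + ?m) = ?c [^] i" for i
    using c cm by (simp flip: nat_pow_mult)
  have "even (card {i. i < 2 * ?m \<and> t \<otimes> ?c [^] i = r})" for r
  proof -
    let ?A = "{i. i < ?m \<and> t \<otimes> ?c [^] i = r}"
    have "{i. i < 2 * ?m \<and> t \<otimes> ?c [^] i = r} = ?A \<union> (\<lambda>i. i + ?m) ` ?A"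
    proof (intro equalityI subsetI)
      fix i assume i: "i \<in> {i. i < 2 * ?m \<and> t \<otimes> ?c [^] i = r}"
      show "i \<in> ?A \<union> (\<lambda>i. i + ?m) ` ?A"
      proof (cases "i < ?m")
        case False
        then obtain j where "i = j + ?m" by (metis add.commute le_Suc_ex not_less)
        then show ?thesis using i per by auto
      qed (use i in auto)
    qed (use per in auto)
    moreover have "card ((\<lambda>i. i + ?m) ` ?A) = card ?A" by (rule card_image) (auto simp: inj_on_def)
    moreover have "?A \<inter> (\<lambda>i. i + ?m) ` ?A = {}" by auto
    ultimately show ?thesis by (simp add: card_Un_disjoint)
  qed
  then show "odd_refl (alt_list (2 * ?m) s t) = {}"
    using odd_refl_alt_end[OF assms, of _ "2 * ?m"] by (auto simp: alt_list_eq_alt_end)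
  show "wp (alt_list (2 * ?m) s t) = \<one>"
    using assms cm by (simp add: alt_list_eq_alt_end wp_alt_end)
qed

lemma alt_list_S: "s \<in> S \<Longrightarrow> t \<in> S \<Longrightarrow> alt_list k s t \<in> lists S"
  using set_alt_list[of k s t] by auto

text \<open>By the cocycle rule, a factor with trivial product and empty \<open>odd_refl\<close>,
  such as a relator, can be inserted anywhere without effect.\<close>

lemma cox_cong_odd_refl:
  assumes "cox_cong G S u v"
  shows "(u \<in> lists S \<longleftrightarrow> v \<in> lists S) \<and> (u \<in> lists S \<longrightarrow> wp u = wp v \<and> odd_refl u = odd_refl v)"
  using assms
proof induction
  case (relator s t u v)
  let ?a = "alt_list (2 * cox_m G s t) s t"
  have a: "?a \<in> lists S" using relator by (rule alt_list_S)
  have "odd_refl (u @ ?a @ v) = odd_refl (u @ v)" if u: "u \<in> lists S" and v: "v \<in> lists S"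
  proof -
    have "r \<in> odd_refl (u @ ?a @ v) \<longleftrightarrow> r \<in> odd_refl (u @ v)" if "r \<in> carrier G" for r
    proof -
      have "?a @ v \<in> lists S" using a v by simp
      moreover have "wp (?a @ v) = wp v"
        using a v relator by (simp add: odd_refl_relator)
      moreover have "r \<in> odd_refl (?a @ v) \<longleftrightarrow> r \<in> odd_refl v"
        using odd_refl_append[OF a v that] odd_refl_relator[OF relator] by simp
      ultimately show ?thesis
        using odd_refl_append[OF u _ that] v by simp
    qed
    moreover have "odd_refl (u @ ?a @ v) \<subseteq> carrier G" "odd_refl (u @ v) \<subseteq> carrier G"
      using odd_refl_reflections[of "u @ ?a @ v"] odd_refl_reflections[of "u @ v"] a u v reflections_carrier by auto
    ultimately show ?thesis by blast
  qed
  then show ?case using a relator by (auto simp: odd_refl_relator)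
qed auto

text \<open>The presentation speaks about words with product 1, so u and v are compared through
  \<open>u @ rev v\<close> and \<open>v @ rev v\<close>, both of which have empty
  \<open>odd_refl\<close>.\<close>

lemma odd_refl_cong:
  assumes "u \<in> lists S" "v \<in> lists S" "wp u = wp v"
  shows "odd_refl u = odd_refl v"
proof -
  have nil: "odd_refl (w @ rev v) = {}" if "w \<in> lists S" "wp w = wp v" for w
  proof -
    have "wp (w @ rev v) = \<one>" using that assms(2) by (subst wp_append_S) auto
    then show ?thesis
      using cox_cong_odd_refl[OF cong_Nil[of "w @ rev v"]] that assms(2) by (simp add: in_lists_conv_set ball_Un)
  qed
  have "r \<in> odd_refl u \<longleftrightarrow> r \<in> odd_refl v" if r: "r \<in> carrier G" for r
  proof -
    define q where "q = wp v \<otimes> r \<otimes> inv (wp v)"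
    have q: "q \<in> carrier G" "inv (wp v) \<otimes> q \<otimes> wp v = r"
      using r assms by (auto simp: q_def m_assoc)
    have rv: "rev v \<in> lists S" using assms by (simp add: in_lists_conv_set)
    show ?thesis
      using odd_refl_append[OF assms(1) rv q(1)] odd_refl_append[OF assms(2) rv q(1)] nil[OF assms(1,3)] nil[OF assms(2)]
        assms q by auto
  qed
  then show ?thesis
    using odd_refl_reflections[OF assms(1)] odd_refl_reflections[OF assms(2)] reflections_carrier by blast
qed


text \<open>The set of reflections \<open>t\<close> with \<open>l(wt) < l(w)\<close>, see \<open>len_mult_refl_less_iff\<close>.\<close>
definition right_inv :: "'w \<Rightarrow> 'w set" where
  "right_inv w = odd_refl (SOME u. u \<in> lists S \<and> wp u = w)"

lemma right_inv_wp: assumes "u \<in> lists S" shows "right_inv (wp u) = odd_refl u"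
proof -
  define v where "v = (SOME v. v \<in> lists S \<and> wp v = wp u)"
  have "v \<in> lists S \<and> wp v = wp u"
    unfolding v_def by (rule someI[of _ u]) (use assms in auto)
  then show ?thesis
    unfolding right_inv_def v_def[symmetric] using assms by (intro odd_refl_cong) auto
qed

lemma right_inv_reflections: assumes "w \<in> carrier G" shows "right_inv w \<subseteq> reflections G S"
  using ex_word[OF assms] odd_refl_reflections right_inv_wp by metis

lemma right_inv_one [simp]: "right_inv \<one> = {}"
  using right_inv_wp[of "[]"] by simp

lemma right_inv_S: "s \<in> S \<Longrightarrow> right_inv s = {s}"
  using right_inv_wp[of "[s]"] by (simp add: S_carrier)

lemma right_inv_mult:
  assumes "a \<in> carrier G" "b \<in> carrier G" "r \<in> carrier G"
  shows "r \<in> right_inv (a \<otimes> b) \<longleftrightarrow> (r \<in> right_inv b) \<noteq> (b \<otimes> r \<otimes> inv b \<in> right_inv a)"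
proof -
  obtain u v where u: "u \<in> lists S" "wp u = a" and v: "v \<in> lists S" "wp v = b"
    using ex_word assms by metis
  then have "right_inv (a \<otimes> b) = odd_refl (u @ v)"
    using right_inv_wp[of "u @ v"] by simp
  then show ?thesis
    using odd_refl_append[OF u(1) v(1) assms(3)] u v right_inv_wp by auto
qed

lemma right_inv_S_mult:
  assumes "s \<in> S" "w \<in> carrier G"
  shows "right_inv (s \<otimes> w) = sym_diff (right_inv w) {conj_by G s w}"
proof -
  obtain u where u: "u \<in> lists S" "wp u = w" using ex_word assms by metis
  then show ?thesis
    using right_inv_wp[of "s # u"] right_inv_wp[of u] assms by (simp add: conj_by_def)
qed

lemma conj_by_reflections: "s \<in> S \<Longrightarrow> w \<in> carrier G \<Longrightarrow> conj_by G s w \<in> reflections G S"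
  unfolding conj_by_def by (intro conj_reflections S_reflections)

lemma conj_by_carrier: "s \<in> S \<Longrightarrow> w \<in> carrier G \<Longrightarrow> conj_by G s w \<in> carrier G"
  by (rule reflections_carrier, rule conj_by_reflections)

lemma mult_conj_by: "s \<in> S \<Longrightarrow> w \<in> carrier G \<Longrightarrow> w \<otimes> conj_by G s w = s \<otimes> w"
  by (simp add: conj_by_def S_carrier m_assoc)

lemma finite_right_inv: assumes "w \<in> carrier G" shows "finite (right_inv w)"
proof -
  have "finite (odd_refl u)" for u by (induction u) auto
  then show ?thesis using ex_word[OF assms] right_inv_wp by metis
qed

section \<open>The exchange condition\<close>

lemma finite_odd_refl [simp]: "finite (odd_refl u)" by (induction u) auto

text \<open>The strong exchange condition: r is the reflection of some letter of u, and multiplying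
  by r on the right cancels precisely that letter.\<close>

lemma odd_refl_mem_delete:
  assumes "J \<subseteq> S" "u \<in> lists J" "r \<in> odd_refl u"
  shows "\<exists>i<length u. wp u \<otimes> r = wp (take i u @ drop (Suc i) u)"
  using assms(2,3)
proof (induction u)
  case (Cons s u)
  then have sS: "s \<in> S" and uS: "u \<in> lists S" using assms(1) by auto
  show ?case
  proof (cases "r \<in> odd_refl u")
    case True
    then obtain i where i: "i < length u" "wp u \<otimes> r = wp (take i u @ drop (Suc i) u)"
      using Cons by auto
    have "r \<in> carrier G" using True odd_refl_reflections[OF uS] reflections_carrier by blast
    then have "wp (s # u) \<otimes> r = s \<otimes> (wp u \<otimes> r)"
      using sS uS by (simp add: m_assoc S_carrier)
    then show ?thesis using i by (intro exI[of _ "Suc i"]) simp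
  next
    case False
    with Cons have "r = inv (wp u) \<otimes> s \<otimes> wp u" by auto
    then have "wp (s # u) \<otimes> r = wp u" using sS uS by (simp add: m_assoc S_carrier)
    then show ?thesis by (intro exI[of _ 0]) simp
  qed
qed simp

text \<open>A repeated reflection would allow the exchange condition to remove two letters.
  Minimality is taken among words over J; hence the lengths relative to J and to S are both the
  number of reflections.\<close>

lemma card_odd_refl_minimal:
  assumes "J \<subseteq> S" "u \<in> lists J" "\<forall>v\<in>lists J. wp v = wp u \<longrightarrow> length u \<le> length v"
  shows "card (odd_refl u) = length u"
  using assms(2,3)
proof (induction u rule: list.induct)
  case (Cons s u)
  then have sS: "s \<in> S" and uS: "u \<in> lists S" using assms(1) by auto
  have "length u \<le> length v" if "v \<in> lists J" "wp v = wp u" for v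
    using Cons.prems(2)[rule_format, of "s # v"] that Cons.prems(1) by simp
  then have IH: "card (odd_refl u) = length u" using Cons by auto
  have "inv (wp u) \<otimes> s \<otimes> wp u \<notin> odd_refl u"
  proof
    assume "inv (wp u) \<otimes> s \<otimes> wp u \<in> odd_refl u"
    then obtain i where i: "i < length u" "wp u \<otimes> (inv (wp u) \<otimes> s \<otimes> wp u) = wp (take i u @ drop (Suc i) u)"
      using odd_refl_mem_delete[OF assms(1), of u "inv (wp u) \<otimes> s \<otimes> wp u"] Cons.prems(1) by auto
    then have "wp (s # u) = wp (take i u @ drop (Suc i) u)"
      using sS uS by (simp add: m_assoc S_carrier)
    moreover have "take i u @ drop (Suc i) u \<in> lists J"
      using Cons.prems(1) by (auto dest: in_set_takeD in_set_dropD)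
    ultimately show False
      using Cons.prems(2)[rule_format, of "take i u @ drop (Suc i) u"] i by simp
  qed
  moreover from this have "odd_refl (s # u) = insert (inv (wp u) \<otimes> s \<otimes> wp u) (odd_refl u)" by auto
  ultimately show ?case using IH by simp
qed simp

lemma ex_minimal_word:
  assumes "J \<subseteq> S" "w \<in> generate G J"
  obtains u where "u \<in> lists J" "wp u = w" "\<And>v. v \<in> lists J \<Longrightarrow> wp v = w \<Longrightarrow> length u \<le> length v"
    "card (right_inv w) = length u"
proof -
  obtain u0 where u0: "u0 \<in> lists J" "wp u0 = w" using ex_word_parabolic[OF assms] by blast
  define u where "u = arg_min length (\<lambda>u. u \<in> lists J \<and> wp u = w)"
  have u: "u \<in> lists J" "wp u = w"
    using arg_min_natI[of "\<lambda>u. u \<in> lists J \<and> wp u = w" u0 length] u0 by (auto simp: u_def)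
  have min: "length u \<le> length v" if "v \<in> lists J" "wp v = w" for v
    using arg_min_nat_le[of "\<lambda>u. u \<in> lists J \<and> wp u = w" v length] that by (simp add: u_def)
  have "u \<in> lists S" using u assms(1) by auto
  then have "card (right_inv w) = length u"
    using card_odd_refl_minimal[OF assms(1) u(1)] min u(2) right_inv_wp[of u] by simp
  with u min that show thesis by blast
qed

section \<open>The length function\<close>

abbreviation l :: "'w \<Rightarrow> nat" where "l \<equiv> len G S"

lemma len_le: assumes "u \<in> lists S" shows "l (wp u) \<le> length u"
  unfolding len_def using assms by (intro Least_le) auto

lemma ex_reduced_word: assumes "w \<in> carrier G" shows "\<exists>u. u \<in> lists S \<and> wp u = w \<and> length u = l w"
proof -
  obtain u where "u \<in> lists S" "wp u = w" using ex_word[OF assms] by blast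
  then have "\<exists>n. \<exists>v\<in>lists S. length v = n \<and> wp v = w" by blast
  from LeastI_ex[OF this] show ?thesis unfolding len_def by blast
qed

lemma len_eq_card:
  assumes "w \<in> carrier G" shows "l w = card (right_inv w)"
proof -
  obtain u where u: "u \<in> lists S" "wp u = w" "card (right_inv w) = length u"
    "\<And>v. v \<in> lists S \<Longrightarrow> wp v = w \<Longrightarrow> length u \<le> length v"
    using ex_minimal_word[of S w] assms generate_S by (metis subset_refl)
  obtain v where "v \<in> lists S" "length v = l w" "wp v = w"
    using ex_reduced_word[OF assms] by blast
  then have "length u = l w" using u(4)[of v] len_le[of u] u(1,2) by simp
  then show ?thesis using u(3) by simp
qed

lemma reduced_word:
  assumes "w \<in> carrier G"
  shows "reduced_word G S w \<in> lists S" "wp (reduced_word G S w) = w" "length (reduced_word G S w) = l w"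
  using someI_ex[OF ex_reduced_word[OF assms]] by (auto simp: reduced_word_def)

text \<open>For \<open>t = g s g^-1\<close> the cocycle rule yields contributions of g and of its
  inverse that cancel; what remains is that s lies in its own set.\<close>

lemma reflection_mem_right_inv:
  assumes "t \<in> reflections G S" shows "t \<in> right_inv t"
proof -
  from assms obtain g s where g: "g \<in> carrier G" and s: "s \<in> S" and t: "t = g \<otimes> s \<otimes> inv g"
    by (auto simp: reflections_def)
  have tc: "t \<in> carrier G" using assms by (rule reflections_carrier)
  have 1: "inv g \<otimes> t \<otimes> g = s" using g s by (simp add: t m_assoc S_carrier)
  have 2: "s \<otimes> s \<otimes> inv s = s" using s by (simp add: S_carrier)
  have "t \<in> right_inv (inv g) \<longleftrightarrow> s \<in> right_inv g"
    using right_inv_mult[of g "inv g" t] g tc 1 by simp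
  moreover have "t \<in> right_inv (g \<otimes> s \<otimes> inv g) \<longleftrightarrow> (t \<in> right_inv (inv g)) \<noteq> (s \<in> right_inv (g \<otimes> s))"
    using right_inv_mult[of "g \<otimes> s" "inv g" t] g s tc 1 by (simp add: S_carrier)
  moreover have "s \<in> right_inv (g \<otimes> s) \<longleftrightarrow> s \<notin> right_inv g"
    using right_inv_mult[of g s s] g s by (simp add: S_carrier right_inv_S)
  ultimately show ?thesis using t by blast
qed

lemma right_inv_mult_refl:
  assumes "w \<in> carrier G" "t \<in> reflections G S"
  shows "t \<in> right_inv (w \<otimes> t) \<longleftrightarrow> t \<notin> right_inv w"
  using right_inv_mult[of w t t] assms reflection_mem_right_inv[OF assms(2)] reflections_carrier[OF assms(2)]
    inv_equality[OF reflection_square[OF assms(2)]] by simp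

lemma len_mult_refl_less:
  assumes "w \<in> carrier G" "t \<in> right_inv w" shows "l (w \<otimes> t) < l w"
proof -
  obtain u where u: "u \<in> lists S" "wp u = w" "length u = l w" using ex_reduced_word[OF assms(1)] by blast
  then obtain i where i: "i < length u" "w \<otimes> t = wp (take i u @ drop (Suc i) u)"
    using odd_refl_mem_delete[of S u t] assms right_inv_wp by auto
  have "take i u @ drop (Suc i) u \<in> lists S"
    using u by (auto dest: in_set_takeD in_set_dropD)
  then have "l (w \<otimes> t) \<le> length (take i u @ drop (Suc i) u)" unfolding i by (rule len_le)
  then show ?thesis using i u by simp
qed

lemma len_mult_refl_less_iff:
  assumes "w \<in> carrier G" "t \<in> reflections G S"
  shows "l (w \<otimes> t) < l w \<longleftrightarrow> t \<in> right_inv w" "l w < l (w \<otimes> t) \<longleftrightarrow> t \<notin> right_inv w"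
proof -
  have tc: "t \<in> carrier G" using assms reflections_carrier by blast
  have "l w < l (w \<otimes> t)" if "t \<notin> right_inv w"
    using len_mult_refl_less[of "w \<otimes> t" t] right_inv_mult_refl[OF assms] that assms tc by (simp add: m_assoc)
  then show "l (w \<otimes> t) < l w \<longleftrightarrow> t \<in> right_inv w" "l w < l (w \<otimes> t) \<longleftrightarrow> t \<notin> right_inv w"
    using len_mult_refl_less[OF assms(1)] by (metis not_less_iff_gr_or_eq)+
qed

lemma len_S_mult_iff:
  assumes "w \<in> carrier G" "s \<in> S"
  shows "l (s \<otimes> w) < l w \<longleftrightarrow> conj_by G s w \<in> right_inv w" "l w < l (s \<otimes> w) \<longleftrightarrow> conj_by G s w \<notin> right_inv w"
  using len_mult_refl_less_iff[OF assms(1) conj_by_reflections[OF assms(2,1)]] assms by (simp_all add: mult_conj_by)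

lemma len_S_mult:
  assumes "w \<in> carrier G" "s \<in> S"
  shows "l (s \<otimes> w) = (if conj_by G s w \<in> right_inv w then l w - 1 else l w + 1)"
proof (cases "conj_by G s w \<in> right_inv w")
  case True
  then have "right_inv (s \<otimes> w) = right_inv w - {conj_by G s w}"
    using right_inv_S_mult[OF assms(2,1)] by blast
  then show ?thesis using True assms by (simp add: len_eq_card S_carrier)
next
  case False
  then have "right_inv (s \<otimes> w) = insert (conj_by G s w) (right_inv w)"
    using right_inv_S_mult[OF assms(2,1)] by blast
  then show ?thesis using False assms finite_right_inv[OF assms(1)] by (simp add: len_eq_card S_carrier)
qed

lemma len_one [simp]: "l \<one> = 0" by (simp add: len_eq_card)

lemma len_eq_0: assumes "w \<in> carrier G" "l w = 0" shows "w = \<one>"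
proof -
  obtain u where "u \<in> lists S" "wp u = w" "length u = l w" using ex_reduced_word[OF assms(1)] by blast
  with assms show ?thesis by simp
qed

lemma len_inv [simp]: assumes "w \<in> carrier G" shows "l (inv w) = l w"
proof -
  have "l (inv w) \<le> l w" if w: "w \<in> carrier G" for w
  proof -
    obtain u where u: "u \<in> lists S" "wp u = w" "length u = l w" using ex_reduced_word[OF w] by blast
    then show ?thesis using len_le[of "rev u"] by (simp add: in_lists_conv_set)
  qed
  from this[of w] this[of "inv w"] assms show ?thesis by simp
qed

lemma l_cancel: "a \<otimes> b = a \<otimes> c \<Longrightarrow> a \<in> carrier G \<Longrightarrow> b \<in> carrier G \<Longrightarrow> c \<in> carrier G \<Longrightarrow> b = c"
  and r_cancel: "b \<otimes> a = c \<otimes> a \<Longrightarrow> a \<in> carrier G \<Longrightarrow> b \<in> carrier G \<Longrightarrow> c \<in> carrier G \<Longrightarrow> b = c"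
  by simp_all

section \<open>The Bruhat order\<close>

abbreviation bstep :: "'w \<Rightarrow> 'w \<Rightarrow> bool" where
  "bstep x y \<equiv> x \<in> carrier G \<and> (\<exists>t\<in>reflections G S. y = x \<otimes> t) \<and> l x < l y"

lemma bruhat_le_rtranclp: "bruhat_le G S = bstep\<^sup>*\<^sup>*"
  by (simp add: bruhat_le_def)

lemma bruhat_refl [simp]: "bruhat_le G S x x"
  by (simp add: bruhat_le_rtranclp)

lemma bruhat_trans: "bruhat_le G S x y \<Longrightarrow> bruhat_le G S y z \<Longrightarrow> bruhat_le G S x z"
  by (simp add: bruhat_le_rtranclp)

lemma bruhat_le_len: "bruhat_le G S x y \<Longrightarrow> x = y \<or> l x < l y"
  unfolding bruhat_le_rtranclp by (induction rule: rtranclp_induct) auto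

lemma bruhat_less_len: "bruhat_less G S x y \<Longrightarrow> l x < l y"
  using bruhat_le_len by (auto simp: bruhat_less_def)

lemma bruhat_antisym: "bruhat_le G S x y \<Longrightarrow> bruhat_le G S y x \<Longrightarrow> x = y"
  using bruhat_le_len[of x y] bruhat_le_len[of y x] by auto

lemma bruhat_le_carrier: "bruhat_le G S x y \<Longrightarrow> y \<in> carrier G \<Longrightarrow> x \<in> carrier G"
  unfolding bruhat_le_rtranclp by (erule converse_rtranclpE) auto

lemma bruhat_stepI:
  assumes "x \<in> carrier G" "t \<in> reflections G S" "l x < l (x \<otimes> t)"
  shows "bruhat_le G S x (x \<otimes> t)"
  unfolding bruhat_le_rtranclp using assms by (intro r_into_rtranclp) blast

text \<open>An element strictly below z lies below some \<open>zt\<close> with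
  \<open>l(zt) < l(z)\<close>, and these t form the finite set \<open>right_inv z\<close>.\<close>

lemma finite_bruhat_lower: "z \<in> carrier G \<Longrightarrow> finite {y. bruhat_le G S y z}"
proof (induction "l z" arbitrary: z rule: less_induct)
  case less
  have "{y. bruhat_le G S y z} \<subseteq> insert z (\<Union>t\<in>right_inv z. {y. bruhat_le G S y (z \<otimes> t)})"
  proof
    fix y assume "y \<in> {y. bruhat_le G S y z}"
    then have "bstep\<^sup>*\<^sup>* y z" by (simp add: bruhat_le_rtranclp)
    then show "y \<in> insert z (\<Union>t\<in>right_inv z. {y. bruhat_le G S y (z \<otimes> t)})"
    proof (cases rule: rtranclp.cases)
      case (rtrancl_into_rtrancl x)
      then obtain t where t: "t \<in> reflections G S" "z = x \<otimes> t" "x \<in> carrier G" "l x < l z" by blast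
      then have "x = z \<otimes> t" using reflections_carrier[of t] by (simp add: m_assoc)
      moreover have "t \<in> right_inv z"
        using t len_mult_refl_less_iff[OF t(3,1)] right_inv_mult_refl[OF t(3,1)] by simp
      ultimately show ?thesis
        using rtrancl_into_rtrancl by (auto simp: bruhat_le_rtranclp)
    qed simp
  qed
  moreover have "finite {y. bruhat_le G S y (z \<otimes> t)}" if "t \<in> right_inv z" for t
    using less that right_inv_reflections[OF less.prems] reflections_carrier len_mult_refl_less[OF less.prems that]
    by (intro less.hyps) auto
  ultimately show ?case
    using finite_right_inv[OF less.prems] by (meson finite_UN_I finite_insert finite_subset)
qed

lemma bruhat_less_S_mult_iff:
  assumes "x \<in> carrier G" "s \<in> S"
  shows "bruhat_less G S x (s \<otimes> x) \<longleftrightarrow> l x < l (s \<otimes> x)"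
  using bruhat_stepI[OF assms(1) conj_by_reflections[OF assms(2,1)]] assms bruhat_less_len[of x "s \<otimes> x"]
  by (auto simp: mult_conj_by bruhat_less_def)

lemma bruhat_less_S_mult_iff':
  assumes "x \<in> carrier G" "s \<in> S"
  shows "bruhat_less G S (s \<otimes> x) x \<longleftrightarrow> l (s \<otimes> x) < l x"
  using bruhat_less_S_mult_iff[of "s \<otimes> x" s] assms by (simp add: S_carrier)

lemma len_S_mult_neq:
  assumes "x \<in> carrier G" "s \<in> S" shows "l (s \<otimes> x) \<noteq> l x"
  using len_S_mult_iff[OF assms] by force

text \<open>A weak form of the lifting property. Left multiplication of x by s changes its set of
  reflections only by \<open>s^x\<close>, so a step from x to \<open>xt\<close> remains a step after
  multiplication by s, unless \<open>xt = sx\<close>.\<close>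

lemma bruhat_S_mult:
  assumes "bruhat_le G S x y" "y \<in> carrier G" "s \<in> S"
  shows "bruhat_le G S (s \<otimes> x) y \<or> bruhat_le G S (s \<otimes> x) (s \<otimes> y)"
  using assms(1) unfolding bruhat_le_rtranclp
proof (induction rule: converse_rtranclp_induct)
  case (step x x1)
  then obtain t where t: "t \<in> reflections G S" "x1 = x \<otimes> t" and x: "x \<in> carrier G" and lt: "l x < l x1" by blast
  have tc: "t \<in> carrier G" using t reflections_carrier by blast
  have sc: "s \<in> carrier G" using assms S_carrier by blast
  have nt: "t \<notin> right_inv x" using len_mult_refl_less_iff[OF x t(1)] t lt by simp
  have sx1: "s \<otimes> x1 = (s \<otimes> x) \<otimes> t" using t x tc sc by (simp add: m_assoc)
  show ?case
  proof (cases "t = conj_by G s x")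
    case True
    then have "s \<otimes> x = x1" using t x assms by (simp add: mult_conj_by)
    then show ?thesis using step by simp
  next
    case False
    then have "t \<notin> right_inv (s \<otimes> x)" using nt assms x by (auto simp: right_inv_S_mult)
    then have "l (s \<otimes> x) < l (s \<otimes> x1)"
      using len_mult_refl_less_iff[OF _ t(1), of "s \<otimes> x"] x sc sx1 by simp
    then have b: "bstep (s \<otimes> x) (s \<otimes> x1)" using x sc t sx1 by blast
    from step.IH show ?thesis
      using converse_rtranclp_into_rtranclp[of bstep, OF b] by blast
  qed
qed simp

section \<open>Parabolic subgroups and minimal coset representatives\<close>

lemma right_inv_parabolic:
  assumes "J \<subseteq> S" "u \<in> generate G J" shows "right_inv u \<subseteq> generate G J"
proof -
  have Jc: "J \<subseteq> carrier G" using assms(1) S_carrier by blast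
  have "odd_refl v \<subseteq> generate G J" if "v \<in> lists J" for v
    using that
  proof (induction v rule: list.induct)
    case (Cons s v)
    then have "wp v \<in> generate G J" "s \<in> generate G J"
      using wp_parabolic[OF assms(1)] by (auto intro: generate.incl)
    then have "inv (wp v) \<otimes> s \<otimes> wp v \<in> generate G J"
      using generate_m_inv_closed[OF Jc] by (auto intro: generate.eng)
    with Cons show ?case by auto
  qed simp
  moreover obtain v where "v \<in> lists J" "wp v = u" using ex_word_parabolic[OF assms] by blast
  moreover from this have "right_inv u = odd_refl v" using right_inv_wp[of v] assms(1) by auto
  ultimately show ?thesis by blast
qed

lemma parabolic_carrier: "J \<subseteq> S \<Longrightarrow> u \<in> generate G J \<Longrightarrow> u \<in> carrier G"
  using generate_in_carrier[of J u] S_carrier by blast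

lemma parabolic_inv: "J \<subseteq> S \<Longrightarrow> u \<in> generate G J \<Longrightarrow> inv u \<in> generate G J"
  using generate_m_inv_closed[of J u] S_carrier by blast

text \<open>The last letter of a J-word of minimal length is a descent, since otherwise the exchange
  condition would give a shorter J-word.\<close>

lemma parabolic_descent:
  assumes "J \<subseteq> S" "u \<in> generate G J" "u \<noteq> \<one>"
  shows "\<exists>t\<in>J. t \<in> right_inv u"
proof -
  obtain v where v: "v \<in> lists J" "wp v = u" "\<And>v'. v' \<in> lists J \<Longrightarrow> wp v' = u \<Longrightarrow> length v \<le> length v'"
    using ex_minimal_word[OF assms(1,2)] by metis
  have vS: "v \<in> lists S" using v(1) assms(1) by auto
  from v assms(3) obtain v' t where vt: "v = v' @ [t]" by (cases v rule: rev_exhaust) auto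
  then have v'S: "v' \<in> lists S" and v'J: "v' \<in> lists J" and t: "t \<in> J" "t \<in> S" using v vS by auto
  have u: "u = wp v' \<otimes> t" using v(2) vt v'S t by (simp add: S_carrier)
  have "t \<in> right_inv u"
  proof (rule ccontr)
    assume "t \<notin> right_inv u"
    then have "t \<in> right_inv (wp v')"
      using right_inv_mult_refl[of "wp v'" t] t v'S u S_reflections by auto
    then obtain i where "i < length v'" "wp v' \<otimes> t = wp (take i v' @ drop (Suc i) v')"
      using odd_refl_mem_delete[OF assms(1) v'J] right_inv_wp[OF v'S] by auto
    moreover have "take i v' @ drop (Suc i) v' \<in> lists J" for i
      using v'J by (auto dest: in_set_takeD in_set_dropD)
    ultimately show False using v(3)[of "take i v' @ drop (Suc i) v'"] u vt by simp
  qed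
  then show ?thesis using t by blast
qed

text \<open>The reflections of \<open>xu\<close> come from those of u, which lie in
  \<open>W_J\<close>, and the conjugates by u of those of x, which lie outside, so nothing cancels.
  The hypothesis excludes all of \<open>W_J\<close> because conjugation by u does not preserve J;
  \<open>DJ_right_inv\<close> supplies it.\<close>

lemma len_mult_parabolic':
  assumes "J \<subseteq> S" "x \<in> carrier G" "right_inv x \<inter> generate G J = {}" "u \<in> generate G J"
  shows "l (x \<otimes> u) = l x + l u"
proof -
  have u: "u \<in> carrier G" using assms parabolic_carrier by blast
  let ?A = "(\<lambda>r. inv u \<otimes> r \<otimes> u) ` right_inv x"
  have xc: "right_inv x \<subseteq> carrier G" and uc: "right_inv u \<subseteq> carrier G" and xuc: "right_inv (x \<otimes> u) \<subseteq> carrier G"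
    using right_inv_reflections[of x] right_inv_reflections[of u] right_inv_reflections[of "x \<otimes> u"] assms u reflections_carrier by auto
  have 1: "r \<in> ?A \<longleftrightarrow> u \<otimes> r \<otimes> inv u \<in> right_inv x" if r: "r \<in> carrier G" for r
  proof
    assume "u \<otimes> r \<otimes> inv u \<in> right_inv x"
    moreover have "r = inv u \<otimes> (u \<otimes> r \<otimes> inv u) \<otimes> u" using u r by (simp add: m_assoc)
    ultimately show "r \<in> ?A" by blast
  next
    assume "r \<in> ?A"
    then obtain q where "q \<in> right_inv x" "r = inv u \<otimes> q \<otimes> u" by blast
    moreover from this have "u \<otimes> r \<otimes> inv u = q" using u xc by (auto simp: m_assoc)
    ultimately show "u \<otimes> r \<otimes> inv u \<in> right_inv x" by simp
  qed
  have disj: "?A \<inter> right_inv u = {}"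
  proof -
    have "r \<notin> right_inv u" if "r \<in> ?A" for r
    proof
      assume "r \<in> right_inv u"
      then have r: "r \<in> generate G J" "r \<in> carrier G" using right_inv_parabolic[OF assms(1,4)] uc by auto
      then have "u \<otimes> r \<otimes> inv u \<in> generate G J"
        using assms(1,4) parabolic_inv by (auto intro: generate.eng)
      then show False using 1[OF r(2)] that assms(3) by auto
    qed
    then show ?thesis by blast
  qed
  have "right_inv (x \<otimes> u) = ?A \<union> right_inv u"
  proof -
    have "?A \<subseteq> carrier G" using xc u by auto
    moreover have "r \<in> right_inv (x \<otimes> u) \<longleftrightarrow> r \<in> ?A \<union> right_inv u" if "r \<in> carrier G" for r
      unfolding right_inv_mult[OF assms(2) u that] 1[OF that, symmetric] using disj by (simp add: disjoint_iff) blast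
    ultimately show ?thesis using uc xuc by (meson Un_least subset_antisym subset_iff)
  qed
  moreover have "card ?A = card (right_inv x)"
  proof (rule card_image, rule inj_onI)
    fix a b assume "a \<in> right_inv x" "b \<in> right_inv x" "inv u \<otimes> a \<otimes> u = inv u \<otimes> b \<otimes> u"
    moreover from this have "a \<in> carrier G" "b \<in> carrier G" using xc by auto
    ultimately show "a = b" using u by simp
  qed
  ultimately show ?thesis
    using disj assms u finite_right_inv by (simp add: len_eq_card card_Un_disjoint)
qed

text \<open>An element of minimal length in the coset of w has no reflection in \<open>W_J\<close>,
  since multiplying by such a reflection would shorten it within the coset.\<close>

lemma parabolic_decomp':
  assumes "J \<subseteq> S" "w \<in> carrier G"
  shows "\<exists>x u. x \<in> carrier G \<and> u \<in> generate G J \<and> w = x \<otimes> u \<and> right_inv x \<inter> generate G J = {}"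
proof -
  define P where "P = (\<lambda>x. \<exists>u\<in>generate G J. x = w \<otimes> u)"
  define x where "x = arg_min l P"
  have "P w" unfolding P_def using assms by (intro bexI[of _ \<one>]) (auto intro: generate.one)
  then have "P x" and min: "\<And>y. P y \<Longrightarrow> l x \<le> l y"
    unfolding x_def using arg_min_natI[of P w l] arg_min_nat_le[of P _ l] by auto
  then obtain u where u: "u \<in> generate G J" "x = w \<otimes> u" by (auto simp: P_def)
  have uc: "u \<in> carrier G" using u assms parabolic_carrier by blast
  have xc: "x \<in> carrier G" using u uc assms by simp
  have "t \<notin> generate G J" if t: "t \<in> right_inv x" for t
  proof
    assume tJ: "t \<in> generate G J"
    then have "P (x \<otimes> t)"
      unfolding P_def using u uc assms parabolic_carrier[OF assms(1) tJ]
      by (intro bexI[of _ "u \<otimes> t"]) (auto simp: m_assoc intro: generate.eng)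
    then show False using min len_mult_refl_less[OF xc t] by (metis not_less)
  qed
  moreover have "w = x \<otimes> inv u" using u uc assms by (simp add: m_assoc)
  ultimately show ?thesis using xc parabolic_inv[OF assms(1) u(1)] by blast
qed

lemma DJ_carrier: "x \<in> DJ G S J \<Longrightarrow> x \<in> carrier G"
  by (simp add: DJ_def)

lemma DJ_iff:
  assumes "J \<subseteq> S" shows "x \<in> DJ G S J \<longleftrightarrow> x \<in> carrier G \<and> right_inv x \<inter> J = {}"
proof -
  have "l x < l (x \<otimes> s) \<longleftrightarrow> s \<notin> right_inv x" if "x \<in> carrier G" "s \<in> J" for s
    using len_mult_refl_less_iff[OF that(1)] that(2) assms S_reflections by blast
  then show ?thesis by (auto simp: DJ_def)
qed

text \<open>Write \<open>x = x0 u\<close> with x0 free of reflections in \<open>W_J\<close>. By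
  additivity of length a descent of u in J would be a descent of x, so u = 1.\<close>

lemma DJ_right_inv:
  assumes "J \<subseteq> S" "x \<in> DJ G S J" shows "right_inv x \<inter> generate G J = {}"
proof -
  have xc: "x \<in> carrier G" using assms by (simp add: DJ_carrier)
  obtain x0 u where x0: "x0 \<in> carrier G" "u \<in> generate G J" "x = x0 \<otimes> u" "right_inv x0 \<inter> generate G J = {}"
    using parabolic_decomp'[OF assms(1) xc] by blast
  have uc: "u \<in> carrier G" using x0 assms parabolic_carrier by blast
  show ?thesis
  proof (cases "u = \<one>")
    case False
    then obtain t where t: "t \<in> J" "t \<in> right_inv u" using parabolic_descent[OF assms(1) x0(2)] by blast
    have tc: "t \<in> carrier G" using t assms S_carrier by blast
    have "l (x \<otimes> t) = l x0 + l (u \<otimes> t)"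
      using len_mult_parabolic'[OF assms(1) x0(1,4), of "u \<otimes> t"] x0 t tc uc
      by (auto simp: m_assoc intro: generate.eng generate.incl)
    also have "\<dots> < l x0 + l u" using len_mult_refl_less[OF uc t(2)] by simp
    also have "\<dots> = l x" using len_mult_parabolic'[OF assms(1) x0(1,4,2)] x0 by simp
    finally show ?thesis using assms t by (auto simp: DJ_def)
  qed (use x0 in simp)
qed

lemma len_mult_parabolic:
  assumes "J \<subseteq> S" "x \<in> DJ G S J" "u \<in> generate G J"
  shows "l (x \<otimes> u) = l x + l u"
  using len_mult_parabolic'[OF assms(1) _ _ assms(3)] DJ_right_inv[OF assms(1,2)] DJ_carrier[OF assms(2)] by blast

lemma parabolic_decomp:
  assumes "J \<subseteq> S" "w \<in> carrier G"
  obtains x u where "x \<in> DJ G S J" "u \<in> generate G J" "w = x \<otimes> u"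
proof -
  obtain x u where x: "x \<in> carrier G" "u \<in> generate G J" "w = x \<otimes> u" "right_inv x \<inter> generate G J = {}"
    using parabolic_decomp'[OF assms] by blast
  moreover have "J \<subseteq> generate G J" by (auto intro: generate.incl)
  with x have "x \<in> DJ G S J" by (auto simp: DJ_iff[OF assms(1)])
  ultimately show thesis using that by blast
qed

text \<open>For \<open>q = u u'^-1\<close> one has x' = x q and x = x' q^-1; additivity of length in
  both directions forces l(q) = 0.\<close>

lemma parabolic_decomp_unique:
  assumes "J \<subseteq> S" "x \<in> DJ G S J" "x' \<in> DJ G S J" "u \<in> generate G J" "u' \<in> generate G J" "x \<otimes> u = x' \<otimes> u'"
  shows "x = x'" "u = u'"
proof -
  have c: "x \<in> carrier G" "x' \<in> carrier G" "u \<in> carrier G" "u' \<in> carrier G"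
    using assms DJ_carrier parabolic_carrier by blast+
  define q where "q = u \<otimes> inv u'"
  have q: "q \<in> generate G J" "q \<in> carrier G"
    unfolding q_def using assms parabolic_inv[OF assms(1)] c by (auto intro: generate.eng)
  have x': "x' = x \<otimes> q" unfolding q_def using assms(6) c by (metis inv_solve_right m_assoc m_closed inv_closed)
  have x: "x = x' \<otimes> inv q" using x' q c by (simp add: m_assoc)
  have "l x' = l x + l q" using len_mult_parabolic[OF assms(1,2) q(1)] x' by simp
  moreover have "l x = l x' + l (inv q)"
    using len_mult_parabolic[OF assms(1,3) parabolic_inv[OF assms(1) q(1)]] x by simp
  ultimately have "q = \<one>" using len_eq_0[OF q(2)] by simp
  then show "x = x'" using x' c by simp
  then show "u = u'" using assms(6) c by (metis l_cancel)
qed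

lemma DJ_le_mult_parabolic:
  assumes "J \<subseteq> S" "x \<in> DJ G S J" "u \<in> generate G J"
  shows "bruhat_le G S x (x \<otimes> u)"
  using assms(3)
proof (induction "l u" arbitrary: u rule: less_induct)
  case less
  have c: "x \<in> carrier G" "u \<in> carrier G" using assms less.prems DJ_carrier parabolic_carrier by blast+
  show ?case
  proof (cases "u = \<one>")
    case False
    then obtain t where t: "t \<in> J" "t \<in> right_inv u" using parabolic_descent[OF assms(1) less.prems] by blast
    have tS: "t \<in> S" "t \<in> carrier G" using t assms S_carrier by blast+
    have ut: "u \<otimes> t \<in> generate G J" using t less.prems by (auto intro: generate.eng generate.incl)
    have lt: "l (u \<otimes> t) < l u" using len_mult_refl_less[OF c(2) t(2)] .
    have "bruhat_le G S x (x \<otimes> (u \<otimes> t))" using less.hyps[OF lt ut] .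
    also have "bruhat_le G S (x \<otimes> (u \<otimes> t)) (x \<otimes> (u \<otimes> t) \<otimes> t)"
    proof (rule bruhat_stepI)
      have "x \<otimes> (u \<otimes> t) \<otimes> t = x \<otimes> u" using c tS by (simp flip: m_assoc)
      then show "l (x \<otimes> (u \<otimes> t)) < l (x \<otimes> (u \<otimes> t) \<otimes> t)"
        using len_mult_parabolic[OF assms(1,2)] less.prems ut lt by simp
    qed (use c tS S_reflections in auto)
    finally (bruhat_trans) show ?thesis using c tS by (simp flip: m_assoc)
  qed (use c in simp)
qed

text \<open>Going down from y to \<open>sy\<close> only removes the reflection \<open>s^y\<close>,
  so no element of J can enter.\<close>

lemma DJ_minus_mult:
  assumes "J \<subseteq> S" "y \<in> DJ G S J" "s \<in> S" "l (s \<otimes> y) < l y"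
  shows "s \<otimes> y \<in> DJ G S J"
proof -
  have c: "y \<in> carrier G" "s \<in> carrier G" using assms DJ_carrier S_carrier by blast+
  have "right_inv (s \<otimes> y) = sym_diff (right_inv y) {conj_by G s y}" using assms c by (simp add: right_inv_S_mult)
  moreover have "conj_by G s y \<in> right_inv y" using len_S_mult_iff[OF c(1) assms(3)] assms by simp
  ultimately have "right_inv (s \<otimes> y) \<subseteq> right_inv y" by blast
  then show ?thesis using assms c by (auto simp: DJ_iff)
qed

text \<open>The only reflection that \<open>sy\<close> can have beyond those of y is
  \<open>s^y\<close>, so it must be the one in J.\<close>

lemma DJ_zero_conj:
  assumes "J \<subseteq> S" "y \<in> DJ G S J" "s \<in> S" "s \<otimes> y \<notin> DJ G S J"
  shows "conj_by G s y \<in> J"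
proof -
  have c: "y \<in> carrier G" "s \<in> carrier G" using assms DJ_carrier S_carrier by blast+
  have "right_inv (s \<otimes> y) = sym_diff (right_inv y) {conj_by G s y}" using assms c by (simp add: right_inv_S_mult)
  then show ?thesis using assms c by (auto simp: DJ_iff)
qed

lemma DJ_plus_iff: "s \<in> S \<Longrightarrow> w \<in> DJ_plus G S J s \<longleftrightarrow> w \<in> DJ G S J \<and> l w < l (s \<otimes> w) \<and> s \<otimes> w \<in> DJ G S J"
  and DJ_zero_iff: "s \<in> S \<Longrightarrow> w \<in> DJ_zero G S J s \<longleftrightarrow> w \<in> DJ G S J \<and> l w < l (s \<otimes> w) \<and> s \<otimes> w \<notin> DJ G S J"
  and DJ_minus_iff: "s \<in> S \<Longrightarrow> w \<in> DJ_minus G S J s \<longleftrightarrow> w \<in> DJ G S J \<and> l (s \<otimes> w) < l w"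
  by (auto simp: DJ_plus_def DJ_zero_def DJ_minus_def bruhat_less_S_mult_iff bruhat_less_S_mult_iff' dest: DJ_carrier)

section \<open>Reduced words and Matsumoto's theorem\<close>

definition reduced :: "'w list \<Rightarrow> bool" where
  "reduced u \<longleftrightarrow> u \<in> lists S \<and> length u = l (wp u)"

lemma reduced_card: "reduced u \<Longrightarrow> card (odd_refl u) = length u"
  using right_inv_wp[of u] by (auto simp: reduced_def len_eq_card)

lemma reduced_iff_card: "u \<in> lists S \<Longrightarrow> reduced u \<longleftrightarrow> card (odd_refl u) = length u"
  using right_inv_wp[of u] by (auto simp: reduced_def len_eq_card)

lemma reduced_Cons: assumes "reduced (a # u)" shows "reduced u" "l (a \<otimes> wp u) = l (wp u) + 1"
proof -
  have S: "a \<in> S" "u \<in> lists S" using assms by (auto simp: reduced_def)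
  have "length u + 1 = l (a \<otimes> wp u)" using assms by (simp add: reduced_def)
  moreover have "l (a \<otimes> wp u) \<le> l (wp u) + 1" using len_S_mult[of "wp u" a] S by auto
  moreover have "l (wp u) \<le> length u" using S by (simp add: len_le)
  ultimately show "reduced u" "l (a \<otimes> wp u) = l (wp u) + 1" using S by (auto simp: reduced_def)
qed

lemma reduced_rev: "reduced u \<Longrightarrow> reduced (rev u)"
  by (auto simp: reduced_def)

lemma reduced_butlast: assumes "reduced (u @ [a])" shows "reduced u"
proof -
  have "reduced (a # rev u)" using reduced_rev[OF assms] by simp
  then have "reduced (rev (rev u))" using reduced_rev[OF reduced_Cons(1)] by blast
  then show ?thesis by simp
qed

lemma cox_m_commute: "s \<in> S \<Longrightarrow> t \<in> S \<Longrightarrow> cox_m G t s = cox_m G s t"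
  using ord_inv[of "s \<otimes> t"] S_carrier by (simp add: cox_m_def inv_mult_group)

text \<open>For k at most the order of \<open>st\<close>, the reflections \<open>t (st)^i\<close>
  with i < k are pairwise distinct, so there are as many as letters.\<close>

lemma reduced_alt_list:
  assumes "s \<in> S" "t \<in> S" "cox_m G s t = 0 \<or> k \<le> cox_m G s t"
  shows "reduced (alt_list k s t)"
proof -
  have *: "reduced (alt_end k s t)" if st: "s \<in> S" "t \<in> S" "cox_m G s t = 0 \<or> k \<le> cox_m G s t" for s t
  proof -
    let ?f = "\<lambda>i. t \<otimes> (s \<otimes> t) [^] (i::nat)"
    have c: "s \<otimes> t \<in> carrier G" using st S_carrier by simp
    have "inj_on ?f {..<k}"
    proof (rule linorder_inj_onI')
      fix i j assume ij: "i \<in> {..<k}" "j \<in> {..<k}" "i < j"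
      show "?f i \<noteq> ?f j"
      proof
        assume "?f i = ?f j"
        then have "(s \<otimes> t) [^] i = (s \<otimes> t) [^] j" using st c S_carrier by simp
        then have "(s \<otimes> t) [^] (j - i) = \<one>" using pow_eq_div2[OF c] by metis
        then have "cox_m G s t dvd j - i" using c pow_eq_id by (simp add: cox_m_def)
        then show False using ij st(3) dvd_imp_le[of "cox_m G s t" "j - i"] by fastforce
      qed
    qed
    moreover have "odd_refl (alt_end k s t) = ?f ` {..<k}"
    proof -
      have "card {i. i < k \<and> ?f i = r} = (if r \<in> ?f ` {..<k} then 1 else 0)" for r
      proof (cases "r \<in> ?f ` {..<k}")
        case True
        then obtain i where "i < k" "r = ?f i" by auto
        then have "{i. i < k \<and> ?f i = r} = {i}" using \<open>inj_on ?f {..<k}\<close> by (auto simp: inj_on_def)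
        then show ?thesis using True by simp
      next
        case False
        then have "{i. i < k \<and> ?f i = r} = {}" by auto
        with False show ?thesis by simp
      qed
      then show ?thesis using odd_refl_alt_end[OF st(1,2), of _ k] by (auto split: if_splits)
    qed
    moreover have "length (alt_end k s t) = k" by (induction k) auto
    ultimately show ?thesis
      using reduced_iff_card[OF alt_end_S[OF st(1,2)], of k] by (simp add: card_image)
  qed
  show ?thesis using *[of s t] *[of t s] cox_m_commute[OF assms(1,2)] assms by (simp add: alt_list_eq_alt_end)
qed

lemma wp_alt_list_braid:
  assumes "s \<in> S" "t \<in> S"
  shows "wp (alt_list k s t) = wp (alt_list k t s) \<longleftrightarrow> cox_m G s t dvd k"
proof -
  have c: "s \<otimes> t \<in> carrier G" using assms S_carrier by simp
  have "(s \<otimes> t) [^] k = wp (alt_list (2 * k) s t)" using assms by (simp add: alt_list_eq_alt_end wp_alt_end)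
  also have "\<dots> = wp (alt_list k s t) \<otimes> inv (wp (alt_list k t s))"
    using alt_list_S[OF assms] alt_list_S[OF assms(2,1)] by (simp add: alt_list_double in_lists_conv_set)
  finally have "(s \<otimes> t) [^] k = \<one> \<longleftrightarrow> wp (alt_list k s t) = wp (alt_list k t s)"
    using alt_list_S[OF assms] alt_list_S[OF assms(2,1)] wp_S by (metis inv_equality inv_inv inv_closed r_inv)
  then show ?thesis using pow_eq_id[OF c] by (simp add: cox_m_def)
qed

text \<open>Only \<open>cox_m G s t\<close> distinct elements have the form \<open>t (st)^i\<close>,
  and a reduced word has as many reflections as letters.\<close>

lemma reduced_alt_list_le:
  assumes "s \<in> S" "t \<in> S" "reduced (alt_list k s t)" "cox_m G s t \<noteq> 0"
  shows "k \<le> cox_m G s t"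
proof -
  have *: "k \<le> cox_m G s t" if st: "s \<in> S" "t \<in> S" "reduced (alt_end k s t)" "cox_m G s t \<noteq> 0" for s t
  proof -
    let ?f = "\<lambda>i. t \<otimes> (s \<otimes> t) [^] (i::nat)" and ?m = "cox_m G s t"
    have c: "s \<otimes> t \<in> carrier G" using st S_carrier by simp
    have mod: "(s \<otimes> t) [^] i = (s \<otimes> t) [^] (i mod ?m)" for i
    proof -
      have "(s \<otimes> t) [^] i = ((s \<otimes> t) [^] ?m) [^] (i div ?m) \<otimes> (s \<otimes> t) [^] (i mod ?m)"
        using c by (simp add: nat_pow_pow nat_pow_mult)
      then show ?thesis using c by (simp add: cox_m_def)
    qed
    have "odd_refl (alt_end k s t) \<subseteq> ?f ` {..<?m}"
    proof
      fix r assume "r \<in> odd_refl (alt_end k s t)"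
      then have "odd (card {i. i < k \<and> ?f i = r})" using odd_refl_alt_end[OF st(1,2)] by blast
      then have "{i. i < k \<and> ?f i = r} \<noteq> {}" by (metis card.empty even_zero)
      then obtain i where "?f i = r" by blast
      then have "r = ?f (i mod ?m)" using mod[of i] by simp
      moreover have "i mod ?m < ?m" using st by simp
      ultimately show "r \<in> ?f ` {..<?m}" by blast
    qed
    then have "card (odd_refl (alt_end k s t)) \<le> ?m"
      using surj_card_le[of "{..<?m}"] by simp
    moreover have "length (alt_end k s t) = k" by (induction k) auto
    ultimately show ?thesis using reduced_card[OF st(3)] by simp
  qed
  show ?thesis using *[of s t] *[of t s] cox_m_commute[OF assms(1,2)] assms by (simp add: alt_list_eq_alt_end split: if_splits)
qed

text \<open>The reflection that takes w to \<open>bw\<close> cancels a letter of u; putting b in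
  front restores the product.\<close>

lemma left_exchange:
  assumes "reduced u" "b \<in> S" "l (b \<otimes> wp u) < l (wp u)"
  shows "\<exists>i<length u. reduced (b # take i u @ drop (Suc i) u) \<and> wp (b # take i u @ drop (Suc i) u) = wp u"
proof -
  have uS: "u \<in> lists S" and lu: "length u = l (wp u)" using assms by (auto simp: reduced_def)
  have "conj_by G b (wp u) \<in> right_inv (wp u)" using len_S_mult_iff[of "wp u" b] assms uS by simp
  then obtain i where i: "i < length u" "wp u \<otimes> conj_by G b (wp u) = wp (take i u @ drop (Suc i) u)"
    using odd_refl_mem_delete[of S u "conj_by G b (wp u)"] right_inv_wp[OF uS] uS by auto
  let ?v = "take i u @ drop (Suc i) u"
  have vS: "?v \<in> lists S" using uS by (auto dest: in_set_takeD in_set_dropD)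
  have "wp ?v = b \<otimes> wp u" using i assms uS by (simp add: mult_conj_by)
  then have "wp (b # ?v) = wp u" using assms uS by simp
  moreover have "length (b # ?v) = length u" using i by simp
  ultimately have "reduced (b # ?v) \<and> wp (b # ?v) = wp u"
    using vS assms(2) lu unfolding reduced_def by simp
  then show ?thesis using i by blast
qed

text \<open>The argument of Bourbaki, Lie IV.1.5, Proposition 5: by the exchange condition and induction, two reduced
  words with distinct products yield such a pair in which the words start with ever longer alternating words.\<close>
lemma matsumoto:
  fixes T :: "'w \<Rightarrow> 'h::monoid_mult"
  assumes braid: "\<And>s t. s \<in> S \<Longrightarrow> t \<in> S \<Longrightarrow> cox_m G s t \<noteq> 0 \<Longrightarrow>
    prod_list (map T (alt_list (cox_m G s t) s t)) = prod_list (map T (alt_list (cox_m G s t) t s))"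
  assumes "reduced u" "reduced v" "wp u = wp v"
  shows "prod_list (map T u) = prod_list (map T v)"
  using assms(2-4)
proof (induction "length u" arbitrary: u v rule: less_induct)
  case less
  let ?F = "\<lambda>u. prod_list (map T u)" and ?w = "wp u" and ?q = "length u"
  define R where "R = (\<lambda>u'. reduced u' \<and> wp u' = wp u)"
  have lenR: "length u' = ?q" if "R u'" for u' using that less.prems by (auto simp: R_def reduced_def)
  have RS: "u' \<in> lists S" if "R u'" for u' using that by (auto simp: R_def reduced_def)
  have same_head: "?F u' = ?F v'" if "R u'" "R v'" "u' = a # u1" "v' = a # v1" for u' v' a u1 v1
  proof -
    have S: "a \<in> S" "u1 \<in> lists S" "v1 \<in> lists S" using RS[OF that(1)] RS[OF that(2)] that by auto
    have "wp u1 = wp v1" using that S by (simp add: R_def S_carrier) (metis S_carrier S l_cancel wp_S)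
    moreover have "length u1 < ?q" using lenR[OF that(1)] that by simp
    ultimately have "?F u1 = ?F v1"
      using less.hyps[of u1 v1] reduced_Cons(1) that by (auto simp: R_def)
    then show ?thesis using that by simp
  qed
  have same_last: "?F u' = ?F v'" if "R u'" "R v'" "u' = u1 @ [a]" "v' = v1 @ [a]" for u' v' a u1 v1
  proof -
    have S: "a \<in> S" "u1 \<in> lists S" "v1 \<in> lists S" using RS[OF that(1)] RS[OF that(2)] that by auto
    have "wp u1 \<otimes> a = wp v1 \<otimes> a" using that S by (simp add: R_def S_carrier)
    then have "wp u1 = wp v1" using S S_carrier by (metis r_cancel wp_S)
    moreover have "length u1 < ?q" using lenR[OF that(1)] that by simp
    ultimately have "?F u1 = ?F v1"
      using less.hyps[of u1 v1] reduced_butlast that by (auto simp: R_def)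
    then show ?thesis using that by simp
  qed
  \<comment> \<open>The exchange condition puts b in front and drops a letter. Were this not the
    last letter a, the new word would share its first letter with one word and its last letter with
    the other, making both values of \<open>?F\<close> equal.\<close>
  have step: "R (b # u1) \<and> ?F (b # u1) \<noteq> ?F (u1 @ [a])"
    if R: "R (u1 @ [a])" "R (b # v1)" and neq: "?F (u1 @ [a]) \<noteq> ?F (b # v1)" for a b u1 v1
  proof -
    let ?u = "u1 @ [a]"
    have S: "b \<in> S" "v1 \<in> lists S" "?u \<in> lists S" using RS[OF R(2)] RS[OF R(1)] by auto
    have "reduced ?u" "wp ?u = b \<otimes> wp v1" using R by (auto simp: R_def)
    moreover have "l (wp v1) < l (b \<otimes> wp v1)" using reduced_Cons(2)[of b v1] R(2) by (simp add: R_def)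
    ultimately obtain i where i: "i < length ?u" "reduced (b # take i ?u @ drop (Suc i) ?u)"
      "wp (b # take i ?u @ drop (Suc i) ?u) = wp ?u"
      using left_exchange[of ?u b] S by auto
    then have R': "R (b # take i ?u @ drop (Suc i) ?u)" using R by (simp add: R_def)
    have F: "?F (b # take i ?u @ drop (Suc i) ?u) = ?F (b # v1)" using same_head[OF R' R(2)] by blast
    have "i = length u1"
    proof (rule ccontr)
      assume "i \<noteq> length u1"
      with i have "drop (Suc i) ?u = drop (Suc i) u1 @ [a]" by simp
      then have "?F (b # take i ?u @ drop (Suc i) ?u) = ?F ?u"
        using same_last[OF R' R(1), of "b # take i ?u @ drop (Suc i) u1"] by simp
      then show False using F neq by simp
    qed
    then have "b # take i ?u @ drop (Suc i) ?u = b # u1" by simp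
    then show ?thesis using R' F neq by metis
  qed
  show ?case
  proof (rule ccontr)
    assume neq: "?F u \<noteq> ?F v"
    have R: "R u" "R v" using less.prems by (auto simp: R_def)
    then have "u \<noteq> []" "v \<noteq> []" using neq lenR[OF R(2)] by auto
    then obtain a u1 b v1 where uv: "u = a # u1" "v = b # v1" by (meson neq_Nil_conv)
    have ab: "a \<in> S" "b \<in> S" using RS[OF R(1)] RS[OF R(2)] uv by auto
    \<comment> \<open>An alternating prefix of k + 1 letters, followed by the part of u that k
      exchanges have left over; the total length stays that of u.\<close>
    define A where "A = (\<lambda>k x y. alt_list (Suc k) x y @ take (?q - 1 - k) u1)"
    have ind: "\<exists>x y V. {x, y} = {a, b} \<and> R (A k x y) \<and> R (y # V) \<and> ?F (A k x y) \<noteq> ?F (y # V)" if "k < ?q" for k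
      using that
    proof (induction k)
      case 0
      have "A 0 a b = u" using uv by (simp add: A_def alt_list_Suc)
      then show ?case using R neq uv by blast
    next
      case (Suc k)
      then obtain x y V where h: "{x, y} = {a, b}" "R (A k x y)" "R (y # V)" "?F (A k x y) \<noteq> ?F (y # V)" by auto
      have "take (?q - 1 - k) u1 \<noteq> []" using Suc uv by auto
      moreover have "take (?q - 1 - k) u1 = take (?q - 1 - Suc k) u1 @ [u1 ! (?q - 1 - Suc k)]"
        using Suc.prems uv take_Suc_conv_app_nth[of "?q - 1 - Suc k" u1] by (simp add: Suc_diff_Suc)
      ultimately have Ak: "A k x y = (alt_list (Suc k) x y @ take (?q - 1 - Suc k) u1) @ [u1 ! (?q - 1 - Suc k)]"
        by (simp add: A_def)
      have "A (Suc k) y x = y # alt_list (Suc k) x y @ take (?q - 1 - Suc k) u1"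
        by (simp add: A_def alt_list_Suc[of "Suc k"])
      then have "R (A (Suc k) y x) \<and> ?F (A (Suc k) y x) \<noteq> ?F (A k x y)"
        using step[OF h(2)[unfolded Ak] h(3) h(4)[unfolded Ak]] Ak by simp
      moreover obtain V' where "A k x y = x # V'" by (simp add: A_def alt_list_Suc)
      ultimately show ?case using h by (metis insert_commute)
    qed
    have "?q - 1 < ?q" using \<open>u \<noteq> []\<close> by simp
    from ind[OF this] obtain x y V where h: "{x, y} = {a, b}" "R (A (?q - 1) x y)" "R (y # V)" "?F (A (?q - 1) x y) \<noteq> ?F (y # V)"
      by blast
    \<comment> \<open>Now the whole word is alternating, and one more exchange produces the opposite
      alternating word. The length must then be the order of \<open>xy\<close>, against the braid
      relation.\<close>
    have A: "A (?q - 1) x y = alt_list ?q x y" using \<open>u \<noteq> []\<close> by (simp add: A_def)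
    have xy: "x \<in> S" "y \<in> S" using h(1) ab by (auto simp: doubleton_eq_iff)
    have "alt_list ?q x y \<noteq> []" using \<open>u \<noteq> []\<close> by (metis length_0_conv length_alt_list)
    then obtain V1 d where V1: "alt_list ?q x y = V1 @ [d]" by (metis rev_exhaust)
    have "V1 = alt_list (?q - 1) x y"
    proof -
      have "V1 = butlast (alt_list ?q x y)" using V1 by simp
      also have "\<dots> = alt_list (?q - 1) x y" using uv
        by (auto simp: alt_list_def map_butlast[symmetric])
      finally show ?thesis .
    qed
    then have "y # V1 = alt_list ?q y x" using uv by (simp add: alt_list_Suc)
    then have yx: "R (alt_list ?q y x)" "?F (alt_list ?q y x) \<noteq> ?F (alt_list ?q x y)"
      using step[of V1 d y V] h A V1 by auto
    have "wp (alt_list ?q x y) = wp (alt_list ?q y x)" using yx h A by (simp add: R_def)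
    then have dvd: "cox_m G x y dvd ?q" using wp_alt_list_braid[OF xy] by blast
    then have m0: "cox_m G x y \<noteq> 0" using \<open>u \<noteq> []\<close> by (metis dvd_0_left_iff length_0_conv)
    have "?q \<le> cox_m G x y" using reduced_alt_list_le[OF xy _ m0] h A by (simp add: R_def)
    then have "cox_m G x y = ?q" using dvd \<open>u \<noteq> []\<close> by (meson dvd_imp_le le_antisym length_greater_0_conv)
    then show False using braid[OF xy m0] yx by simp
  qed
qed

end

section \<open>Hecke algebras\<close>

lemma poly_mapping_sum_single:
  fixes f :: "'a \<Rightarrow>\<^sub>0 'b::comm_monoid_add"
  shows "f = (\<Sum>k\<in>Poly_Mapping.keys f. Poly_Mapping.single k (Poly_Mapping.lookup f k))"
  by (rule poly_mapping_eqI) (auto simp: lookup_sum lookup_single when_def in_keys_iff sum.delta)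

lemma poly_mapping_add_induct [case_names zero single add]:
  fixes f :: "'a \<Rightarrow>\<^sub>0 'b::comm_monoid_add"
  assumes "P 0" "\<And>k v. P (Poly_Mapping.single k v)" "\<And>f g. P f \<Longrightarrow> P g \<Longrightarrow> P (f + g)"
  shows "P f"
proof -
  have "P (\<Sum>k\<in>A. Poly_Mapping.single k (Poly_Mapping.lookup f k))" if "finite A" for A
    using that by (induction A) (auto intro: assms)
  then show ?thesis using poly_mapping_sum_single[of f] finite_keys by metis
qed

lemma single_fword_Nil: "Poly_Mapping.single (FWord []) 1 = 1"
  by (metis single_one zero_fword_def)

lemma map_additive:
  fixes \<phi> :: "'a::ab_group_add \<Rightarrow> 'b::ab_group_add"
  assumes "\<And>x y. \<phi> (x + y) = \<phi> x + \<phi> y"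
  shows "Poly_Mapping.lookup (Poly_Mapping.map \<phi> F) k = \<phi> (Poly_Mapping.lookup F k)"
proof -
  have "\<phi> 0 = 0" using assms[of 0 0] by simp
  then show ?thesis by (simp add: map.rep_eq when_def)
qed

lemma single_eq_iff: "Poly_Mapping.single k a = Poly_Mapping.single k b \<longleftrightarrow> a = b"
  by (metis lookup_single_eq)

locale algebra_map =
  fixes sc :: "'r::comm_ring_1 \<Rightarrow> 'a::ring_1" and g :: "'g \<Rightarrow> 'a"
  assumes sc_one [simp]: "sc 1 = 1" and sc_add: "sc (a + b) = sc a + sc b"
    and sc_mult: "sc (a * b) = sc a * sc b" and sc_central: "sc a * h = h * sc a"
begin

lemma sc_zero [simp]: "sc 0 = 0"
  using sc_add[of 0 0] by simp

lemma sc_minus: "sc (- a) = - sc a"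
  using sc_add[of a "- a"] by (simp add: eq_neg_iff_add_eq_0 add.commute)

lemma free_eval_single: "free_eval sc g (Poly_Mapping.single u a) = sc a * prod_list (map g (letters u))"
  by (simp add: free_eval_def)

lemma free_eval_zero [simp]: "free_eval sc g 0 = 0"
  by (simp add: free_eval_def)

lemma free_eval_add: "free_eval sc g (x + y) = free_eval sc g x + free_eval sc g y"
  unfolding free_eval_def by (rule setsum_keys_plus_distrib) (simp_all add: sc_add distrib_right)

lemma free_eval_sum: "free_eval sc g (sum f A) = (\<Sum>i\<in>A. free_eval sc g (f i))"
  by (induction A rule: infinite_finite_induct) (auto simp: free_eval_add)

lemma free_eval_minus: "free_eval sc g (- x) = - free_eval sc g x"
  using free_eval_add[of x "- x"] by (simp add: eq_neg_iff_add_eq_0 add.commute)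

lemma free_eval_diff: "free_eval sc g (x - y) = free_eval sc g x - free_eval sc g y"
  using free_eval_add[of x "- y"] by (simp add: free_eval_minus)

lemma free_eval_mult: "free_eval sc g (x * y) = free_eval sc g x * free_eval sc g y"
proof (induction x rule: poly_mapping_add_induct)
  case (single u a)
  show ?case
  proof (induction y rule: poly_mapping_add_induct)
    case (single v b)
    then show ?case
      by (simp add: mult_single free_eval_single plus_fword_def sc_mult mult.assoc)
        (metis mult.assoc sc_central)
  qed (simp_all add: distrib_left free_eval_add)
qed (simp_all add: distrib_right free_eval_add)

lemma free_eval_one [simp]: "free_eval sc g 1 = 1"
  using free_eval_single[of "FWord []" 1] by (simp add: single_fword_Nil)

lemma free_eval_const [simp]: "free_eval sc g (Poly_Mapping.single 0 a) = sc a"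
  by (simp add: free_eval_single zero_fword_def)

lemma free_eval_gen [simp]: "free_eval sc g (free_gen y) = g y"
  by (simp add: free_gen_def free_eval_single)

lemma free_eval_prod_list: "free_eval sc g (prod_list xs) = prod_list (map (free_eval sc g) xs)"
  by (induction xs) (auto simp: free_eval_mult)

end

lemma one_free_alg [simp]: "1 \<in> free_alg Y"
  by (auto simp: free_alg_def zero_fword_def)

lemma free_alg_add: "f \<in> free_alg Y \<Longrightarrow> g \<in> free_alg Y \<Longrightarrow> f + g \<in> free_alg Y"
  using keys_add[of f g] by (auto simp: free_alg_def)

lemma zero_free_alg [simp]: "0 \<in> free_alg Y"
  by (simp add: free_alg_def)

lemma free_alg_uminus: "f \<in> free_alg Y \<Longrightarrow> - f \<in> free_alg (Y :: 'g set)" for f :: "'g fword \<Rightarrow>\<^sub>0 'r::ab_group_add"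
  by (simp add: free_alg_def in_keys_iff)

lemma free_alg_diff: "f \<in> free_alg Y \<Longrightarrow> g \<in> free_alg Y \<Longrightarrow> f - g \<in> free_alg (Y :: 'g set)" for f :: "'g fword \<Rightarrow>\<^sub>0 'r::ab_group_add"
  using free_alg_add[of f Y "- g"] free_alg_uminus[of g Y] by simp

lemma free_alg_mult: "f \<in> free_alg Y \<Longrightarrow> g \<in> free_alg Y \<Longrightarrow> f * g \<in> free_alg Y" for f :: "'g fword \<Rightarrow>\<^sub>0 'r::semiring_0"
  using keys_mult[of f g] by (fastforce simp: free_alg_def plus_fword_def)

lemma free_alg_single: "set (letters u) \<subseteq> Y \<Longrightarrow> Poly_Mapping.single u a \<in> free_alg Y"
  by (auto simp: free_alg_def)

lemma free_alg_const: "Poly_Mapping.single 0 a \<in> free_alg Y"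
  by (rule free_alg_single) (simp add: zero_fword_def)

lemma free_alg_gen: "y \<in> Y \<Longrightarrow> free_gen y \<in> free_alg Y"
  unfolding free_gen_def by (rule free_alg_single) simp

lemma free_alg_prod_list: "(\<And>x. x \<in> set xs \<Longrightarrow> x \<in> free_alg Y) \<Longrightarrow> prod_list xs \<in> free_alg (Y :: 'g set)"
  for xs :: "('g fword \<Rightarrow>\<^sub>0 'r::semiring_1) list"
  by (induction xs) (auto intro: free_alg_mult)

lemma free_alg_sum: "(\<And>i. i \<in> A \<Longrightarrow> f i \<in> free_alg Y) \<Longrightarrow> sum f A \<in> free_alg (Y :: 'g set)"
  for f :: "'i \<Rightarrow> 'g fword \<Rightarrow>\<^sub>0 'r::comm_monoid_add"
  by (induction A rule: infinite_finite_induct) (simp_all add: free_alg_add)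

lemma presented_algebra_map: "presented_algebra sc g Y R \<Longrightarrow> algebra_map sc"
  unfolding presented_algebra_def by (intro algebra_map.intro) blast+

lemma presented_algebra_rel:
  assumes "presented_algebra sc g Y R" "f \<in> R" "f \<in> free_alg Y"
  shows "free_eval sc g f = 0"
proof -
  have "1 * f * 1 \<in> two_sided_ideal (free_alg Y) R"
    using assms(2) by (intro two_sided_ideal.gen) auto
  then show ?thesis using assms by (auto simp: presented_algebra_def)
qed

text \<open>The coefficient \<open>v_s - v_s^-1\<close> of the quadratic relation; all
  \<open>v_s\<close> equal v because L(s) = 1.\<close>

definition lxi :: "int laurent" where "lxi = vpow 1 - vpow (- 1)"

section \<open>Linear independence of the elements T_w\<close>

locale hecke = coxeter G S for G :: "('w, 'c) monoid_scheme" (structure) and S +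
  fixes L :: "'w \<Rightarrow> int" and sc :: "int laurent \<Rightarrow> 'h::ring_1" and T :: "'w \<Rightarrow> 'h"
  assumes hecke_algebra: "hecke_algebra G S L sc T" and L_one: "\<forall>s\<in>S. L s = 1"
begin

lemma presented: "presented_algebra sc T S (hecke_rels G S L)"
  using hecke_algebra by (simp add: hecke_algebra_def)

sublocale algebra_map sc T
  using presented by (rule presented_algebra_map)

text \<open>Left and right multiplication by \<open>T\<^sub>s\<close>, in terms of the coefficients at the prospective basis \<open>T\<^sub>w\<close>. That they
  commute reduces the braid relations for \<open>lam\<close> to the value at 1, where they are evident.\<close>
definition lam :: "'w \<Rightarrow> ('w \<Rightarrow> int laurent) \<Rightarrow> 'w \<Rightarrow> int laurent" where
  "lam s f w = f (s \<otimes> w) + (if l (s \<otimes> w) < l w then lxi * f w else 0)"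

definition rho :: "'w \<Rightarrow> ('w \<Rightarrow> int laurent) \<Rightarrow> 'w \<Rightarrow> int laurent" where
  "rho t f w = f (w \<otimes> t) + (if l (w \<otimes> t) < l w then lxi * f w else 0)"

lemma lam_add: "lam s (\<lambda>w. f w + g w) = (\<lambda>w. lam s f w + lam s g w)"
  by (auto simp: lam_def fun_eq_iff algebra_simps)

lemma lam_mult: "lam s (\<lambda>w. a * f w) = (\<lambda>w. a * lam s f w)"
  by (auto simp: lam_def fun_eq_iff algebra_simps)

lemma foldr_lam_add: "foldr lam u (\<lambda>w. f w + g w) = (\<lambda>w. foldr lam u f w + foldr lam u g w)"
  by (induction u) (auto simp: lam_add)

lemma foldr_lam_mult: "foldr lam u (\<lambda>w. a * f w) = (\<lambda>w. a * foldr lam u f w)"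
  by (induction u) (auto simp: lam_mult)

lemma foldr_lam_zero: "foldr lam u (\<lambda>w. 0) = (\<lambda>w. 0)"
  using foldr_lam_mult[of u 0 "\<lambda>w. 0"] by simp

text \<open>Functions live on the whole type but identities are proved on \<open>carrier G\<close>;
  this allows them to be used below further operators.\<close>

lemma foldr_lam_cong:
  assumes "u \<in> lists S" "\<And>w. w \<in> carrier G \<Longrightarrow> f w = g w" "w \<in> carrier G"
  shows "foldr lam u f w = foldr lam u g w"
  using assms(1,3) by (induction u arbitrary: w rule: list.induct) (auto simp: assms(2) lam_def S_carrier)

text \<open>The representation of the free algebra in which generators act by \<open>lam\<close>. As
  it kills the relations on the group, it detects independence in the Hecke algebra.\<close>

definition hact :: "('w fword \<Rightarrow>\<^sub>0 int laurent) \<Rightarrow> ('w \<Rightarrow> int laurent) \<Rightarrow> 'w \<Rightarrow> int laurent" where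
  "hact x f = (\<lambda>w. \<Sum>u\<in>Poly_Mapping.keys x. Poly_Mapping.lookup x u * foldr lam (letters u) f w)"

lemma hact_zero [simp]: "hact 0 f = (\<lambda>w. 0)"
  by (simp add: hact_def)

lemma hact_single: "hact (Poly_Mapping.single u a) f = (\<lambda>w. a * foldr lam (letters u) f w)"
  by (auto simp: hact_def)

lemma hact_add: "hact (x + y) f = (\<lambda>w. hact x f w + hact y f w)"
  unfolding hact_def by (rule ext, rule setsum_keys_plus_distrib) (simp_all add: distrib_right)

lemma hact_minus: "hact (- x) f w = - hact x f w"
  using fun_cong[OF hact_add[of x "- x" f], of w] by (simp add: eq_neg_iff_add_eq_0 add.commute)

lemma hact_diff: "hact (x - y) f w = hact x f w - hact y f w"
  using fun_cong[OF hact_add[of x "- y" f], of w] by (simp add: hact_minus)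

lemma hact_add_right: "hact x (\<lambda>w. f w + g w) = (\<lambda>w. hact x f w + hact x g w)"
  by (auto simp: hact_def foldr_lam_add distrib_left sum.distrib)

lemma hact_zero_right: "hact x (\<lambda>w. 0) = (\<lambda>w. 0)"
  by (auto simp: hact_def foldr_lam_zero)

lemma hact_mult: "hact (x * y) f = hact x (hact y f)"
proof (induction x rule: poly_mapping_add_induct)
  case (single u a)
  show ?case
  proof (induction y rule: poly_mapping_add_induct)
    case (single v b)
    show ?case
      by (simp add: mult_single hact_single plus_fword_def foldr_lam_mult mult.assoc)
  qed (simp_all add: distrib_left hact_add hact_add_right hact_zero_right)
qed (simp_all add: distrib_right hact_add)

lemma hact_one [simp]: "hact 1 f = f"
  using hact_single[of "FWord []" 1 f] by (simp add: single_fword_Nil)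

lemma hact_gen: "hact (free_gen s) f = lam s f"
  by (simp add: free_gen_def hact_single)

lemma hact_const: "hact (Poly_Mapping.single 0 a) f = (\<lambda>w. a * f w)"
  by (simp add: hact_single zero_fword_def)

lemma hact_prod_list: "hact (prod_list (map free_gen u)) f = foldr lam u f"
  by (induction u) (auto simp: hact_mult hact_gen)

lemma hact_cong:
  assumes "x \<in> free_alg S" "\<And>w. w \<in> carrier G \<Longrightarrow> f w = g w" "w \<in> carrier G"
  shows "hact x f w = hact x g w"
  unfolding hact_def
proof (rule sum.cong)
  fix u assume "u \<in> Poly_Mapping.keys x"
  then have "letters u \<in> lists S" using assms(1) by (auto simp: free_alg_def)
  then show "Poly_Mapping.lookup x u * foldr lam (letters u) f w = Poly_Mapping.lookup x u * foldr lam (letters u) g w"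
    using foldr_lam_cong[of "letters u" f g w] assms by simp
qed simp

text \<open>Either \<open>sw = wt\<close>, and both composites unfold to the same terms; or passing
  from w to \<open>sw\<close> does not change whether t is a right descent, and likewise with the
  sides exchanged, so the correction terms correspond.\<close>

lemma lam_rho:
  assumes "s \<in> S" "t \<in> S" "w \<in> carrier G"
  shows "lam s (rho t f) w = rho t (lam s f) w"
proof (cases "conj_by G s w = t")
  case True
  then have sw: "s \<otimes> w = w \<otimes> t" using mult_conj_by[OF assms(1,3)] by simp
  have "s \<otimes> w \<otimes> t = w" using sw assms by simp
  moreover have "s \<otimes> (w \<otimes> t) = w" using sw[symmetric] assms by simp
  ultimately show ?thesis using sw by (simp add: lam_def rho_def algebra_simps)
next
  case False
  have c: "s \<in> carrier G" "t \<in> carrier G" "t \<in> reflections G S" using assms S_carrier S_reflections by auto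
  have cc: "conj_by G s w \<in> carrier G" using assms conj_by_carrier by blast
  have 1: "l (s \<otimes> w \<otimes> t) < l (s \<otimes> w) \<longleftrightarrow> l (w \<otimes> t) < l w"
    using len_mult_refl_less_iff[of "s \<otimes> w" t] len_mult_refl_less_iff[of w t] right_inv_S_mult[OF assms(1,3)] False c assms by auto
  have e: "conj_by G s (w \<otimes> t) = t \<otimes> conj_by G s w \<otimes> t"
    using c assms by (simp add: conj_by_def inv_mult_group m_assoc)
  have "t \<otimes> conj_by G s w \<otimes> t \<noteq> t"
  proof
    assume "t \<otimes> conj_by G s w \<otimes> t = t"
    then have "t \<otimes> (conj_by G s w \<otimes> t) = t \<otimes> \<one>" using c cc assms(2) by (simp add: m_assoc)
    then have "conj_by G s w \<otimes> t = \<one>" using l_cancel c cc by (meson m_closed one_closed)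
    then have "conj_by G s w \<otimes> t \<otimes> t = t" using c by simp
    then show False using False cc assms(2) by simp
  qed
  moreover have "t \<otimes> (t \<otimes> conj_by G s w \<otimes> t) \<otimes> inv t = conj_by G s w"
    using c cc assms(2) by (simp add: m_assoc)
  ultimately have "t \<otimes> conj_by G s w \<otimes> t \<in> right_inv (w \<otimes> t) \<longleftrightarrow> conj_by G s w \<in> right_inv w"
    using right_inv_mult[of w t "t \<otimes> conj_by G s w \<otimes> t"] c cc assms right_inv_S[OF assms(2)] by simp
  then have 2: "l (s \<otimes> (w \<otimes> t)) < l (w \<otimes> t) \<longleftrightarrow> l (s \<otimes> w) < l w"
    using len_S_mult_iff(1)[OF _ assms(1), of "w \<otimes> t"] len_S_mult_iff(1)[OF _ assms(1), of w] c assms e by simp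
  show ?thesis using 1 2 c assms by (simp add: lam_def rho_def m_assoc algebra_simps)
qed

lemma foldr_lam_rho:
  assumes "u \<in> lists S" "t \<in> S" "w \<in> carrier G"
  shows "foldr lam u (rho t f) w = rho t (foldr lam u f) w"
  using assms(1,3)
proof (induction u arbitrary: w rule: list.induct)
  case (Cons s u)
  then have "foldr lam (s # u) (rho t f) w = lam s (rho t (foldr lam u f)) w"
    using foldr_lam_cong[of "[s]" "foldr lam u (rho t f)" "rho t (foldr lam u f)" w] by simp
  then show ?case using lam_rho Cons assms by simp
qed simp

lemma len_wp_mult_le:
  assumes "u \<in> lists S" "w \<in> carrier G" shows "l (wp u \<otimes> w) \<le> length u + l w"
  using assms(1)
proof (induction u rule: list.induct)
  case (Cons s u)
  then have "l (s \<otimes> (wp u \<otimes> w)) \<le> l (wp u \<otimes> w) + 1"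
    using len_S_mult[of "wp u \<otimes> w" s] assms by (simp split: if_splits)
  with Cons assms show ?case by (simp add: m_assoc S_carrier)
qed (use assms in simp)

text \<open>The length grows with every letter on the way from w to the end point, so no correction
  term occurs and each \<open>lam\<close> is a translation.\<close>

lemma foldr_lam_up:
  assumes "u \<in> lists S" "w \<in> carrier G" "l (wp (rev u) \<otimes> w) = length u + l w"
  shows "foldr lam u f w = f (wp (rev u) \<otimes> w)"
  using assms
proof (induction u arbitrary: w rule: list.induct)
  case (Cons s u)
  then have s: "s \<in> S" "s \<in> carrier G" and u: "u \<in> lists S" "rev u \<in> lists S" using S_carrier by auto
  have e: "wp (rev (s # u)) \<otimes> w = wp (rev u) \<otimes> (s \<otimes> w)"
    using s u Cons.prems wp_append_S[OF u(2), of "[s]"] by (simp add: m_assoc del: wp_rev)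
  have "l (wp (rev u) \<otimes> (s \<otimes> w)) \<le> length u + l (s \<otimes> w)"
    using len_wp_mult_le[OF u(2), of "s \<otimes> w"] s Cons.prems by simp
  moreover have "l (s \<otimes> w) \<le> l w + 1" using len_S_mult[of w s] s Cons.prems by (simp split: if_splits)
  ultimately have "l (s \<otimes> w) = l w + 1" "l (wp (rev u) \<otimes> (s \<otimes> w)) = length u + l (s \<otimes> w)"
    using Cons.prems(3) e by auto
  then show ?case using Cons.IH[OF u(1), of "s \<otimes> w"] e s Cons.prems by (simp add: lam_def)
qed simp

lemma lam_square:
  assumes "s \<in> S" "w \<in> carrier G"
  shows "lam s (lam s f) w = f w + lxi * lam s f w"
  using len_S_mult_neq[OF assms(2,1)] assms by (auto simp: lam_def S_carrier algebra_simps)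

lemma lam_braid:
  assumes "s \<in> S" "t \<in> S" "cox_m G s t \<noteq> 0" "w \<in> carrier G"
  shows "foldr lam (alt_list (cox_m G s t) s t) f w = foldr lam (alt_list (cox_m G s t) t s) f w"
  using assms(4)
proof (induction "l w" arbitrary: w f rule: less_induct)
  case less
  let ?m = "cox_m G s t"
  have S: "alt_list ?m s t \<in> lists S" "alt_list ?m t s \<in> lists S" using assms alt_list_S by blast+
  show ?case
  proof (cases "w = \<one>")
    case True
    have red: "reduced (alt_list ?m s t)" "reduced (alt_list ?m t s)"
      using reduced_alt_list[OF assms(1,2), of ?m] reduced_alt_list[OF assms(2,1), of ?m] cox_m_commute[OF assms(1,2)] by auto
    have "foldr lam u f \<one> = f (inv (wp u))" if "reduced u" for u
      using foldr_lam_up[of u \<one> f] that by (auto simp: reduced_def)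
    then show ?thesis using True red wp_alt_list_braid[OF assms(1,2), of ?m] by simp
  next
    case False
    then obtain r where r: "r \<in> S" "r \<in> right_inv w"
      using parabolic_descent[of S w] less.prems generate_S by auto
    have lt: "l (w \<otimes> r) < l w" using len_mult_refl_less[OF less.prems r(2)] .
    have c: "w \<otimes> r \<in> carrier G" using r S_carrier less.prems by simp
    \<comment> \<open>As \<open>wr\<close> is shorter than w, applying \<open>rho r\<close> and
      evaluating at \<open>wr\<close> is evaluation at w, without a correction term.\<close>
    have e: "foldr lam u f w = foldr lam u (rho r f) (w \<otimes> r)" if "u \<in> lists S" for u
      using foldr_lam_rho[OF that r(1) c, of f] lt r less.prems by (simp add: rho_def)
    show ?thesis using e[OF S(1)] e[OF S(2)] less.hyps[OF lt c, of "rho r f"] by simp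
  qed
qed

lemma hecke_rels_free_alg: "hecke_rels G S L \<subseteq> free_alg S"
proof -
  have "prod_list (alt_list k (free_gen s) (free_gen t)) \<in> free_alg S" if "s \<in> S" "t \<in> S" for k s t
    using that set_alt_list[of k "free_gen s" "free_gen t"] by (intro free_alg_prod_list) (auto intro: free_alg_gen)
  then show ?thesis
    unfolding hecke_rels_def
    by (auto intro!: free_alg_diff free_alg_add free_alg_mult free_alg_gen free_alg_const)
qed

lemma map_alt_list: "map f (alt_list k a b) = alt_list k (f a) (f b)"
  by (auto simp: alt_list_def)

lemma hact_rels:
  assumes "r \<in> hecke_rels G S L" "w \<in> carrier G" shows "hact r f w = 0"
proof -
  consider (quad) s where "s \<in> S" "r = free_gen s * free_gen s
        - (1 + Poly_Mapping.single 0 (vpow (L s) - vpow (- L s)) * free_gen s)"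
    | (braid) s t where "s \<in> S" "t \<in> S" "cox_m G s t \<noteq> 0"
      "r = prod_list (alt_list (cox_m G s t) (free_gen s) (free_gen t))
        - prod_list (alt_list (cox_m G s t) (free_gen t) (free_gen s))"
    using assms(1) unfolding hecke_rels_def by blast
  then show ?thesis
  proof cases
    case quad
    then show ?thesis using L_one lam_square[OF quad(1) assms(2)]
      by (simp add: hact_diff hact_add hact_mult hact_gen hact_const lxi_def)
  next
    case braid
    then show ?thesis using lam_braid[OF braid(1-3) assms(2)]
      by (simp add: hact_diff hact_prod_list flip: map_alt_list)
  qed
qed

lemma hact_ideal:
  assumes "x \<in> two_sided_ideal (free_alg S) (hecke_rels G S L)" "w \<in> carrier G"
  shows "hact x f w = 0"
  using assms(1)
proof (induction)
  case (gen r a b)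
  have "hact (a * r * b) f w = hact a (hact r (hact b f)) w" by (simp add: hact_mult)
  also have "\<dots> = hact a (\<lambda>w. 0) w" using gen assms(2) by (intro hact_cong) (auto simp: hact_rels)
  finally show ?case by (simp add: hact_zero_right)
qed (auto simp: hact_add)

abbreviation TT :: "'w \<Rightarrow> 'h" where "TT \<equiv> hecke_T G S T"

text \<open>The delta function at 1 plays the role of the unit, from which a reduced word for w
  produces \<open>T_w\<close>.\<close>

lemma foldr_lam_delta:
  assumes "reduced u" "w \<in> carrier G"
  shows "foldr lam u (\<lambda>w. if w = \<one> then 1 else 0) w = (if w = wp u then 1 else 0)"
  using assms
proof (induction u arbitrary: w rule: list.induct)
  case (Cons s u)
  then have s: "s \<in> S" "s \<in> carrier G" and u: "u \<in> lists S" "reduced u" "l (s \<otimes> wp u) = l (wp u) + 1"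
    using S_carrier reduced_Cons by (auto simp: reduced_def)
  have "foldr lam (s # u) (\<lambda>w. if w = \<one> then 1 else 0) w = lam s (\<lambda>w. if w = wp u then 1 else 0) w"
    using foldr_lam_cong[of "[s]" "foldr lam u (\<lambda>w. if w = \<one> then 1 else 0)"] Cons.IH u s Cons.prems by simp
  moreover have e: "s \<otimes> w = wp u \<longleftrightarrow> w = s \<otimes> wp u" using S_square_left s(1) u(1) Cons.prems(2) by (metis wp_S)
  have "lam s (\<lambda>w. if w = wp u then 1 else 0) w = (if w = s \<otimes> wp u then 1 else 0)"
    using u e by (auto simp: lam_def)
  ultimately show ?case by simp
qed auto

text \<open>A vanishing combination lifts to an element of the ideal of relations, and acting on the
  delta function at 1 it returns its own coefficients.\<close>

lemma hecke_T_independent: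
  assumes "finite F" "F \<subseteq> carrier G" "(\<Sum>w\<in>F. sc (a w) * TT w) = 0" "w \<in> F"
  shows "a w = 0"
proof -
  define x where "x = (\<Sum>w\<in>F. Poly_Mapping.single (FWord (reduced_word G S w)) (a w))"
  have "x \<in> free_alg S"
    unfolding x_def using assms(2) reduced_word(1) by (intro free_alg_sum free_alg_single) auto
  moreover have "free_eval sc T x = 0"
    using assms(3) by (simp add: x_def free_eval_sum free_eval_single hecke_T_def)
  ultimately have "x \<in> two_sided_ideal (free_alg S) (hecke_rels G S L)"
    using presented by (simp add: presented_algebra_def)
  then have "hact x (\<lambda>w. if w = \<one> then 1 else 0) w = 0" using assms by (intro hact_ideal) auto
  moreover have "hact (sum g A) f w = (\<Sum>i\<in>A. hact (g i) f w)" for g f and A :: "'w set"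
    by (induction A rule: infinite_finite_induct) (auto simp: hact_add)
  moreover have "foldr lam (reduced_word G S w') (\<lambda>w. if w = \<one> then 1 else 0) w = (if w = w' then 1 else 0)" if "w' \<in> F" for w'
  proof -
    have "w' \<in> carrier G" "w \<in> carrier G" using that assms by auto
    then show ?thesis
      using foldr_lam_delta[of "reduced_word G S w'" w] reduced_word[of w'] by (auto simp: reduced_def)
  qed
  ultimately show ?thesis using assms by (simp add: x_def hact_single if_distrib cong: if_cong sum.cong)
qed

sublocale hmod: Modules.module "\<lambda>a h. sc a * h"
  by unfold_locales (auto simp: sc_add sc_mult distrib_left distrib_right mult.assoc)

lemma inj_TT: "inj_on TT (carrier G)"
proof (rule inj_onI, rule ccontr)
  fix v w assume vw: "v \<in> carrier G" "w \<in> carrier G" "TT v = TT w" "v \<noteq> w"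
  then have "(\<Sum>u\<in>{v, w}. sc (if u = v then 1 else - 1) * TT u) = 0" by (simp add: sc_minus)
  from hecke_T_independent[OF _ _ this, of v] vw show False by simp
qed

lemma independent_TT: "\<not> hmod.dependent (TT ` carrier G)"
proof
  assume "hmod.dependent (TT ` carrier G)"
  then obtain U u v where U: "finite U" "U \<subseteq> TT ` carrier G" "(\<Sum>h\<in>U. sc (u h) * h) = 0" "v \<in> U" "u v \<noteq> 0"
    unfolding hmod.dependent_explicit by auto
  then obtain F where F: "F \<subseteq> carrier G" "U = TT ` F" by (meson subset_image_iff)
  then have "inj_on TT F" using inj_TT inj_on_subset by blast
  then have "finite F" "(\<Sum>w\<in>F. sc (u (TT w)) * TT w) = 0"
    using U F finite_imageD by (auto simp: sum.reindex)
  then show False using hecke_T_independent[of F "\<lambda>w. u (TT w)"] F U by blast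
qed

abbreviation coeff :: "'h \<Rightarrow> 'w \<Rightarrow> int laurent" where "coeff \<equiv> hecke_coeff G S sc T"

lemma coeff_sum:
  assumes "finite F" "F \<subseteq> carrier G" "w \<in> carrier G"
  shows "coeff (\<Sum>v\<in>F. sc (a v) * TT v) w = (if w \<in> F then a w else 0)"
proof -
  have "coeff (\<Sum>v\<in>F. sc (a v) * TT v) w = (\<Sum>v\<in>F. a v * coeff (TT v) w)"
    unfolding hecke_coeff_def using assms
    by (subst hmod.representation_sum[OF independent_TT])
      (auto simp: hmod.representation_scale[OF independent_TT] hmod.span_base subset_iff intro!: hmod.span_scale sum.cong)
  also have "\<dots> = (\<Sum>v\<in>F. if v = w then a v else 0)"
  proof (rule sum.cong)
    fix v assume v: "v \<in> F"
    then have "TT v = TT w \<longleftrightarrow> v = w" using inj_TT assms by (auto dest: inj_onD)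
    then show "a v * coeff (TT v) w = (if v = w then a v else 0)"
      unfolding hecke_coeff_def using v assms by (subst hmod.representation_basis[OF independent_TT]) auto
  qed simp
  finally show ?thesis using assms by simp
qed

section \<open>Products of standard basis elements\<close>

lemma T_square: assumes "s \<in> S" shows "T s * T s = 1 + sc lxi * T s"
proof -
  have "free_gen s * free_gen s - (1 + Poly_Mapping.single 0 (vpow (L s) - vpow (- L s)) * free_gen s) \<in> hecke_rels G S L"
    using assms unfolding hecke_rels_def by blast
  then have "free_eval sc T (free_gen s * free_gen s - (1 + Poly_Mapping.single 0 (vpow (L s) - vpow (- L s)) * free_gen s)) = 0"
    using presented_algebra_rel[OF presented] hecke_rels_free_alg by blast
  then show ?thesis using L_one assms
    by (simp add: free_eval_diff free_eval_add free_eval_mult lxi_def)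
qed

lemma T_braid:
  assumes "s \<in> S" "t \<in> S" "cox_m G s t \<noteq> 0"
  shows "prod_list (map T (alt_list (cox_m G s t) s t)) = prod_list (map T (alt_list (cox_m G s t) t s))"
proof -
  have "prod_list (alt_list (cox_m G s t) (free_gen s) (free_gen t))
        - prod_list (alt_list (cox_m G s t) (free_gen t) (free_gen s)) \<in> hecke_rels G S L"
    using assms unfolding hecke_rels_def by blast
  then have "free_eval sc T (prod_list (alt_list (cox_m G s t) (free_gen s) (free_gen t))
        - prod_list (alt_list (cox_m G s t) (free_gen t) (free_gen s))) = 0"
    using presented_algebra_rel[OF presented] hecke_rels_free_alg by blast
  then show ?thesis
    by (simp add: free_eval_diff free_eval_prod_list map_alt_list)
qed

text \<open>\<open>hecke_T\<close> is defined by a chosen reduced word; Matsumoto's theorem permits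
  any other.\<close>

lemma TT_reduced: assumes "reduced u" shows "TT (wp u) = prod_list (map T u)"
proof -
  have "wp u \<in> carrier G" using assms by (simp add: reduced_def)
  note w = reduced_word[OF this]
  have "reduced (reduced_word G S (wp u))" using w by (simp add: reduced_def)
  then show ?thesis
    unfolding hecke_T_def using matsumoto[of T, OF T_braid] assms w(2) by blast
qed

lemma TT_mult:
  assumes "x \<in> carrier G" "u \<in> carrier G" "l (x \<otimes> u) = l x + l u"
  shows "TT x * TT u = TT (x \<otimes> u)"
proof -
  let ?v = "reduced_word G S x @ reduced_word G S u"
  have "?v \<in> lists S" "wp ?v = x \<otimes> u" using reduced_word[OF assms(1)] reduced_word[OF assms(2)] by auto
  moreover from this have "reduced ?v"
    unfolding reduced_def using reduced_word[OF assms(1)] reduced_word[OF assms(2)] assms by simp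
  ultimately show ?thesis using TT_reduced[of ?v] by (simp add: hecke_T_def)
qed

lemma TT_one [simp]: "TT \<one> = 1"
  using TT_reduced[of "[]"] by (simp add: reduced_def)

lemma reduced_S: "s \<in> S \<Longrightarrow> reduced [s]"
  by (auto simp: reduced_iff_card)

lemma len_S: "s \<in> S \<Longrightarrow> l s = 1"
  using reduced_S[of s] by (simp add: reduced_def S_carrier)

lemma TT_S: "s \<in> S \<Longrightarrow> TT s = T s"
  using TT_reduced[OF reduced_S[of s]] by (simp add: S_carrier)

lemma T_mult_TT_up:
  assumes "s \<in> S" "w \<in> carrier G" "l w < l (s \<otimes> w)"
  shows "T s * TT w = TT (s \<otimes> w)"
  using TT_mult[of s w] assms len_S[of s] len_S_mult[of w s] S_carrier by (auto simp: TT_S split: if_splits)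

lemma T_mult_TT_down:
  assumes "s \<in> S" "w \<in> carrier G" "l (s \<otimes> w) < l w"
  shows "T s * TT w = TT (s \<otimes> w) + sc lxi * TT w"
proof -
  have "TT w = T s * TT (s \<otimes> w)" using T_mult_TT_up[of s "s \<otimes> w"] assms S_carrier by simp
  then have "T s * TT w = T s * T s * TT (s \<otimes> w)" by (simp add: mult.assoc)
  also have "\<dots> = TT (s \<otimes> w) + sc lxi * (T s * TT (s \<otimes> w))"
    using T_square[OF assms(1)] by (simp add: distrib_right mult.assoc)
  finally show ?thesis using \<open>TT w = _\<close> by simp
qed

end

section \<open>Laurent polynomials and the bar involution\<close>

lemma lookup_lbar [simp]: "Poly_Mapping.lookup (lbar f) k = Poly_Mapping.lookup f (- k)"
  unfolding lbar_def by (subst map_key.rep_eq) (auto simp: inj_def)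

lemma lbar_zero [simp]: "lbar 0 = 0"
  by (rule poly_mapping_eqI) simp

lemma lbar_single [simp]: "lbar (Poly_Mapping.single k a) = Poly_Mapping.single (- k) a"
  by (rule poly_mapping_eqI) (auto simp: lookup_single when_def)

lemma lbar_one [simp]: "lbar 1 = 1"
  by (metis lbar_single minus_zero single_one)

lemma lbar_add: "lbar (f + g) = lbar f + lbar g"
  by (rule poly_mapping_eqI) (simp add: lookup_add)

text \<open>The filtration by lowest exponent. The bound is variable because \<open>v^-1\<close> and
  \<open>C_t\<close> lower it by one, so that their product with a positive element is still
  \<open>low 0\<close>.\<close>

definition low :: "int \<Rightarrow> 'a::zero laurent \<Rightarrow> bool" where
  "low c f \<longleftrightarrow> (\<forall>k<c. Poly_Mapping.lookup f k = 0)"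

abbreviation pos :: "'a::zero laurent \<Rightarrow> bool" where "pos \<equiv> low 1"

lemma low_keys: "low c f \<longleftrightarrow> Poly_Mapping.keys f \<subseteq> {c..}"
  unfolding low_def by (auto simp: in_keys_iff subset_iff) (metis not_le)+

lemma pos_keys: "pos f \<longleftrightarrow> Poly_Mapping.keys f \<subseteq> {0<..}"
  unfolding low_keys by (auto simp: subset_iff)

lemma low_mono: "low c f \<Longrightarrow> d \<le> c \<Longrightarrow> low d f"
  by (auto simp: low_def)

lemma low_zero [simp]: "low c 0" by (simp add: low_def)

lemma low_single: "c \<le> k \<Longrightarrow> low c (Poly_Mapping.single k a)"
  by (auto simp: low_def lookup_single when_def)

lemma low_add: "low c f \<Longrightarrow> low c g \<Longrightarrow> low c (f + g)" for f g :: "'a::comm_monoid_add laurent"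
  by (simp add: low_def lookup_add)

lemma low_minus: "low c f \<Longrightarrow> low c (- f)" for f :: "'a::ab_group_add laurent"
  by (simp add: low_def)

lemma low_diff: "low c f \<Longrightarrow> low c g \<Longrightarrow> low c (f - g)" for f g :: "'a::ab_group_add laurent"
  by (simp add: low_def lookup_minus)

lemma low_sum: "(\<And>i. i \<in> A \<Longrightarrow> low c (f i)) \<Longrightarrow> low c (sum f A)" for f :: "'i \<Rightarrow> 'a::comm_monoid_add laurent"
  by (induction A rule: infinite_finite_induct) (auto intro: low_add)

lemma low_mult: "low c f \<Longrightarrow> low d g \<Longrightarrow> low (c + d) (f * g)" for f :: "'a::semiring_0 laurent"
  unfolding low_keys using keys_mult[of f g] by fastforce

lemma pos_lbar_eq_zero: assumes "pos f" "lbar f = f" shows "f = 0"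
proof (rule poly_mapping_eqI)
  fix k
  have "Poly_Mapping.lookup f k = Poly_Mapping.lookup f (- k)" using lookup_lbar[of f k] assms(2) by simp
  then show "Poly_Mapping.lookup f k = Poly_Mapping.lookup 0 k"
    using assms(1) by (cases "k \<le> 0") (auto simp: low_def)
qed

section \<open>Extension of an action to Laurent polynomials\<close>

locale laurent_action =
  fixes act :: "'a::ab_group_add \<Rightarrow> 'n::ab_group_add \<Rightarrow> 'n"
  assumes act_add_left: "act (a + b) m = act a m + act b m"
    and act_add_right: "act a (m + n) = act a m + act a n"
begin

lemma act_zero [simp]: "act 0 m = 0" "act a 0 = 0"
  using act_add_left[of 0 0 m] act_add_right[of a 0 0] by simp_all

lemma act_minus_right: "act a (- m) = - act a m"
  using act_add_right[of a m "- m"] by (simp add: eq_neg_iff_add_eq_0 add.commute)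

lemma act_minus_left: "act (- a) m = - act a m"
  using act_add_left[of a "- a" m] by (simp add: eq_neg_iff_add_eq_0 add.commute)

lemma act_diff_left: "act (a - b) m = act a m - act b m"
  using act_add_left[of a "- b" m] by (simp add: act_minus_left)

lemma lact_single [simp]:
  "lact act (Poly_Mapping.single i a) (Poly_Mapping.single j m) = Poly_Mapping.single (i + j) (act a m)"
  by (auto simp: lact_def)

lemma lact_add_left: "lact act (f + g) u = lact act f u + lact act g u"
  unfolding lact_def
  by (rule setsum_keys_plus_distrib) (simp_all add: act_add_left single_add sum.distrib)

lemma lact_zero_left [simp]: "lact act 0 u = 0" and lact_zero_right [simp]: "lact act f 0 = 0"
  by (simp_all add: lact_def)

lemma lact_add_right: "lact act f (u + w) = lact act f u + lact act f w"
proof -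
  have "(\<Sum>j\<in>Poly_Mapping.keys (u + w). Poly_Mapping.single (i + j) (act a (Poly_Mapping.lookup (u + w) j))) =
    (\<Sum>j\<in>Poly_Mapping.keys u. Poly_Mapping.single (i + j) (act a (Poly_Mapping.lookup u j))) +
    (\<Sum>j\<in>Poly_Mapping.keys w. Poly_Mapping.single (i + j) (act a (Poly_Mapping.lookup w j)))" for i a
    by (rule setsum_keys_plus_distrib) (simp_all add: act_add_right single_add)
  then show ?thesis unfolding lact_def by (simp add: sum.distrib)
qed

lemma laurent_action_lact: "laurent_action (lact act)"
  by unfold_locales (simp_all add: lact_add_left lact_add_right)

lemma lbar_lact: "lbar (lact act f u) = lact act (lbar f) (lbar u)"
proof (induction f rule: poly_mapping_add_induct)
  case (single i a)
  show ?case by (induction u rule: poly_mapping_add_induct) (simp_all add: lact_add_right lbar_add)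
qed (simp_all add: lact_add_left lbar_add)

lemma lookup_lact_single:
  "Poly_Mapping.lookup (lact act (Poly_Mapping.single i a) u) k = act a (Poly_Mapping.lookup u (k - i))"
proof (induction u rule: poly_mapping_add_induct)
  case (single j m)
  then show ?case by (auto simp: lookup_single when_def)
qed (simp_all add: lact_add_right lookup_add act_add_right)

lemma low_lact: assumes "low c f" "low d u" shows "low (c + d) (lact act f u)"
proof -
  have "low (c + d) (Poly_Mapping.single (i + j) (act (Poly_Mapping.lookup f i) (Poly_Mapping.lookup u j)))"
    if "i \<in> Poly_Mapping.keys f" "j \<in> Poly_Mapping.keys u" for i j
    using that assms by (intro low_single add_mono) (auto simp: low_keys)
  then show ?thesis unfolding lact_def by (intro low_sum)
qed

end

lemma lact_mult:
  fixes act :: "'a::ring_1 \<Rightarrow> 'n::ab_group_add \<Rightarrow> 'n"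
  assumes "laurent_action act" "\<And>a b m. act (a * b) m = act a (act b m)"
  shows "lact act (f * g) u = lact act f (lact act g u)"
proof -
  interpret laurent_action act by fact
  show ?thesis
  proof (induction f rule: poly_mapping_add_induct)
    case (single i a)
    show ?case
    proof (induction g rule: poly_mapping_add_induct)
      case (single j b)
      show ?case
        by (induction u rule: poly_mapping_add_induct) (simp_all add: mult_single lact_add_right assms(2) add.assoc)
    qed (simp_all add: lact_add_left lact_add_right distrib_left)
  qed (simp_all add: lact_add_left distrib_right)
qed

lemma lact_one:
  fixes act :: "'a::ring_1 \<Rightarrow> 'n::ab_group_add \<Rightarrow> 'n"
  assumes "laurent_action act" "\<And>m. act 1 m = m"
  shows "lact act (vpow 0) u = u" "lact act 1 u = u"
proof -
  interpret laurent_action act by fact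
  show "lact act (vpow 0) u = u"
    by (induction u rule: poly_mapping_add_induct) (simp_all add: lact_add_right assms(2) del: single_one)
  then show "lact act 1 u = u" by simp
qed

lemma lact_commute:
  assumes "laurent_action act1" "laurent_action act2" "\<And>a b m. act1 a (act2 b m) = act2 b (act1 a m)"
  shows "lact act1 f (lact act2 g u) = lact act2 g (lact act1 f u)"
proof -
  interpret A: laurent_action act1 by fact
  interpret B: laurent_action act2 by fact
  show ?thesis
  proof (induction f rule: poly_mapping_add_induct)
    case (single i a)
    show ?case
    proof (induction g rule: poly_mapping_add_induct)
      case (single j b)
      show ?case
        by (induction u rule: poly_mapping_add_induct)
          (simp_all add: A.lact_add_right B.lact_add_right assms(3) add.left_commute)
    qed (simp_all add: B.lact_add_left A.lact_add_right)
  qed (simp_all add: A.lact_add_left B.lact_add_right)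
qed

section \<open>The bar involution of the Hecke algebra\<close>

locale hecke_inv = hecke G S L sc T for G :: "('w, 'c) monoid_scheme" (structure) and S L
    and sc :: "int laurent \<Rightarrow> 'h::ring_1" and T +
  fixes \<iota> :: "'h \<Rightarrow> 'h" and J :: "'w set"
  assumes hecke_bar: "hecke_bar S sc T \<iota>" and J_subset: "J \<subseteq> S"
begin

lemma bar_one [simp]: "\<iota> 1 = 1" and bar_add: "\<iota> (g + h) = \<iota> g + \<iota> h" and bar_mult: "\<iota> (g * h) = \<iota> g * \<iota> h"
  using hecke_bar by (auto simp: hecke_bar_def)

lemma bar_T: assumes "s \<in> S" shows "\<iota> (T s) = T s - sc lxi"
proof -
  have "T s * (T s - sc lxi) = 1"
    using T_square[OF assms] sc_central[of lxi "T s"] by (simp add: right_diff_distrib)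
  moreover have "\<iota> (T s) * T s = 1" using hecke_bar assms by (auto simp: hecke_bar_def)
  ultimately show ?thesis by (metis mult.assoc mult_1_left mult_1_right)
qed

lemma hecke_span_mult:
  assumes "\<And>b. b \<in> B \<Longrightarrow> g * b \<in> hmod.span B'" "h \<in> hmod.span B"
  shows "g * h \<in> hmod.span B'"
  using assms(2)
proof (induction rule: hmod.span_induct_alt)
  case (step c x y)
  have "g * (sc c * x) = sc c * (g * x)" using sc_central[of c g] by (metis mult.assoc)
  then show ?case using step assms(1) by (auto simp: distrib_left intro!: hmod.span_add hmod.span_scale)
qed (simp add: hmod.span_zero)

text \<open>For \<open>y = s y'\<close> with y' shorter,
  \<open>\<iota>(T_y) = (T_s - v + v^-1) \<iota>(T_y')\<close>, and by \<open>bruhat_S_mult\<close>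
  both w and \<open>sw\<close> lie below y whenever w lies below y'.\<close>

lemma bar_TT_span:
  assumes "y \<in> carrier G" shows "\<iota> (TT y) \<in> hmod.span (TT ` {w. bruhat_le G S w y})"
  using assms
proof (induction "l y" arbitrary: y rule: less_induct)
  case less
  show ?case
  proof (cases "y = \<one>")
    case True
    then have "\<iota> (TT y) = TT y" by simp
    then show ?thesis by (metis hmod.span_base image_eqI mem_Collect_eq bruhat_refl)
  next
    case False
    have "reduced_word G S y \<noteq> []" using reduced_word(2)[OF less.prems] False by auto
    then obtain s u where u: "reduced_word G S y = s # u" by (meson neq_Nil_conv)
    have "reduced (s # u)" using reduced_word[OF less.prems] u by (simp add: reduced_def)
    note r = reduced_Cons[OF this]
    define y' where "y' = wp u"
    have s: "s \<in> S" "s \<in> carrier G" and y': "y' \<in> carrier G" "y = s \<otimes> y'" "l y = l y' + 1"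
      using reduced_word[OF less.prems] u r S_carrier by (auto simp: y'_def)
    have "\<iota> (TT y) = (T s - sc lxi) * \<iota> (TT y')"
      using T_mult_TT_up[OF s(1) y'(1)] y' bar_T[OF s(1)] bar_mult[of "T s" "TT y'"] by simp
    moreover have "(T s - sc lxi) * b \<in> hmod.span (TT ` {w. bruhat_le G S w y})"
      if "b \<in> TT ` {w. bruhat_le G S w y'}" for b
    proof -
      from that obtain w where w: "b = TT w" "bruhat_le G S w y'" by blast
      have wc: "w \<in> carrier G" using bruhat_le_carrier[OF w(2)] y' by simp
      have le: "bruhat_le G S y' y" using bruhat_less_S_mult_iff[OF y'(1) s(1)] y' by (simp add: bruhat_less_def)
      have "bruhat_le G S w y" using bruhat_trans[OF w(2) le] .
      moreover have "bruhat_le G S (s \<otimes> w) y"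
        using bruhat_S_mult[OF w(2) y'(1) s(1)] bruhat_trans le y' by blast
      ultimately have sp: "TT w \<in> hmod.span (TT ` {w. bruhat_le G S w y})"
        "TT (s \<otimes> w) \<in> hmod.span (TT ` {w. bruhat_le G S w y})"
        by (auto intro: hmod.span_base)
      have "T s * TT w \<in> hmod.span (TT ` {w. bruhat_le G S w y})"
      proof (cases "l w < l (s \<otimes> w)")
        case True
        then show ?thesis using sp by (simp add: T_mult_TT_up[OF s(1) wc])
      next
        case False
        then have "l (s \<otimes> w) < l w" using len_S_mult_neq[OF wc s(1)] by simp
        then show ?thesis using hmod.span_add[OF sp(2) hmod.span_scale[OF sp(1)]] by (simp add: T_mult_TT_down[OF s(1) wc])
      qed
      then show ?thesis
        using hmod.span_diff hmod.span_scale[OF sp(1), of lxi] w by (simp add: left_diff_distrib)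
    qed
    moreover have "\<iota> (TT y') \<in> hmod.span (TT ` {w. bruhat_le G S w y'})" using less.hyps[of y'] y' by simp
    ultimately show ?thesis
      using hecke_span_mult[of "TT ` {w. bruhat_le G S w y'}" "T s - sc lxi" "TT ` {w. bruhat_le G S w y}"] by simp
  qed
qed

abbreviation Rp :: "'w \<Rightarrow> 'w \<Rightarrow> int laurent" where "Rp \<equiv> R_poly G S sc T \<iota>"

lemma bar_TT:
  assumes "y \<in> carrier G"
  shows "\<iota> (TT y) = (\<Sum>w\<in>{w. bruhat_le G S w y}. sc (Rp w y) * TT w)"
    "\<And>w. w \<in> carrier G \<Longrightarrow> \<not> bruhat_le G S w y \<Longrightarrow> Rp w y = 0"
proof -
  let ?A = "{w. bruhat_le G S w y}"
  have A: "finite ?A" "?A \<subseteq> carrier G" using finite_bruhat_lower[OF assms] bruhat_le_carrier assms by auto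
  have inj: "inj_on TT ?A" using inj_TT A(2) inj_on_subset by blast
  obtain a where "\<iota> (TT y) = (\<Sum>h\<in>TT ` ?A. sc (a h) * h)"
    using bar_TT_span[OF assms] hmod.span_finite[of "TT ` ?A"] A(1) by auto
  then have e: "\<iota> (TT y) = (\<Sum>w\<in>?A. sc (a (TT w)) * TT w)" using inj by (simp add: sum.reindex)
  have R: "Rp w y = (if w \<in> ?A then a (TT w) else 0)" if "w \<in> carrier G" for w
    unfolding R_poly_def e using coeff_sum[OF A that] .
  show "\<iota> (TT y) = (\<Sum>w\<in>?A. sc (Rp w y) * TT w)"
    unfolding e using R A(2) by (intro sum.cong) auto
  show "\<And>w. w \<in> carrier G \<Longrightarrow> \<not> bruhat_le G S w y \<Longrightarrow> Rp w y = 0" using R by simp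
qed

text \<open>The component in \<open>H_J\<close> of \<open>\<iota>(T_y)\<close> at
  \<open>T_x\<close>, that is, \<open>r_x,y\<close> before the embedding. It is kept inside the
  Hecke algebra because the balancing relation of the tensor product moves elements of
  \<open>H_J\<close>.\<close>

definition bar_comp :: "'w \<Rightarrow> 'w \<Rightarrow> 'h" where
  "bar_comp x y = Sum_any (\<lambda>u. if u \<in> generate G J then sc (Rp (x \<otimes> u) y) * TT u else 0)"

lemma bar_comp_sum:
  assumes "x \<in> carrier G" "y \<in> carrier G"
  shows "finite {u \<in> generate G J. bruhat_le G S (x \<otimes> u) y}" (is "finite ?U")
    "bar_comp x y = (\<Sum>u\<in>{u \<in> generate G J. bruhat_le G S (x \<otimes> u) y}. sc (Rp (x \<otimes> u) y) * TT u)"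
proof -
  have c: "u \<in> carrier G" if "u \<in> generate G J" for u using that parabolic_carrier J_subset by blast
  have "inj_on (\<lambda>u. x \<otimes> u) ?U" using c assms by (auto intro!: inj_onI)
  moreover have "(\<lambda>u. x \<otimes> u) ` ?U \<subseteq> {w. bruhat_le G S w y}" by auto
  ultimately show fin: "finite ?U" using finite_bruhat_lower[OF assms(2)] by (meson finite_imageD finite_subset)
  show "bar_comp x y = (\<Sum>u\<in>?U. sc (Rp (x \<otimes> u) y) * TT u)"
    unfolding bar_comp_def using bar_TT(2)[OF assms(2)] c assms fin
    by (subst Sum_any.expand_superset[OF fin]) (auto intro!: sum.cong intro: ccontr)
qed

lemma bar_comp_par: assumes "x \<in> carrier G" "y \<in> carrier G" shows "bar_comp x y \<in> hecke_par G S J sc T"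
  unfolding hecke_par_def bar_comp_sum(2)[OF assms]
  by (intro hmod.span_sum hmod.span_scale hmod.span_base) auto

text \<open>The expansion of \<open>\<iota>(T_y)\<close> is grouped by cosets: every element is
  uniquely \<open>xu\<close> with x in D_J and u in W_J, \<open>T_xu = T_x T_u\<close>, and
  \<open>x \<le> xu \<le> y\<close> confines x to the lower set of y.\<close>

lemma bar_TT_decomp:
  assumes "y \<in> carrier G"
  shows "\<iota> (TT y) = (\<Sum>x\<in>{x \<in> DJ G S J. bruhat_le G S x y}. TT x * bar_comp x y)"
proof -
  let ?A = "{w. bruhat_le G S w y}" and ?D = "{x \<in> DJ G S J. bruhat_le G S x y}"
    and ?U = "\<lambda>x. {u \<in> generate G J. bruhat_le G S (x \<otimes> u) y}" and ?f = "\<lambda>(x, u). x \<otimes> u"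
  have c: "u \<in> carrier G" if "u \<in> generate G J" for u using that parabolic_carrier J_subset by blast
  have inj: "inj_on ?f (Sigma ?D ?U)"
  proof (rule inj_onI, clarify)
    fix x u x' u' assume "x \<in> DJ G S J" "x' \<in> DJ G S J" "u \<in> generate G J" "u' \<in> generate G J" "x \<otimes> u = x' \<otimes> u'"
    then show "x = x' \<and> u = u'" using parabolic_decomp_unique[OF J_subset] by blast
  qed
  have img: "?f ` Sigma ?D ?U = ?A"
  proof
    show "?A \<subseteq> ?f ` Sigma ?D ?U"
    proof
      fix w assume w: "w \<in> ?A"
      then have "w \<in> carrier G" using bruhat_le_carrier assms by blast
      then obtain x u where xu: "x \<in> DJ G S J" "u \<in> generate G J" "w = x \<otimes> u"
        using parabolic_decomp[OF J_subset] by blast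
      moreover from this have "bruhat_le G S x y"
        using bruhat_trans[OF DJ_le_mult_parabolic[OF J_subset xu(1,2)], of y] w by simp
      ultimately show "w \<in> ?f ` Sigma ?D ?U" using w by (intro image_eqI[of _ _ "(x, u)"]) auto
    qed
  qed auto
  have finD: "finite ?D" using finite_bruhat_lower[OF assms] by (rule rev_finite_subset) auto
  have "\<iota> (TT y) = (\<Sum>(x, u)\<in>Sigma ?D ?U. sc (Rp (x \<otimes> u) y) * TT (x \<otimes> u))"
    unfolding bar_TT(1)[OF assms] img[symmetric] sum.reindex[OF inj] by (simp add: case_prod_beta)
  also have "\<dots> = (\<Sum>x\<in>?D. \<Sum>u\<in>?U x. sc (Rp (x \<otimes> u) y) * TT (x \<otimes> u))"
    using finD bar_comp_sum(1)[OF DJ_carrier[of _ J] assms] by (subst sum.Sigma) auto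
  also have "\<dots> = (\<Sum>x\<in>?D. TT x * bar_comp x y)"
  proof (rule sum.cong)
    fix x assume x: "x \<in> ?D"
    then have xc: "x \<in> carrier G" using DJ_carrier by blast
    have "sc (Rp (x \<otimes> u) y) * TT (x \<otimes> u) = TT x * (sc (Rp (x \<otimes> u) y) * TT u)" if "u \<in> ?U x" for u
    proof -
      have "TT (x \<otimes> u) = TT x * TT u"
        using TT_mult[OF xc c] len_mult_parabolic[OF J_subset] x that by simp
      then show ?thesis using sc_central by (metis mult.assoc)
    qed
    then show "(\<Sum>u\<in>?U x. sc (Rp (x \<otimes> u) y) * TT (x \<otimes> u)) = TT x * bar_comp x y"
      unfolding bar_comp_sum(2)[OF xc assms] sum_distrib_left by (intro sum.cong) auto
  qed simp
  finally show ?thesis .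
qed

lemma TT_par: "u \<in> generate G J \<Longrightarrow> TT u \<in> hecke_par G S J sc T"
  unfolding hecke_par_def by (intro hmod.span_base) auto

lemma sc_par: "sc a \<in> hecke_par G S J sc T"
proof -
  have "sc a * TT \<one> \<in> hecke_par G S J sc T"
    unfolding hecke_par_def by (intro hmod.span_scale hmod.span_base imageI generate.one)
  then show ?thesis by simp
qed

text \<open>This yields the embedding at the generators \<open>T_t\<close> with t in J and at
  scalars; other elements of \<open>H_J\<close> are only met through \<open>r_elem\<close>.\<close>

lemma hecke_embed_scale_TT:
  fixes E :: "'w \<Rightarrow> 'o::ring_1"
  assumes "u \<in> generate G J"
  shows "hecke_embed G S L J sc T E X (sc a * TT u) =
    Poly_Mapping.map of_int a * prod_list (map (omega_T L E X) (reduced_word G S u))"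
proof -
  have c: "w \<in> carrier G" if "w \<in> generate G J" for w using that parabolic_carrier J_subset by blast
  have "coeff (sc a * TT u) w = (if w = u then a else 0)" if "w \<in> generate G J" for w
    using coeff_sum[of "{u}" w "\<lambda>_. a"] c that assms by simp
  moreover have "Poly_Mapping.map of_int 0 = (0 :: 'o laurent)" by (simp add: map_eq_zero_iff)
  ultimately have "hecke_embed G S L J sc T E X (sc a * TT u) = Sum_any (\<lambda>w. if w = u then
    Poly_Mapping.map of_int a * prod_list (map (omega_T L E X) (reduced_word G S u)) else 0)"
    unfolding hecke_embed_def using assms
    by (intro arg_cong[where f = Sum_any] ext) auto
  then show ?thesis by simp
qed

lemma reduced_word_S: assumes "s \<in> S" shows "reduced_word G S s = [s]"
proof -
  have "length (reduced_word G S s) = 1" using reduced_word(3)[of s] assms by (simp add: S_carrier len_S)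
  then obtain t where t: "reduced_word G S s = [t]" by (metis One_nat_def length_0_conv length_Suc_conv)
  then show ?thesis using reduced_word[of s] assms by (auto simp: S_carrier)
qed

lemma hecke_embed_T:
  fixes E :: "'w \<Rightarrow> 'o::ring_1"
  assumes "t \<in> J" shows "hecke_embed G S L J sc T E X (T t) = omega_T L E X t"
proof -
  have t: "t \<in> S" "t \<in> generate G J" using assms J_subset by (auto intro: generate.incl)
  have "Poly_Mapping.map of_int (1 :: int laurent) = (1 :: 'o laurent)"
    by (simp flip: single_one)
  then show ?thesis using hecke_embed_scale_TT[OF t(2), of E X 1] t TT_S[OF t(1)] reduced_word_S[OF t(1)]
    by simp
qed

lemma hecke_embed_sc:
  fixes E :: "'w \<Rightarrow> 'o::ring_1"
  shows "hecke_embed G S L J sc T E X (sc a) = Poly_Mapping.map of_int a"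
proof -
  have "reduced_word G S \<one> = []" using reduced_word(3)[OF one_closed] by simp
  then show ?thesis
    using hecke_embed_scale_TT[OF generate.one, of E X a] by simp
qed

lemma r_elem_eq: "r_elem G S L J sc T \<iota> E X x y = hecke_embed G S L J sc T E X (bar_comp x y)"
  by (simp add: r_elem_def bar_comp_def)

end

section \<open>The induced module and its canonical basis\<close>

lemma zmul_add: "zmul (m + n) x = zmul m x + zmul n x"
proof -
  define f where "f = (\<lambda>n::nat. \<Sum>i<n. x)"
  have f: "f (a + b) = f a + f b" for a b
    by (induction b) (auto simp: f_def add.assoc)
  \<comment> \<open>Without subtraction the identity holds for the truncating \<open>nat\<close>,
    and the additivity of f on natural numbers applies.\<close>
  have "nat (m + n) + nat (- m) + nat (- n) = nat m + nat n + nat (- (m + n))" by linarith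
  then have "f (nat (m + n)) + f (nat (- m)) + f (nat (- n)) = f (nat m) + f (nat n) + f (nat (- (m + n)))"
    by (metis f)
  then have e: "f (nat (m + n)) = f (nat m) + f (nat n) + f (nat (- (m + n))) - f (nat (- n)) - f (nat (- m))"
    by (metis add_diff_cancel_right')
  have z: "zmul k x = f (nat k) - f (nat (- k))" for k by (simp add: zmul_def f_def)
  show ?thesis unfolding z e by (simp add: algebra_simps)
qed

lemma zmul_0 [simp]: "zmul 0 x = 0" and zmul_1 [simp]: "zmul 1 x = x"
  by (simp_all add: zmul_def)

lemma frag_lift_add: "frag_lift t (f + g) = frag_lift t f + frag_lift t g"
  unfolding frag_lift_def by (rule setsum_keys_plus_distrib) (simp_all add: zmul_add)

lemma frag_lift_of [simp]: "frag_lift t (frag_of b) = t b"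
  by (simp add: frag_lift_def keys_frag_of)

lemma frag_lift_minus: "frag_lift t (- f) = - frag_lift t f"
  using frag_lift_add[of t f "- f"] by (simp add: frag_lift_def eq_neg_iff_add_eq_0 add.commute)

lemma frag_lift_diff: "frag_lift t (f - g) = frag_lift t f - frag_lift t g"
  using frag_lift_add[of t f "- g"] by (simp add: frag_lift_minus)

locale tensor =
  fixes A :: "'h::ring_1 set" and actV :: "'h \<Rightarrow> 'v::ab_group_add \<Rightarrow> 'v" and t :: "'h \<Rightarrow> 'v \<Rightarrow> 'i::ab_group_add"
  assumes tensor_product: "tensor_product A actV t"
begin

lemma rel: "f \<in> tensor_rels A actV \<Longrightarrow> frag_lift (case_prod t) f = 0"
  using tensor_product by (auto simp: tensor_product_def)

lemma tens_add_left: "t (g + h) u = t g u + t h u"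
  using rel[OF tensor_rels.addl[of g h u]] by (simp add: frag_lift_diff frag_lift_add algebra_simps)

lemma tens_add_right: "t h (u + w) = t h u + t h w"
  using rel[OF tensor_rels.addr[of h u w]] by (simp add: frag_lift_diff frag_lift_add algebra_simps)

lemma tens_bal: "c \<in> A \<Longrightarrow> t (h * c) u = t h (actV c u)"
  using rel[OF tensor_rels.bal[of c A h u]] by (simp add: frag_lift_diff)

lemma tens_zero [simp]: "t 0 u = 0" "t h 0 = 0"
  using tens_add_left[of 0 0 u] tens_add_right[of h 0 0] by simp_all

lemma tens_minus_left: "t (- h) u = - t h u"
  using tens_add_left[of h "- h" u] by (simp add: eq_neg_iff_add_eq_0 add.commute)

lemma tens_minus_right: "t h (- u) = - t h u"
  using tens_add_right[of h u "- u"] by (simp add: eq_neg_iff_add_eq_0 add.commute)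

lemma tens_diff_left: "t (g - h) u = t g u - t h u"
  using tens_add_left[of g "- h" u] by (simp add: tens_minus_left)

lemma tens_diff_right: "t h (u - w) = t h u - t h w"
  using tens_add_right[of h u "- w"] by (simp add: tens_minus_right)

lemma tens_sum_left: "t (sum f B) u = (\<Sum>b\<in>B. t (f b) u)"
  by (induction B rule: infinite_finite_induct) (auto simp: tens_add_left)

lemma tens_sum_right: "t h (sum f B) = (\<Sum>b\<in>B. t h (f b))"
  by (induction B rule: infinite_finite_induct) (auto simp: tens_add_right)

text \<open>A negative multiple of a pure tensor is a sum of copies of
  \<open>(-h) \<otimes> u\<close>, and 0 is itself pure, so sums of pure tensors exhaust the
  module.\<close>

lemma tensor_induct [case_names tens add]:
  assumes "\<And>h u. P (t h u)" "\<And>x y. P x \<Longrightarrow> P y \<Longrightarrow> P (x + y)"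
  shows "P i"
proof -
  have P0: "P 0" using assms(1)[of 0 0] by simp
  have Psum: "P (sum f B)" if "\<And>b. b \<in> B \<Longrightarrow> P (f b)" for f and B :: "'b set"
    using that by (induction B rule: infinite_finite_induct) (auto intro: P0 assms(2))
  obtain f where f: "frag_lift (case_prod t) f = i" using tensor_product by (auto simp: tensor_product_def)
  have "P (zmul n (t h u))" for n h u
  proof -
    have "zmul n (t h u) = (\<Sum>i<nat n. t h u) + (\<Sum>i<nat (- n). t (- h) u)"
      by (simp add: zmul_def tens_minus_left sum_negf)
    moreover have "P (\<Sum>i<nat n. t h u)" "P (\<Sum>i<nat (- n). t (- h) u)"
      by (rule Psum, rule assms(1))+
    ultimately show ?thesis using assms(2) by metis
  qed
  then have "P (frag_lift (case_prod t) f)"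
    unfolding frag_lift_def by (intro Psum) (auto simp: case_prod_beta)
  then show ?thesis using f by simp
qed

end

section \<open>The induced module with its scalars and its involution\<close>

locale hy_data = hecke_inv G S L sc T \<iota> J
  for G :: "('w, 'c) monoid_scheme" (structure) and S L and sc :: "int laurent \<Rightarrow> 'h::ring_1" and T \<iota> J +
  fixes E :: "'w \<Rightarrow> 'o::ring_1" and X :: "'w \<Rightarrow> int \<Rightarrow> 'o"
    and p :: "'w \<Rightarrow> 'w \<Rightarrow> 'o laurent" and \<mu> :: "'w \<Rightarrow> 'w \<Rightarrow> 'w \<Rightarrow> 'o laurent"
    and sM :: "'k::comm_ring_1 \<Rightarrow> 'm::ab_group_add \<Rightarrow> 'm" and act :: "'o \<Rightarrow> 'm \<Rightarrow> 'm" and B :: "'m set"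
    and tens :: "'h \<Rightarrow> 'm laurent \<Rightarrow> 'i::ab_group_add" and scI :: "'k laurent \<Rightarrow> 'i \<Rightarrow> 'i"
    and actI :: "'h \<Rightarrow> 'i \<Rightarrow> 'i" and \<iota>I :: "'i \<Rightarrow> 'i" and C :: "'w \<Rightarrow> 'm \<Rightarrow> 'i"
  assumes omega_algebra: "omega_algebra G J L E X"
    and p_family: "p_family G S L J sc T \<iota> E X p"
    and mu_family: "mu_family G S L J E X p \<mu>"
    and omega_module: "omega_module sM act"
    and basis_B: "basis_of sM UNIV B"
    and diag_B: "\<And>s b. s \<in> J \<Longrightarrow> b \<in> B \<Longrightarrow> act (E s) b = 0 \<or> act (E s) b = b"
    and induced_module: "induced_module G S L J sc T \<iota> E X sM act tens scI actI \<iota>I"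
    and hy_basis: "hy_basis G S J T B tens scI \<iota>I C"
begin

abbreviation "D \<equiv> DJ G S J"
abbreviation "He \<equiv> hecke_embed G S L J sc T E X"
abbreviation lac (infixr "\<star>" 75) where "a \<star> u \<equiv> lact act a u"
abbreviation "r \<equiv> r_elem G S L J sc T \<iota> E X"

lemma DG: "x \<in> D \<Longrightarrow> x \<in> carrier G" using DJ_carrier by blast

sublocale M: Modules.module sM
  using omega_module by (simp add: omega_module_def)

lemma act_hom: "Modules.module_hom sM sM (act a)"
  and act_one [simp]: "act 1 m = m"
  and act_add: "act (a + b) m = act a m + act b m"
  and act_mult: "act (a * b) m = act a (act b m)"
  using omega_module by (auto simp: omega_module_def)

lemma act_scale: "act a (sM k m) = sM k (act a m)"
  using act_hom by (rule Modules.module_hom.scale)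

sublocale A: laurent_action act
  by unfold_locales (auto simp: act_add Modules.module_hom.add[OF act_hom])

sublocale K: laurent_action sM
  by unfold_locales (auto simp: M.scale_left_distrib M.scale_right_distrib)

lemma star_mult: "(a * b) \<star> u = a \<star> b \<star> u"
  by (rule lact_mult) (unfold_locales, rule act_mult)

lemma star_one [simp]: "1 \<star> u = u"
  by (rule lact_one) (unfold_locales, rule act_one)

lemma star_scale: "a \<star> lact sM f u = lact sM f (a \<star> u)"
  by (rule lact_commute) (unfold_locales, rule act_scale)

text \<open>Powers of v act on V both as elements of k[\<Gamma>] and as elements of
  \<int>[\<Gamma>]\<Omega>_J; identifying the two keeps all computations with coefficients in one
  action.\<close>

lemma scale_vpow: "lact sM (vpow k) u = vpow k \<star> u"
  by (rule poly_mapping_eqI) (simp add: A.lookup_lact_single K.lookup_lact_single)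

sublocale tensor "hecke_par G S J sc T" "\<lambda>h u. He h \<star> u" tens
  using induced_module by unfold_locales (simp add: induced_module_def)

lemma scI_add_right: "scI a (x + y) = scI a x + scI a y"
  and scI_tens [simp]: "scI a (tens h u) = tens h (lact sM a u)"
  and actI_add_right: "actI g (x + y) = actI g x + actI g y"
  and actI_tens [simp]: "actI g (tens h u) = tens (g * h) u"
  and iI_add: "\<iota>I (x + y) = \<iota>I x + \<iota>I y"
  and iI_tens [simp]: "\<iota>I (tens h u) = tens (\<iota> h) (lbar u)"
  using induced_module by (auto simp: induced_module_def add_hom_def)

sublocale I: Modules.module scI
proof
  fix a b x y
  show "scI a (x + y) = scI a x + scI a y" by (rule scI_add_right)
  show "scI (a + b) x = scI a x + scI b x"
    by (induction x rule: tensor_induct) (simp_all add: scI_add_right K.lact_add_left tens_add_right)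
  have "lact sM (a * b) u = lact sM a (lact sM b u)" for u
    by (rule lact_mult) (unfold_locales, simp)
  then show "scI a (scI b x) = scI (a * b) x"
    by (induction x rule: tensor_induct) (simp_all add: scI_add_right)
  have "lact sM 1 u = u" for u by (rule lact_one) (unfold_locales, simp)
  then show "scI 1 x = x" by (induction x rule: tensor_induct) (simp_all add: scI_add_right)
qed

lemma actI_sum: "actI g (sum f F) = (\<Sum>i\<in>F. actI g (f i))"
proof -
  have "actI g 0 = 0" using actI_add_right[of g 0 0] by simp
  then show ?thesis by (induction F rule: infinite_finite_induct) (auto simp: actI_add_right)
qed

lemma iI_zero [simp]: "\<iota>I 0 = 0"
  using iI_add[of 0 0] by simp

lemma iI_sum: "\<iota>I (sum f F) = (\<Sum>i\<in>F. \<iota>I (f i))"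
  by (induction F rule: infinite_finite_induct) (auto simp: iI_add)

lemma iI_minus: "\<iota>I (- x) = - \<iota>I x"
  using iI_add[of x "- x"] by (simp add: eq_neg_iff_add_eq_0 add.commute)

lemma iI_diff: "\<iota>I (x - y) = \<iota>I x - \<iota>I y"
  using iI_add[of x "- y"] by (simp add: iI_minus)

lemma actI_diff_left: "actI (g - h) x = actI g x - actI h x"
proof (induction x rule: tensor_induct)
  case (tens h u)
  then show ?case by (simp add: left_diff_distrib tens_diff_left)
next
  case (add x y)
  then show ?case by (simp add: actI_add_right)
qed

lemma iI_actI: "\<iota>I (actI g x) = actI (\<iota> g) (\<iota>I x)"
  by (induction x rule: tensor_induct) (simp_all add: actI_add_right iI_add bar_mult)

lemma iI_scI: "\<iota>I (scI a x) = scI (lbar a) (\<iota>I x)"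
  by (induction x rule: tensor_induct) (simp_all add: scI_add_right iI_add K.lbar_lact)

lemma map_of_int_lxi: "Poly_Mapping.map of_int lxi = (vpow 1 - vpow (- 1) :: 'o laurent)"
  by (rule poly_mapping_eqI) (simp add: lxi_def lookup_minus lookup_single map.rep_eq when_def)

text \<open>Scalars of H are central and lie in \<open>H_J\<close>, so they pass through the tensor
  sign and act there like elements of k[\<Gamma>].\<close>

lemma actI_lxi: "actI (sc lxi) x = scI (vpow 1) x - scI (vpow (- 1)) x"
proof (induction x rule: tensor_induct)
  case (tens h u)
  have "tens (sc lxi * h) u = tens (h * sc lxi) u" by (metis sc_central)
  also have "\<dots> = tens h ((vpow 1 - vpow (- 1)) \<star> u)"
    by (simp add: tens_bal[OF sc_par] hecke_embed_sc map_of_int_lxi)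
  finally show ?case
    by (simp add: scale_vpow A.laurent_action_lact[THEN laurent_action.act_diff_left] tens_diff_right)
next
  case (add x y)
  then show ?case by (simp add: actI_add_right scI_add_right)
qed

lemma star_diff: "(a - b) \<star> u = a \<star> u - b \<star> u"
  and star_minus: "(- a) \<star> u = - (a \<star> u)"
  and star_minus_right: "a \<star> (- u) = - (a \<star> u)"
  using A.laurent_action_lact
  by (simp_all add: laurent_action.act_diff_left laurent_action.act_minus_left laurent_action.act_minus_right)

lemma star_diff_right: "a \<star> (u - w) = a \<star> u - a \<star> w"
  using A.lact_add_right[of a u "- w"] by (simp add: star_minus_right)

lemma star_sum: "(sum f F) \<star> u = (\<Sum>i\<in>F. f i \<star> u)"
  by (induction F rule: infinite_finite_induct) (auto simp: A.lact_add_left)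

text \<open>That the sum of the \<open>T\<^sub>y \<otimes> V\<close> is direct is read off from the given basis, which is related to the
  standard elements by a unitriangular transformation (\<open>coordC_T\<close>).\<close>

lemma independent_B: "\<not> M.dependent B" and span_B: "M.span B = UNIV"
  using basis_B by (auto simp: basis_of_def)

abbreviation "CB \<equiv> case_prod C ` (D \<times> B)"

lemma inj_C: "inj_on (case_prod C) (D \<times> B)"
  and independent_CB: "\<not> I.dependent CB" and span_CB: "I.span CB = UNIV"
  using hy_basis by (auto simp: hy_basis_def basis_of_def)

lemma C_bar: "x \<in> D \<Longrightarrow> b \<in> B \<Longrightarrow> \<iota>I (C x b) = C x b"
  using hy_basis by (auto simp: hy_basis_def)

lemma C_triangular:
  assumes "x \<in> D" "b \<in> B"
  shows "\<exists>f. (\<forall>w. pos (f w)) \<and>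
    C x b = tens (TT x) (Poly_Mapping.single 0 b) + (\<Sum>w\<in>{w \<in> D. bruhat_less G S w x}. tens (TT w) (f w))"
  using hy_basis assms unfolding hy_basis_def pos_keys by blast

definition coordC :: "'w \<Rightarrow> 'm \<Rightarrow> 'i \<Rightarrow> 'k laurent" where
  "coordC x b i = I.representation CB i (C x b)"

definition coordV :: "'m \<Rightarrow> 'm laurent \<Rightarrow> 'k laurent" where
  "coordV b u = Poly_Mapping.map (\<lambda>m. M.representation B m b) u"

lemma coordC_add: "coordC x b (i + j) = coordC x b i + coordC x b j"
  unfolding coordC_def by (subst I.representation_add[OF independent_CB]) (auto simp: span_CB)

lemma coordC_scale: "coordC x b (scI a i) = a * coordC x b i"
  unfolding coordC_def by (subst I.representation_scale[OF independent_CB]) (auto simp: span_CB)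

lemma coordC_zero [simp]: "coordC x b 0 = 0"
  using coordC_add[of x b 0 0] by simp

lemma coordC_sum: "coordC x b (sum f F) = (\<Sum>i\<in>F. coordC x b (f i))"
  by (induction F rule: infinite_finite_induct) (auto simp: coordC_add)

lemma coordC_C:
  assumes "x \<in> D" "b \<in> B" "y \<in> D" "b' \<in> B"
  shows "coordC x b (C y b') = (if x = y \<and> b = b' then 1 else 0)"
proof -
  have "C y b' = C x b \<longleftrightarrow> x = y \<and> b = b'"
    using inj_onD[OF inj_C, of "(y, b')" "(x, b)"] assms by auto
  then show ?thesis
    unfolding coordC_def using assms by (subst I.representation_basis[OF independent_CB]) auto
qed

lemma repB_zero [simp]: "M.representation B 0 b = 0"
  by (simp add: M.representation_zero)

lemma repB_add: "M.representation B (m + n) b = M.representation B m b + M.representation B n b"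
  by (subst M.representation_add[OF independent_B]) (auto simp: span_B)

lemma lookup_coordV: "Poly_Mapping.lookup (coordV b u) k = M.representation B (Poly_Mapping.lookup u k) b"
  by (simp add: coordV_def map.rep_eq when_def)

lemma coordV_add: "coordV b (u + w) = coordV b u + coordV b w"
  by (rule poly_mapping_eqI) (simp add: lookup_coordV lookup_add repB_add)

lemma coordV_zero [simp]: "coordV b 0 = 0"
  by (rule poly_mapping_eqI) (simp add: lookup_coordV)

lemma coordV_diff: "coordV b (u - w) = coordV b u - coordV b w"
  using coordV_add[of b "u - w" w] by simp

lemma coordV_single: "coordV b (Poly_Mapping.single k m) = Poly_Mapping.single k (M.representation B m b)"
  by (rule poly_mapping_eqI) (simp add: lookup_coordV lookup_single when_def)

lemma coordV_eq_zero: assumes "\<And>b. b \<in> B \<Longrightarrow> coordV b u = 0" shows "u = 0"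
proof (rule poly_mapping_eqI)
  fix k
  have "M.representation B (Poly_Mapping.lookup u k) b = 0" if "b \<in> B" for b
    using assms[OF that] lookup_coordV[of b u k] by simp
  then have "M.representation B (Poly_Mapping.lookup u k) b = 0" for b
    using M.representation_ne_zero by blast
  moreover have "(\<Sum>b\<in>{b. M.representation B (Poly_Mapping.lookup u k) b \<noteq> 0}. sM (M.representation B (Poly_Mapping.lookup u k) b) b) = Poly_Mapping.lookup u k"
    by (rule M.sum_nonzero_representation_eq[OF independent_B]) (simp add: span_B)
  ultimately show "Poly_Mapping.lookup u k = Poly_Mapping.lookup 0 k" by simp
qed

lemma laurent_M_induct [case_names basis add]:
  assumes "\<And>k c b. b \<in> B \<Longrightarrow> P (lact sM (Poly_Mapping.single k c) (Poly_Mapping.single 0 b))"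
    "\<And>u w. P u \<Longrightarrow> P w \<Longrightarrow> P (u + w)" "P 0"
  shows "P u"
proof (induction u rule: poly_mapping_add_induct)
  case (single k m)
  have "m \<in> M.span B" by (simp add: span_B)
  then show ?case
  proof (induction rule: M.span_induct_alt)
    case (step c x y)
    have "Poly_Mapping.single k (sM c x + y) = lact sM (Poly_Mapping.single k c) (Poly_Mapping.single 0 x) + Poly_Mapping.single k y"
      by (simp add: single_add)
    then show ?case using assms(1)[of x k c] assms(2) step by simp
  qed (simp add: assms(3))
qed (use assms in auto)

text \<open>Induction on l(y): \<open>C_y,b\<close> and \<open>T_y \<otimes> b\<close> differ by
  terms of smaller length, which do not reach x. The bound is by length because topmost coefficients
  are chosen by length.\<close>

lemma coordC_T:
  assumes "x \<in> D" "b \<in> B" "y \<in> D" "l y \<le> l x"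
  shows "coordC x b (tens (TT y) u) = (if x = y then coordV b u else 0)"
  using assms(3,4)
proof (induction "l y" arbitrary: y u rule: less_induct)
  case less
  have base: "coordC x b (tens (TT y) (Poly_Mapping.single 0 b')) = (if x = y \<and> b = b' then 1 else 0)" if b': "b' \<in> B" for b'
  proof -
    obtain f where f: "C y b' = tens (TT y) (Poly_Mapping.single 0 b') + (\<Sum>w\<in>{w \<in> D. bruhat_less G S w y}. tens (TT w) (f w))"
      using C_triangular[OF less.prems(1) b'] by blast
    have "coordC x b (tens (TT w) (f w)) = 0" if w: "w \<in> D" "bruhat_less G S w y" for w
    proof -
      have "l w < l y" using bruhat_less_len[OF w(2)] .
      then show ?thesis using less.hyps[of w] w(1) less.prems by auto
    qed
    then have "coordC x b (C y b') = coordC x b (tens (TT y) (Poly_Mapping.single 0 b'))"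
      unfolding f by (simp add: coordC_add coordC_sum)
    then show ?thesis using coordC_C[OF assms(1,2) less.prems(1) b'] by simp
  qed
  show ?case
  proof (induction u rule: laurent_M_induct)
    case (basis k c b')
    have "coordC x b (tens (TT y) (lact sM (Poly_Mapping.single k c) (Poly_Mapping.single 0 b'))) =
      Poly_Mapping.single k c * coordC x b (tens (TT y) (Poly_Mapping.single 0 b'))"
      using coordC_scale[of x b "Poly_Mapping.single k c" "tens (TT y) (Poly_Mapping.single 0 b')"] by (simp only: scI_tens)
    moreover have "M.representation B (sM c b') b = c * (if b' = b then 1 else 0)"
      using basis by (simp add: M.representation_scale[OF independent_B] M.representation_basis[OF independent_B] span_B)
    ultimately show ?case using base[OF basis] by (auto simp: coordV_single)
  qed (auto simp: tens_add_right coordC_add coordV_add)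
qed

lemma ex_max_nonzero:
  fixes g :: "'w \<Rightarrow> 'x::zero"
  assumes "finite F" "\<exists>y\<in>F. g y \<noteq> 0"
  shows "\<exists>y\<in>F. g y \<noteq> 0 \<and> (\<forall>y'\<in>F. l y < l y' \<longrightarrow> g y' = 0)"
proof -
  let ?M = "{y \<in> F. g y \<noteq> 0}"
  have "Max (l ` ?M) \<in> l ` ?M" using assms by (intro Max_in) auto
  then obtain y where y: "y \<in> ?M" "l y = Max (l ` ?M)" by auto
  have "g y' = 0" if "y' \<in> F" "l y < l y'" for y'
  proof (rule ccontr)
    assume "g y' \<noteq> 0"
    then have "l y' \<le> Max (l ` ?M)" using assms that by (intro Max_ge) auto
    then show False using that y by simp
  qed
  then show ?thesis using y by blast
qed

lemma coordC_T_sum: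
  assumes "finite F" "F \<subseteq> D" "x \<in> F" "b \<in> B" "\<forall>y\<in>F. l x < l y \<longrightarrow> g y = 0"
  shows "coordC x b (\<Sum>y\<in>F. tens (TT y) (g y)) = coordV b (g x)"
proof -
  have "coordC x b (tens (TT y) (g y)) = (if y = x then coordV b (g x) else 0)" if "y \<in> F" for y
  proof (cases "l y \<le> l x")
    case True
    then show ?thesis using coordC_T[of x b y "g y"] assms that by (auto simp: subset_iff)
  next
    case False
    then have "g y = 0" using assms(5) that by simp
    moreover have "y \<noteq> x" using False by auto
    ultimately show ?thesis by simp
  qed
  then show ?thesis using assms by (simp add: coordC_sum)
qed

section \<open>Elements that are invariant under the involution\<close>

lemma p_props:
  assumes "x \<in> D" "z \<in> D"
  shows "low 0 (p x z)" "p z z = 1" "\<not> bruhat_le G S x z \<Longrightarrow> p x z = 0" "x \<noteq> z \<Longrightarrow> pos (p x z)"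
    "p x z = (\<Sum>y\<in>{y \<in> D. bruhat_le G S x y \<and> bruhat_le G S y z}. r x y * lbar (p y z))"
proof -
  note * = bspec[OF bspec[OF p_family[unfolded p_family_def] assms(1)] assms(2)]
  show "low 0 (p x z)" unfolding low_keys using * by (elim conjE)
  show "p z z = 1" using * by (elim conjE)
  show "p x z = (\<Sum>y\<in>{y \<in> D. bruhat_le G S x y \<and> bruhat_le G S y z}. r x y * lbar (p y z))"
    using * by (elim conjE)
  show le: "p x z = 0" if "\<not> bruhat_le G S x z" using * that by (elim conjE) (erule mp)
  show "pos (p x z)" if "x \<noteq> z"
  proof (cases "bruhat_le G S x z")
    case True
    then have "bruhat_less G S x z" using that by (simp add: bruhat_less_def)
    with * show ?thesis unfolding pos_keys by (elim conjE) (erule mp)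
  qed (simp add: le)
qed

text \<open>Read off from the recursion for p at x = z, where the sum has a single term.\<close>

lemma r_diag: assumes "z \<in> D" shows "r z z = 1"
proof -
  have "{y \<in> D. bruhat_le G S z y \<and> bruhat_le G S y z} = {z}" using assms bruhat_antisym by auto
  then have "p z z = r z z * lbar (p z z)" using p_props(5)[OF assms assms] by simp
  then show ?thesis using p_props(2)[OF assms assms] by simp
qed

lemma finite_lower_D: "z \<in> carrier G \<Longrightarrow> finite {y \<in> D. bruhat_le G S y z}"
  by (rule finite_subset[OF _ finite_bruhat_lower]) auto

lemma iI_T:
  assumes "y \<in> D"
  shows "\<iota>I (tens (TT y) u) = (\<Sum>x\<in>{x \<in> D. bruhat_le G S x y}. tens (TT x) (r x y \<star> lbar u))"
proof -
  have "tens (TT x * bar_comp x y) (lbar u) = tens (TT x) (r x y \<star> lbar u)" if "x \<in> D" for x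
    using tens_bal[OF bar_comp_par[OF DG[OF that] DG[OF assms]]] by (simp add: r_elem_eq)
  then show ?thesis
    by (simp only: iI_tens bar_TT_decomp[OF DG[OF assms]] tens_sum_left) (rule sum.cong, auto)
qed

text \<open>At \<open>T_x\<close>, a term with l(y) \<le> l(x) contributes to the image under the
  involution only for y = x, with factor \<open>r_x,x = 1\<close>; the coefficients at longer y
  vanish.\<close>

lemma bar_invariant_top:
  assumes "finite F" "F \<subseteq> D" "\<iota>I (\<Sum>y\<in>F. tens (TT y) (g y)) = (\<Sum>y\<in>F. tens (TT y) (g y))"
    "x \<in> F" "\<forall>y\<in>F. l x < l y \<longrightarrow> g y = 0"
  shows "lbar (g x) = g x"
proof -
  have xD: "x \<in> D" using assms by blast
  have "coordV b (lbar (g x) - g x) = 0" if b: "b \<in> B" for b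
  proof -
    have "coordC x b (\<iota>I (tens (TT y) (g y))) = (if y = x then coordV b (lbar (g x)) else 0)" if y: "y \<in> F" for y
    proof (cases "l y \<le> l x")
      case True
      have yD: "y \<in> D" using y assms by blast
      have "coordC x b (tens (TT w) (r w y \<star> lbar (g y))) = (if w = x then if y = x then coordV b (lbar (g x)) else 0 else 0)"
        if w: "w \<in> D" "bruhat_le G S w y" for w
      proof -
        have "l w \<le> l y" using bruhat_le_len[OF w(2)] by auto
        moreover have "y = x" if "w = x" using bruhat_le_len[OF w(2)] True that by auto
        ultimately show ?thesis using coordC_T[OF xD b w(1)] True r_diag[OF xD] by auto
      qed
      then have "coordC x b (\<iota>I (tens (TT y) (g y))) =
        (\<Sum>w\<in>{w \<in> D. bruhat_le G S w y}. if w = x then if y = x then coordV b (lbar (g x)) else 0 else 0)"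
        unfolding iI_T[OF yD] coordC_sum by (intro sum.cong) auto
      then show ?thesis using finite_lower_D[OF DG[OF yD]] xD by (auto simp: sum.delta)
    next
      case False
      then have "g y = 0" using assms(5) y by simp
      moreover have "y \<noteq> x" using False by auto
      ultimately show ?thesis by simp
    qed
    then have "coordC x b (\<iota>I (\<Sum>y\<in>F. tens (TT y) (g y))) = coordV b (lbar (g x))"
      unfolding iI_sum coordC_sum using assms(1,4) by (simp add: sum.delta del: iI_tens cong: sum.cong)
    then show ?thesis using coordC_T_sum[OF assms(1,2,4) b assms(5)] assms(3) by (simp add: coordV_diff)
  qed
  then have "lbar (g x) - g x = 0" by (rule coordV_eq_zero)
  then show ?thesis by simp
qed

text \<open>The reason why a topmost coefficient vanishes is left as a premise, since
  \<open>T_canon_descent\<close> argues differently for the three kinds of cosets.\<close>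

lemma bar_invariant_zero:
  assumes "finite F" "F \<subseteq> D" "\<iota>I (\<Sum>y\<in>F. tens (TT y) (g y)) = (\<Sum>y\<in>F. tens (TT y) (g y))"
    "\<And>x. x \<in> F \<Longrightarrow> \<forall>y\<in>F. l x < l y \<longrightarrow> g y = 0 \<Longrightarrow> lbar (g x) = g x \<Longrightarrow> g x = 0"
    "y \<in> F"
  shows "g y = 0"
proof (rule ccontr)
  assume "g y \<noteq> 0"
  then have "\<exists>y\<in>F. g y \<noteq> 0" using assms by blast
  then obtain x where "x \<in> F" "g x \<noteq> 0" "\<forall>y'\<in>F. l x < l y' \<longrightarrow> g y' = 0"
    using ex_max_nonzero[OF assms(1), of g] by blast
  then show False using assms(4) bar_invariant_top[OF assms(1-3)] by blast
qed

lemma bar_invariant_pos_zero: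
  assumes "finite F" "F \<subseteq> D" "\<iota>I (\<Sum>y\<in>F. tens (TT y) (g y)) = (\<Sum>y\<in>F. tens (TT y) (g y))"
    "\<And>x. x \<in> F \<Longrightarrow> pos (g x)"
  shows "(\<Sum>y\<in>F. tens (TT y) (g y)) = 0"
proof (rule sum.neutral, rule ballI)
  fix y assume "y \<in> F"
  then have "g y = 0" using bar_invariant_zero[OF assms(1-3)] pos_lbar_eq_zero assms(4) by blast
  then show "tens (TT y) (g y) = 0" by simp
qed

section \<open>The elements c(z|m)\<close>

definition canon :: "'w \<Rightarrow> 'm \<Rightarrow> 'i" where
  "canon z m = (\<Sum>y\<in>{y \<in> D. bruhat_le G S y z}. tens (TT y) (p y z \<star> Poly_Mapping.single 0 m))"

text \<open>Allows elements belonging to different z to be written over a common index set.\<close>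

lemma canon_superset:
  assumes "z \<in> D" "finite F" "F \<subseteq> D" "{y \<in> D. bruhat_le G S y z} \<subseteq> F"
  shows "canon z m = (\<Sum>y\<in>F. tens (TT y) (p y z \<star> Poly_Mapping.single 0 m))"
  unfolding canon_def using assms p_props(3) by (intro sum.mono_neutral_left) (auto simp: subset_iff)

lemma canon_bar: assumes "z \<in> D" shows "\<iota>I (canon z m) = canon z m"
proof -
  let ?D = "{y \<in> D. bruhat_le G S y z}" and ?m = "Poly_Mapping.single 0 m"
  let ?t = "\<lambda>x y. tens (TT x) ((r x y * lbar (p y z)) \<star> ?m)"
  have fin: "finite ?D" using finite_lower_D DG assms by blast
  have "\<iota>I (canon z m) = (\<Sum>y\<in>?D. \<Sum>x\<in>{x \<in> ?D. bruhat_le G S x y}. ?t x y)"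
  proof -
    have "\<iota>I (tens (TT y) (p y z \<star> ?m)) = (\<Sum>x\<in>{x \<in> ?D. bruhat_le G S x y}. ?t x y)" if y: "y \<in> ?D" for y
    proof -
      have "{x \<in> D. bruhat_le G S x y} = {x \<in> ?D. bruhat_le G S x y}" using y bruhat_trans by blast
      moreover have "y \<in> D" using y by simp
      ultimately show ?thesis by (simp only: iI_T A.lbar_lact star_mult lbar_single minus_zero)
    qed
    then show ?thesis unfolding canon_def iI_sum by (rule sum.cong[OF HOL.refl])
  qed
  also have "\<dots> = (\<Sum>x\<in>?D. \<Sum>y\<in>{y \<in> ?D. bruhat_le G S x y}. ?t x y)"
    by (rule sum.swap_restrict[OF fin fin])
  also have "\<dots> = canon z m"
    unfolding canon_def
  proof (rule sum.cong)
    fix x assume x: "x \<in> ?D"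
    have "{y \<in> ?D. bruhat_le G S x y} = {y \<in> D. bruhat_le G S x y \<and> bruhat_le G S y z}" by auto
    then show "(\<Sum>y\<in>{y \<in> ?D. bruhat_le G S x y}. ?t x y) = tens (TT x) (p x z \<star> ?m)"
      using p_props(5)[of x z] x assms by (simp add: star_sum tens_sum_right)
  qed simp
  finally show ?thesis .
qed

lemma canon_eq_C: assumes x: "x \<in> D" and b: "b \<in> B" shows "canon x b = C x b"
proof -
  let ?F = "{y \<in> D. bruhat_le G S y x}"
  have fin: "finite ?F" using finite_lower_D DG x by blast
  obtain f where f: "\<And>w. pos (f w)"
    "C x b = tens (TT x) (Poly_Mapping.single 0 b) + (\<Sum>w\<in>{w \<in> D. bruhat_less G S w x}. tens (TT w) (f w))"
    using C_triangular[OF x b] by blast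
  define h where "h = (\<lambda>w. if w = x then Poly_Mapping.single 0 b else f w)"
  define g where "g = (\<lambda>w. h w - p w x \<star> Poly_Mapping.single 0 b)"
  have "?F = insert x {w \<in> D. bruhat_less G S w x}" using x by (auto simp: bruhat_less_def)
  moreover have "x \<notin> {w \<in> D. bruhat_less G S w x}" by (simp add: bruhat_less_def)
  ultimately have "(\<Sum>w\<in>?F. tens (TT w) (h w)) = tens (TT x) (h x) + (\<Sum>w\<in>{w \<in> D. bruhat_less G S w x}. tens (TT w) (h w))"
    using fin by simp
  also have "\<dots> = C x b"
    unfolding f(2) by (auto simp: h_def bruhat_less_def intro!: sum.cong)
  finally have e: "(\<Sum>w\<in>?F. tens (TT w) (g w)) = C x b - canon x b"
    by (simp add: g_def canon_def tens_diff_right sum_subtractf)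
  have "(\<Sum>w\<in>?F. tens (TT w) (g w)) = 0"
  proof (rule bar_invariant_pos_zero[OF fin])
    show "\<iota>I (\<Sum>w\<in>?F. tens (TT w) (g w)) = (\<Sum>w\<in>?F. tens (TT w) (g w))"
      unfolding e by (simp add: iI_diff canon_bar[OF x] C_bar[OF x b])
    fix w assume w: "w \<in> ?F"
    show "pos (g w)"
    proof (cases "w = x")
      case True
      then show ?thesis using p_props(2)[OF x x] by (simp add: g_def h_def)
    next
      case False
      then have "pos (p w x)" using p_props(4)[of w x] w x by blast
      then have "pos (p w x \<star> Poly_Mapping.single 0 b)"
        using A.low_lact[of 1 "p w x" 0 "Poly_Mapping.single 0 b"] by (simp add: low_single)
      then show ?thesis using False f(1) by (simp add: g_def h_def low_diff)
    qed
  qed auto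
  then show ?thesis using e by simp
qed

section \<open>The action of the Hecke algebra on the canonical basis\<close>

lemma L_J: "t \<in> J \<Longrightarrow> L t = 1"
  using L_one J_subset by blast

lemma omega_relation:
  assumes "t \<in> J"
  shows "E t * E t = E t" "E t * X t 0 = X t 0" "X t 0 * E t = 0"
proof -
  let ?g = "\<lambda>g. case g of Evar s \<Rightarrow> E s | Xvar s \<gamma> \<Rightarrow> X s \<gamma>"
  have pres: "presented_algebra (of_int :: int \<Rightarrow> 'o) ?g (wgens J L) (omega_rels G J L)"
    using omega_algebra by (simp add: omega_algebra_def)
  interpret O: algebra_map "of_int :: int \<Rightarrow> 'o" ?g
    using pres by (rule presented_algebra_map)
  have L: "L t = 1" using assms by (rule L_J)
  have fr: "free_E t \<in> free_alg (wgens J L)" "free_X t 0 \<in> free_alg (wgens J L)"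
    using assms L by (auto simp: free_E_def free_X_def wgens_def intro!: free_alg_gen)
  have ev: "free_eval of_int ?g (free_E t) = E t" "free_eval of_int ?g (free_X t 0) = X t 0"
    by (simp_all add: free_E_def free_X_def)
  have "free_E t * free_E t - free_E t \<in> omega_rels G J L"
    using assms unfolding omega_rels_def by blast
  then show "E t * E t = E t"
    using presented_algebra_rel[OF pres, of "free_E t * free_E t - free_E t"] fr ev
    by (simp add: free_alg_diff free_alg_mult O.free_eval_diff O.free_eval_mult)
  have L': "- L t < 0" "0 < L t" using L by auto
  have "free_E t * free_X t 0 - free_X t 0 \<in> omega_rels G J L"
    unfolding omega_rels_def by (rule UnI1, rule UnI1, rule UnI1, rule UnI2) (use assms L' in blast)
  then show "E t * X t 0 = X t 0"
    using presented_algebra_rel[OF pres, of "free_E t * free_X t 0 - free_X t 0"] fr ev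
    by (simp add: free_alg_diff free_alg_mult O.free_eval_diff O.free_eval_mult)
  have "free_X t 0 * free_E t \<in> omega_rels G J L"
    unfolding omega_rels_def by (rule UnI1, rule UnI1, rule UnI2) (use assms L' in blast)
  then show "X t 0 * E t = 0"
    using presented_algebra_rel[OF pres, of "free_X t 0 * free_E t"] fr ev
    by (simp add: free_alg_mult O.free_eval_mult)
qed

abbreviation oT :: "'w \<Rightarrow> 'o laurent" where "oT \<equiv> omega_T L E X"

lemma oT_eq: assumes "t \<in> J"
  shows "oT t = Poly_Mapping.single 1 (1 - E t) - Poly_Mapping.single (- 1) (E t) + Poly_Mapping.single 0 (X t 0)"
proof -
  have "{-1<..<1::int} = {0}" by auto
  then show ?thesis using L_J[OF assms] by (simp add: omega_T_def j_T_def)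
qed

lemma oC_eq: assumes "t \<in> J"
  shows "omega_C L E X t = oT t - vpow 1"
  using L_J[OF assms] by (simp add: omega_C_def)

lemma vpow_lcomm: "vpow k * a = a * (vpow k :: 'o laurent)"
proof (induction a rule: poly_mapping_add_induct)
  case (single j b)
  then show ?case by (simp add: mult_single add.commute)
qed (simp_all add: distrib_left distrib_right)

lemma vpow_star: "vpow k \<star> a \<star> u = a \<star> vpow k \<star> u"
  by (metis star_mult vpow_lcomm)

lemma vpow_vpow: "vpow k \<star> vpow j \<star> u = vpow (k + j) \<star> u"
  by (simp add: mult_single flip: star_mult)

lemma low_vpow: "low d u \<Longrightarrow> low (k + d) (vpow k \<star> u)"
  by (rule A.low_lact) (simp add: low_single)

text \<open>Multiplication by \<open>v + v^-1\<close> is injective: if k is the highest exponent of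
  u, the result has at k + 1 the coefficient of u at k.\<close>

lemma shift_sum_zero:
  fixes u :: "'m laurent"
  assumes "vpow 1 \<star> u + vpow (- 1) \<star> u = 0" shows "u = 0"
proof (rule ccontr)
  assume "u \<noteq> 0"
  then have K: "finite (Poly_Mapping.keys u)" "Poly_Mapping.keys u \<noteq> {}" by auto
  define k where "k = Max (Poly_Mapping.keys u)"
  have k: "Poly_Mapping.lookup u k \<noteq> 0" using Max_in[OF K] by (auto simp: k_def in_keys_iff)
  have "Poly_Mapping.lookup u (k + 2) = 0"
  proof (rule ccontr)
    assume "Poly_Mapping.lookup u (k + 2) \<noteq> 0"
    then have "k + 2 \<le> k" using Max_ge[OF K(1), of "k + 2"] by (simp add: k_def in_keys_iff)
    then show False by simp
  qed
  moreover have "Poly_Mapping.lookup (vpow 1 \<star> u + vpow (- 1) \<star> u) (k + 1) = 0" using assms by simp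
  ultimately show False using k by (simp add: lookup_add A.lookup_lact_single add.commute)
qed

text \<open>Let \<open>q = T_t + v^-1\<close>. The idempotent \<open>1 - e_t\<close>, called
  \<open>e\<close> in the proof, satisfies \<open>(1 - e_t) q = (v + v^-1)(1 - e_t)\<close> and
  \<open>q (1 - e_t) = q\<close>. Applied to the invariance of q g, the first identity makes
  \<open>w = (1 - e_t) g\<close> invariant; being positive, w is 0, and the second gives q g = q w =
  0.\<close>

lemma descent_zero:
  assumes t: "t \<in> J" and g: "pos g" and inv: "lbar ((oT t + vpow (- 1)) \<star> g) = (oT t + vpow (- 1)) \<star> g"
  shows "(oT t + vpow (- 1)) \<star> g = 0"
proof -
  define e :: "'o laurent" where "e = Poly_Mapping.single 0 (1 - E t)"
  define q where "q = oT t + vpow (- 1)"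
  define w where "w = e \<star> g"
  note rel = omega_relation[OF t]
  have idem: "(1 - E t) * (1 - E t) = 1 - E t" "(1 - E t) * X t 0 = 0" "X t 0 * (1 - E t) = X t 0"
    "(1 - E t) * E t = 0" "E t * (1 - E t) = 0"
    using rel by (simp_all add: left_diff_distrib right_diff_distrib)
  have q: "q = Poly_Mapping.single 1 (1 - E t) + Poly_Mapping.single (- 1) (1 - E t) + Poly_Mapping.single 0 (X t 0)"
    unfolding q_def oT_eq[OF t] by (simp add: single_diff)
  have eq: "e * q = (vpow 1 + vpow (- 1)) * e" and qe: "q * e = q"
    unfolding q e_def by (simp_all add: distrib_left distrib_right mult_single idem)
  have lw: "lbar (e \<star> u) = e \<star> lbar u" for u by (simp add: A.lbar_lact e_def)
  have w: "pos w" unfolding w_def using A.low_lact[OF _ g, of 0 e] by (simp add: e_def low_single)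
  have "e \<star> q \<star> g = vpow 1 \<star> w + vpow (- 1) \<star> w"
    using arg_cong[OF eq, of "\<lambda>a. a \<star> g"] by (simp add: star_mult w_def A.lact_add_left)
  moreover have "lbar (e \<star> q \<star> g) = e \<star> q \<star> g" using inv by (simp add: lw q_def)
  ultimately have "vpow (- 1) \<star> lbar w + vpow 1 \<star> lbar w = vpow 1 \<star> w + vpow (- 1) \<star> w"
    by (simp add: lbar_add A.lbar_lact)
  then have "vpow 1 \<star> (w - lbar w) + vpow (- 1) \<star> (w - lbar w) = 0"
    by (simp add: star_diff_right algebra_simps)
  then have "lbar w = w" using shift_sum_zero[of "w - lbar w"] by simp
  then have "w = 0" using pos_lbar_eq_zero[OF w] by simp
  moreover have "q \<star> g = q \<star> w" using star_mult[of q e g] qe by (simp add: w_def)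
  ultimately show ?thesis by (simp add: q_def)
qed

section \<open>The action of T_s on standard elements\<close>

lemma D_cases:
  assumes "s \<in> S" "y \<in> D"
  obtains (plus) "y \<in> DJ_plus G S J s" "y \<notin> DJ_zero G S J s" "y \<notin> DJ_minus G S J s" "l y < l (s \<otimes> y)"
      "s \<otimes> y \<in> D" "s \<otimes> y \<in> DJ_minus G S J s"
    | (zero) "y \<in> DJ_zero G S J s" "y \<notin> DJ_plus G S J s" "y \<notin> DJ_minus G S J s" "l y < l (s \<otimes> y)"
      "s \<otimes> y \<notin> D" "conj_by G s y \<in> J"
    | (minus) "y \<in> DJ_minus G S J s" "y \<notin> DJ_plus G S J s" "y \<notin> DJ_zero G S J s" "l (s \<otimes> y) < l y"
      "s \<otimes> y \<in> D" "s \<otimes> y \<in> DJ_plus G S J s"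
proof -
  have yc: "y \<in> carrier G" and sc': "s \<in> carrier G" using assms DG S_carrier by blast+
  have ss: "s \<otimes> (s \<otimes> y) = y" using assms yc by simp
  note iffs = DJ_plus_iff[OF assms(1)] DJ_zero_iff[OF assms(1)] DJ_minus_iff[OF assms(1)]
  consider "l (s \<otimes> y) < l y" | "l y < l (s \<otimes> y)" using len_S_mult_neq[OF yc assms(1)] by fastforce
  then show thesis
  proof cases
    case 1
    then have "s \<otimes> y \<in> D" using DJ_minus_mult[OF J_subset assms(2,1)] by blast
    then show thesis using minus 1 assms(2) ss by (simp add: iffs)
  next
    case 2
    show thesis
    proof (cases "s \<otimes> y \<in> D")
      case True
      then show thesis using plus 2 assms(2) ss by (simp add: iffs)
    next
      case False
      then have "conj_by G s y \<in> J" using DJ_zero_conj[OF J_subset assms(2,1)] by blast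
      then show thesis using zero 2 assms(2) False by (simp add: iffs)
    qed
  qed
qed

abbreviation xi :: "'o laurent" where "xi \<equiv> vpow 1 - vpow (- 1)"

lemma actI_T_single:
  assumes "s \<in> S" "y \<in> D"
  shows "y \<in> DJ_plus G S J s \<Longrightarrow> actI (T s) (tens (TT y) u) = tens (TT (s \<otimes> y)) u"
    "y \<in> DJ_zero G S J s \<Longrightarrow> actI (T s) (tens (TT y) u) = tens (TT y) (oT (conj_by G s y) \<star> u)"
    "y \<in> DJ_minus G S J s \<Longrightarrow> actI (T s) (tens (TT y) u) = tens (TT (s \<otimes> y)) u + tens (TT y) (xi \<star> u)"
proof -
  have yc: "y \<in> carrier G" using assms DG by blast
  show "actI (T s) (tens (TT y) u) = tens (TT (s \<otimes> y)) u" if "y \<in> DJ_plus G S J s"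
    using that T_mult_TT_up[OF assms(1) yc] by (simp add: DJ_plus_iff[OF assms(1)])
  show "actI (T s) (tens (TT y) u) = tens (TT y) (oT (conj_by G s y) \<star> u)" if y: "y \<in> DJ_zero G S J s"
  proof -
    let ?t = "conj_by G s y"
    have lt: "l y < l (s \<otimes> y)" and t: "?t \<in> J"
      using y DJ_zero_conj[OF J_subset assms(2,1)] by (auto simp: DJ_zero_iff[OF assms(1)])
    have tS: "?t \<in> S" and tc: "?t \<in> carrier G" and tg: "?t \<in> generate G J"
      using t J_subset S_carrier by (auto intro: generate.incl)
    \<comment> \<open>Lengths add on both sides, so \<open>T_s T_y = T_y T_t\<close>, and
      \<open>T_t\<close> passes through the tensor sign.\<close>
    have e: "s \<otimes> y = y \<otimes> ?t" using mult_conj_by[OF assms(1) yc] by simp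
    have "l (y \<otimes> ?t) = l y + l ?t" using len_mult_parabolic[OF J_subset assms(2) tg] .
    then have "T s * TT y = TT y * T ?t"
      using T_mult_TT_up[OF assms(1) yc lt] TT_mult[OF yc tc] TT_S[OF tS] e by simp
    then show ?thesis using tens_bal[OF TT_par[OF tg], of "TT y" u] hecke_embed_T[OF t, of E X] TT_S[OF tS] by simp
  qed
  show "actI (T s) (tens (TT y) u) = tens (TT (s \<otimes> y)) u + tens (TT y) (xi \<star> u)" if "y \<in> DJ_minus G S J s"
  proof -
    have "l (s \<otimes> y) < l y" using that by (simp add: DJ_minus_iff[OF assms(1)])
    then have "T s * TT y = TT (s \<otimes> y) + TT y * sc lxi"
      using T_mult_TT_down[OF assms(1) yc] sc_central by metis
    then show ?thesis
      using tens_bal[OF sc_par, of "TT y" lxi u] by (simp add: tens_add_left hecke_embed_sc map_of_int_lxi)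
  qed
qed

text \<open>The coefficient at \<open>T_y\<close> after applying \<open>T_s\<close>. Multiplication
  by s exchanges D^+ and D^-, so there g is taken at \<open>sy\<close>; a coset in D^0 is
  preserved.\<close>

definition hcoef :: "'w \<Rightarrow> ('w \<Rightarrow> 'm laurent) \<Rightarrow> 'w \<Rightarrow> 'm laurent" where
  "hcoef s g y = (if y \<in> DJ_zero G S J s then oT (conj_by G s y) \<star> g y
     else if y \<in> DJ_minus G S J s then g (s \<otimes> y) + xi \<star> g y else g (s \<otimes> y))"

lemma actI_T_sum:
  assumes s: "s \<in> S" and F: "finite F" "F \<subseteq> D" "\<And>y. y \<in> F \<Longrightarrow> s \<otimes> y \<in> D \<Longrightarrow> s \<otimes> y \<in> F"
  shows "actI (T s) (\<Sum>y\<in>F. tens (TT y) (g y)) = (\<Sum>y\<in>F. tens (TT y) (hcoef s g y))"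
proof -
  \<comment> \<open>On D^0, where \<open>sy\<close> leaves D_J, this is the identity and carries the
    coefficient 0; elsewhere it is the involution y \<mapsto> sy.\<close>
  define \<sigma> where "\<sigma> = (\<lambda>y. if s \<otimes> y \<in> D then s \<otimes> y else y)"
  define a where "a = (\<lambda>y. if s \<otimes> y \<in> D then g y else 0)"
  define \<beta> where "\<beta> = (\<lambda>y. if y \<in> DJ_zero G S J s then oT (conj_by G s y) \<star> g y
     else if y \<in> DJ_minus G S J s then xi \<star> g y else 0)"
  have ss: "s \<otimes> (s \<otimes> y) = y" if "y \<in> F" for y
    using that F(2) DG s by auto
  have 1: "actI (T s) (tens (TT y) (g y)) = tens (TT (\<sigma> y)) (a y) + tens (TT y) (\<beta> y)" if "y \<in> F" for y
  proof -
    have yD: "y \<in> D" using that F by blast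
    from s yD show ?thesis
      by (cases rule: D_cases) (simp_all only: actI_T_single[OF s yD] \<sigma>_def a_def \<beta>_def if_True if_False
        tens_zero add_0_left add_0_right)
  qed
  have "(\<Sum>y\<in>F. tens (TT (\<sigma> y)) (a y)) = (\<Sum>y\<in>F. tens (TT y) (if s \<otimes> y \<in> D then g (s \<otimes> y) else 0))"
  proof (rule sum.reindex_bij_witness[of _ \<sigma> \<sigma>])
    fix y assume y: "y \<in> F"
    then have yD: "y \<in> D" using F by blast
    show "\<sigma> (\<sigma> y) = y" "\<sigma> y \<in> F" using ss[OF y] F(3)[OF y] y yD by (auto simp: \<sigma>_def)
    then show "\<sigma> (\<sigma> y) = y" "\<sigma> y \<in> F" by blast+
    show "tens (TT (\<sigma> y)) (if s \<otimes> \<sigma> y \<in> D then g (s \<otimes> \<sigma> y) else 0) = tens (TT (\<sigma> y)) (a y)"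
      using ss[OF y] yD by (auto simp: \<sigma>_def a_def)
  qed
  then have "actI (T s) (\<Sum>y\<in>F. tens (TT y) (g y)) =
    (\<Sum>y\<in>F. tens (TT y) ((if s \<otimes> y \<in> D then g (s \<otimes> y) else 0) + \<beta> y))"
    unfolding actI_sum using 1 by (simp add: sum.distrib tens_add_right del: actI_tens cong: sum.cong)
  also have "\<dots> = (\<Sum>y\<in>F. tens (TT y) (hcoef s g y))"
  proof (rule sum.cong)
    fix y assume "y \<in> F"
    then have yD: "y \<in> D" using F by blast
    from s yD show "tens (TT y) ((if s \<otimes> y \<in> D then g (s \<otimes> y) else 0) + \<beta> y) = tens (TT y) (hcoef s g y)"
      by (cases rule: D_cases) (simp_all add: \<beta>_def hcoef_def)
  qed simp
  finally show ?thesis .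
qed

text \<open>Since \<open>\<iota>(T_s) = T_s - v + v^-1\<close>, the elements
  \<open>T_s + v^-1\<close> and \<open>T_s - v\<close> are fixed by \<iota>.\<close>

lemma iI_actI_T:
  assumes "s \<in> S" "\<iota>I x = x"
  shows "\<iota>I (actI (T s) x + scI (vpow (- 1)) x) = actI (T s) x + scI (vpow (- 1)) x"
    "\<iota>I (actI (T s) x - scI (vpow 1) x) = actI (T s) x - scI (vpow 1) x"
  using assms by (simp_all add: iI_add iI_diff iI_actI iI_scI bar_T actI_diff_left actI_lxi)

text \<open>A finite common support for \<open>c(x|m)\<close> with x \<le> z, for
  \<open>c(sz|m)\<close> when \<open>sz\<close> is in D_J, and for their images under
  \<open>T_s\<close>; this is why it is closed under multiplication by s within D_J.\<close>

definition Fs :: "'w \<Rightarrow> 'w \<Rightarrow> 'w set" where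
  "Fs s z = {y \<in> D. bruhat_le G S y z \<or> bruhat_le G S y (s \<otimes> z) \<or> bruhat_le G S (s \<otimes> y) z \<or> bruhat_le G S (s \<otimes> y) (s \<otimes> z)}"

lemma Fs:
  assumes "s \<in> S" "z \<in> D"
  shows "finite (Fs s z)" "Fs s z \<subseteq> D" "\<And>y. y \<in> Fs s z \<Longrightarrow> s \<otimes> y \<in> D \<Longrightarrow> s \<otimes> y \<in> Fs s z"
    "\<And>x. bruhat_le G S x z \<Longrightarrow> {y \<in> D. bruhat_le G S y x} \<subseteq> Fs s z"
    "{y \<in> D. bruhat_le G S y (s \<otimes> z)} \<subseteq> Fs s z"
proof -
  have c: "s \<in> carrier G" "z \<in> carrier G" using assms S_carrier DG by blast+
  let ?A = "{y. bruhat_le G S y z} \<union> {y. bruhat_le G S y (s \<otimes> z)}"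
  have "finite ?A" using finite_bruhat_lower c by simp
  moreover have "Fs s z \<subseteq> ?A \<union> (\<lambda>y. s \<otimes> y) ` ?A"
  proof
    fix y assume y: "y \<in> Fs s z"
    then have "y = s \<otimes> (s \<otimes> y)" using assms DG by (simp add: Fs_def)
    then show "y \<in> ?A \<union> (\<lambda>y. s \<otimes> y) ` ?A" using y by (auto simp: Fs_def)
  qed
  ultimately show "finite (Fs s z)" by (meson finite_Un finite_imageI finite_subset)
  show "Fs s z \<subseteq> D" by (auto simp: Fs_def)
  show "s \<otimes> y \<in> Fs s z" if "y \<in> Fs s z" "s \<otimes> y \<in> D" for y
    using that assms DG by (auto simp: Fs_def)
  show "{y \<in> D. bruhat_le G S y x} \<subseteq> Fs s z" if "bruhat_le G S x z" for x
    using that bruhat_trans by (auto simp: Fs_def)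
  show "{y \<in> D. bruhat_le G S y (s \<otimes> z)} \<subseteq> Fs s z" by (auto simp: Fs_def)
qed

abbreviation P :: "'w \<Rightarrow> 'w \<Rightarrow> 'm \<Rightarrow> 'm laurent" where
  "P y z m \<equiv> p y z \<star> Poly_Mapping.single 0 m"

lemma low_P: "y \<in> D \<Longrightarrow> z \<in> D \<Longrightarrow> low 0 (P y z m)"
  using A.low_lact[of 0 "p y z" 0 "Poly_Mapping.single 0 m"] p_props(1) by (simp add: low_single)

lemma pos_P: "y \<in> D \<Longrightarrow> z \<in> D \<Longrightarrow> y \<noteq> z \<Longrightarrow> pos (P y z m)"
  using A.low_lact[of 1 "p y z" 0 "Poly_Mapping.single 0 m"] p_props(4) by (simp add: low_single)

lemma P_self: "z \<in> D \<Longrightarrow> P z z m = Poly_Mapping.single 0 m"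
  using p_props(2) by simp

lemma oT_fixed:
  assumes "t \<in> J" "act (E t) m = m"
  shows "oT t \<star> Poly_Mapping.single 0 m = - (vpow (- 1) \<star> Poly_Mapping.single 0 m)"
proof -
  have "act (X t 0) m = act (X t 0 * E t) m" using assms by (simp add: act_mult)
  also have "\<dots> = 0" using omega_relation[OF assms(1)] by simp
  finally show ?thesis
    using assms by (simp add: oT_eq A.lact_add_left star_diff A.act_diff_left single_uminus)
qed

text \<open>The element \<open>a = (T\<^sub>s + v\<^sup>-\<^sup>1)c(z|m)\<close> is invariant under the involution. Its coefficients satisfy
  \<open>a\<^sub>s\<^sub>y = va\<^sub>y\<close> for \<open>y \<in> D\<^sup>+\<close>, involve only positive exponents for \<open>y \<in> D\<^sup>-\<close>, and are handled by
  \<open>descent_zero\<close> for \<open>y \<in> D\<^sup>0\<close>; so no coefficient can be the topmost one that does not vanish.\<close>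
lemma T_canon_descent:
  assumes s: "s \<in> S" and z: "z \<in> D"
    and desc: "z \<in> DJ_minus G S J s \<or> z \<in> DJ_zero G S J s \<and> act (E (conj_by G s z)) m = m"
  shows "actI (T s) (canon z m) + scI (vpow (- 1)) (canon z m) = 0"
    and "\<And>y. y \<in> DJ_zero G S J s \<Longrightarrow> (oT (conj_by G s y) + vpow (- 1)) \<star> P y z m = 0"
proof -
  let ?F = "Fs s z" and ?g = "\<lambda>y. P y z m"
  note F = Fs[OF s z]
  define a where "a = (\<lambda>y. hcoef s ?g y + vpow (- 1) \<star> ?g y)"
  have canon: "canon z m = (\<Sum>y\<in>?F. tens (TT y) (?g y))"
    using canon_superset[OF z F(1,2) F(4)[of z]] by simp
  have act: "actI (T s) (\<Sum>y\<in>?F. tens (TT y) (?g y)) = (\<Sum>y\<in>?F. tens (TT y) (hcoef s ?g y))"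
    by (rule actI_T_sum[OF s F(1,2)]) (rule F(3))
  have d: "actI (T s) (canon z m) + scI (vpow (- 1)) (canon z m) = (\<Sum>y\<in>?F. tens (TT y) (a y))"
    unfolding canon act I.scale_sum_right a_def
    by (simp add: scale_vpow tens_add_right sum.distrib)
  have sz: "z \<notin> DJ_plus G S J s" using desc DJ_plus_iff[OF s] DJ_minus_iff[OF s] DJ_zero_iff[OF s] by auto
  have inv: "\<iota>I (\<Sum>y\<in>?F. tens (TT y) (a y)) = (\<Sum>y\<in>?F. tens (TT y) (a y))"
    unfolding d[symmetric] by (rule iI_actI_T(1)[OF s canon_bar[OF z]])
  have a0: "a y = 0" if "y \<in> ?F" for y
  proof (rule bar_invariant_zero[OF F(1,2) inv _ that])
    fix y assume y: "y \<in> ?F" and top: "\<forall>y'\<in>?F. l y < l y' \<longrightarrow> a y' = 0" and bar: "lbar (a y) = a y"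
    have yD: "y \<in> D" using y F(2) by blast
    from s yD show "a y = 0"
    proof (cases rule: D_cases)
      case plus
      have sy: "s \<otimes> y \<in> ?F" using F(3)[OF y plus(5)] .
      have ss: "s \<otimes> (s \<otimes> y) = y" using s DG[OF yD] by simp
      have nz: "s \<otimes> y \<notin> DJ_zero G S J s" using plus(6) DJ_zero_iff[OF s] DJ_minus_iff[OF s] by auto
      \<comment> \<open>The \<open>v^-1\<close> of the quadratic relation cancels against the added
        one, so that \<open>a_sy = v a_y\<close>.\<close>
      have "a (s \<otimes> y) = ?g y + vpow 1 \<star> ?g (s \<otimes> y)"
        unfolding a_def hcoef_def using plus(6) nz ss by (simp add: star_diff)
      then have "a y = vpow (- 1) \<star> a (s \<otimes> y)"
        unfolding a_def hcoef_def using plus by (simp add: A.lact_add_right vpow_vpow)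
      moreover have "a (s \<otimes> y) = 0" using top sy plus(4) by blast
      ultimately show ?thesis by simp
    next
      case zero
      have ay: "a y = (oT (conj_by G s y) + vpow (- 1)) \<star> ?g y"
        unfolding a_def hcoef_def using zero by (simp add: A.lact_add_left)
      show ?thesis
      \<comment> \<open>At y = z the coefficient is m, which is not positive, so
        \<open>descent_zero\<close> is replaced by the hypothesis that e_t fixes m.\<close>
      proof (cases "y = z")
        case True
        then have "act (E (conj_by G s z)) m = m" using desc zero by auto
        then show ?thesis
          using ay True oT_fixed[of "conj_by G s z" m] zero(6) by (simp add: P_self[OF z] A.lact_add_left)
      next
        case False
        then show ?thesis using descent_zero[OF zero(6) pos_P[OF yD z]] ay bar by simp
      qed
    next
      case minus
      \<comment> \<open>As \<open>sy\<close> is in D^+ and z is not, the coefficient at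
        \<open>sy\<close> is positive.\<close>
      have "s \<otimes> y \<noteq> z" using sz minus(6) by auto
      then have "pos (?g (s \<otimes> y))" using pos_P[OF minus(5) z] by simp
      moreover have "pos (vpow 1 \<star> ?g y)" using low_vpow[OF low_P[OF yD z], of 1] by simp
      ultimately have "pos (a y)"
        unfolding a_def hcoef_def using minus by (simp add: star_diff low_add)
      then show ?thesis using bar by (rule pos_lbar_eq_zero)
    qed
  qed
  show "actI (T s) (canon z m) + scI (vpow (- 1)) (canon z m) = 0"
    unfolding d using a0 by simp
  fix y assume y: "y \<in> DJ_zero G S J s"
  then have yD: "y \<in> D" by (simp add: DJ_zero_iff[OF s])
  show "(oT (conj_by G s y) + vpow (- 1)) \<star> ?g y = 0"
  proof (cases "y \<in> ?F")
    case True
    then show ?thesis using a0[OF True] y by (simp add: a_def hcoef_def A.lact_add_left)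
  next
    case False
    then have "\<not> bruhat_le G S y z" using F(4)[of z] yD by auto
    then show ?thesis using p_props(3)[OF yD z] by simp
  qed
qed

section \<open>The family \<mu> and the expansion of T_s c(z|m)\<close>

lemma mu_props:
  assumes "s \<in> S" "x \<in> D" "z \<in> D"
  shows "\<not> (bruhat_less G S x z \<and> z \<in> DJ_plus G S J s \<union> DJ_zero G S J s
             \<and> x \<in> DJ_zero G S J s \<union> DJ_minus G S J s) \<Longrightarrow> \<mu> s x z = 0"
    "lbar (\<mu> s x z) = \<mu> s x z"
    "z \<in> DJ_plus G S J s \<union> DJ_zero G S J s \<Longrightarrow> x \<in> DJ_zero G S J s \<union> DJ_minus G S J s \<Longrightarrow>
      pos (\<mu> s x z + mu_R G S L J E X p s x z
             + (\<Sum>y\<in>{y \<in> D. bruhat_less G S x y \<and> bruhat_less G S y z}. p x y * \<mu> s y z))"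
proof -
  note * = bspec[OF bspec[OF bspec[OF mu_family[unfolded mu_family_def] assms(1)] assms(2)] assms(3)]
  show "\<mu> s x z = 0" if "\<not> (bruhat_less G S x z \<and> z \<in> DJ_plus G S J s \<union> DJ_zero G S J s
             \<and> x \<in> DJ_zero G S J s \<union> DJ_minus G S J s)"
    using *[THEN conjunct1] that by (rule mp)
  show "lbar (\<mu> s x z) = \<mu> s x z" using * by (elim conjE)
  show "pos (\<mu> s x z + mu_R G S L J E X p s x z
             + (\<Sum>y\<in>{y \<in> D. bruhat_less G S x y \<and> bruhat_less G S y z}. p x y * \<mu> s y z))"
    if "z \<in> DJ_plus G S J s \<union> DJ_zero G S J s" "x \<in> DJ_zero G S J s \<union> DJ_minus G S J s"
    unfolding pos_keys using *[THEN conjunct2, THEN conjunct2] that by blast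
qed

lemma low_oC: assumes "t \<in> J" shows "low (- 1) (omega_C L E X t)"
  unfolding oC_eq[OF assms] oT_eq[OF assms] by (intro low_add low_diff low_single) auto

text \<open>By downward induction on \<open>x\<close>: as \<open>L(s) = 1\<close>, multiplying \<open>p\<^sub>x\<^sub>,\<^sub>z\<close> by \<open>C\<^sub>t\<close> or \<open>v\<^sup>-\<^sup>1\<close> leaves no negative exponents,
  so \<open>\<mu>\<close> has none, and it is invariant under the bar map.\<close>
lemma mu_const:
  assumes "s \<in> S" "x \<in> D" "z \<in> D"
  shows "\<mu> s x z = Poly_Mapping.single 0 (Poly_Mapping.lookup (\<mu> s x z) 0)"
proof -
  have low: "low 0 (\<mu> s x z)"
    using assms(2)
  proof (induction "l z - l x" arbitrary: x rule: less_induct)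
    case less
    show ?case
    proof (cases "bruhat_less G S x z \<and> z \<in> DJ_plus G S J s \<union> DJ_zero G S J s \<and> x \<in> DJ_zero G S J s \<union> DJ_minus G S J s")
      case False
      then show ?thesis using mu_props(1)[OF assms(1) less.prems assms(3)] by simp
    next
      case True
      let ?R = "mu_R G S L J E X p s x z"
        and ?S = "\<Sum>y\<in>{y \<in> D. bruhat_less G S x y \<and> bruhat_less G S y z}. p x y * \<mu> s y z"
      have pxz: "pos (p x z)" using p_props(4)[OF less.prems assms(3)] True by (auto simp: bruhat_less_def)
      have "low 0 ?S"
      proof (rule low_sum)
        fix y assume y: "y \<in> {y \<in> D. bruhat_less G S x y \<and> bruhat_less G S y z}"
        have "l z - l y < l z - l x" using y bruhat_less_len[of x y] bruhat_less_len[of y z] by auto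
        then have "low 0 (\<mu> s y z)" using less.hyps y by blast
        then show "low 0 (p x y * \<mu> s y z)"
          using low_mult[of 0 "p x y" 0 "\<mu> s y z"] p_props(1)[of x y] less.prems y by simp
      qed
      moreover have "low 0 ?R"
      proof -
        have a: "low 0 (vpow (- L s) * p x z)"
          using low_mult[of "- 1" "vpow (- L s)" 1 "p x z"] pxz L_one assms(1) by (simp add: low_single)
        have b: "low 0 (omega_C L E X (conj_by G s x) * p x z)" if "x \<in> DJ_zero G S J s"
        proof -
          have "conj_by G s x \<in> J" using that DJ_zero_conj[OF J_subset less.prems assms(1)] by (simp add: DJ_zero_iff[OF assms(1)])
          then show ?thesis using low_mult[OF low_oC pxz] by simp
        qed
        have c: "low 0 (p x z * omega_C L E X (conj_by G s z))" if "z \<in> DJ_zero G S J s"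
        proof -
          have "conj_by G s z \<in> J" using that DJ_zero_conj[OF J_subset assms(3,1)] by (simp add: DJ_zero_iff[OF assms(1)])
          then show ?thesis using low_mult[OF pxz low_oC] by simp
        qed
        show ?thesis
          unfolding mu_R_def using True a b c by (auto intro: low_minus low_diff low_add)
      qed
      moreover have "low 0 (\<mu> s x z + ?R + ?S)"
        using mu_props(3)[OF assms(1) less.prems assms(3)] True low_mono[of 1 _ 0] by simp
      ultimately have "low 0 (\<mu> s x z + ?R + ?S - ?S - ?R)" by (intro low_diff)
      then show ?thesis by simp
    qed
  qed
  show ?thesis
  proof (rule poly_mapping_eqI)
    fix k
    have sym: "Poly_Mapping.lookup (\<mu> s x z) k = Poly_Mapping.lookup (\<mu> s x z) (- k)"
      using lookup_lbar[of "\<mu> s x z" k] mu_props(2)[OF assms] by simp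
    show "Poly_Mapping.lookup (\<mu> s x z) k = Poly_Mapping.lookup (Poly_Mapping.single 0 (Poly_Mapping.lookup (\<mu> s x z) 0)) k"
    proof (cases "k = 0")
      case False
      then have "k < 0 \<or> - k < 0" by auto
      then have "Poly_Mapping.lookup (\<mu> s x z) k = 0" using low sym unfolding low_def by auto
      then show ?thesis using False by (simp add: lookup_single)
    qed simp
  qed
qed

abbreviation mu0 :: "'w \<Rightarrow> 'w \<Rightarrow> 'w \<Rightarrow> 'm \<Rightarrow> 'm" where
  "mu0 s x z m \<equiv> act (Poly_Mapping.lookup (\<mu> s x z) 0) m"

lemma mu_star:
  assumes "s \<in> S" "x \<in> D" "z \<in> D"
  shows "\<mu> s x z \<star> Poly_Mapping.single 0 m = Poly_Mapping.single 0 (mu0 s x z m)"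
  by (subst mu_const[OF assms]) simp

lemma low_mu: "s \<in> S \<Longrightarrow> x \<in> D \<Longrightarrow> z \<in> D \<Longrightarrow> low 0 (\<mu> s x z)"
  by (subst mu_const) (auto intro: low_single)

lemma finite_less_D: "z \<in> D \<Longrightarrow> finite {x \<in> D. bruhat_less G S x z}"
  by (rule finite_subset[OF _ finite_bruhat_lower[of z]]) (auto simp: bruhat_less_def DG)

text \<open>Brings the coefficient at \<open>T_y\<close> of the sum of all
  \<open>c(x|\<mu>_x,z m)\<close> into the shape of the condition that determines \<mu>; the term x
  = y supplies \<mu>_y,z because \<open>p_y,y = 1\<close>.\<close>

lemma p_mu_sum:
  assumes "s \<in> S" "y \<in> D" "z \<in> D"
  shows "(\<Sum>x\<in>{x \<in> D. bruhat_less G S x z}. p y x * \<mu> s x z) =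
    \<mu> s y z + (\<Sum>x\<in>{x \<in> D. bruhat_less G S y x \<and> bruhat_less G S x z}. p y x * \<mu> s x z)"
proof -
  let ?A = "{x \<in> D. bruhat_less G S x z}" and ?B = "{x \<in> D. bruhat_less G S y x \<and> bruhat_less G S x z}"
  have fin: "finite ?A" using finite_less_D[OF assms(3)] .
  have yB: "y \<notin> ?B" by (simp add: bruhat_less_def)
  have finB: "finite ?B" using fin by (rule rev_finite_subset) auto
  have "(\<Sum>x\<in>?A. p y x * \<mu> s x z) = (\<Sum>x\<in>insert y ?B. p y x * \<mu> s x z)"
  proof (rule sum.mono_neutral_cong)
    show "p y x * \<mu> s x z = 0" if "x \<in> insert y ?B - ?A" for x
      using that assms mu_props(1)[OF assms] by auto
    show "p y x * \<mu> s x z = 0" if "x \<in> ?A - insert y ?B" for x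
      using that p_props(3)[OF assms(2), of x] by (auto simp: bruhat_less_def)
  qed (use fin finB in auto)
  then show ?thesis using finB yB p_props(2)[OF assms(2,2)] by simp
qed

text \<open>Here \<open>\<epsilon>\<close> is the family of coefficients of \<open>c(sz|m)\<close> if \<open>z \<in> D\<^sup>+\<close>, and of \<open>c(z|x\<^sub>tm)\<close> with \<open>t = s\<^sup>z\<close> if \<open>z \<in> D\<^sup>0\<close>.
  The characterisation of \<open>\<mu>\<close> says that the difference of the two sides involves only positive exponents.\<close>
lemma T_canon_ascent:
  assumes s: "s \<in> S" and z: "z \<in> DJ_plus G S J s \<union> DJ_zero G S J s"
    and e: "\<iota>I (\<Sum>y\<in>Fs s z. tens (TT y) (\<epsilon> y)) = (\<Sum>y\<in>Fs s z. tens (TT y) (\<epsilon> y))"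
    and e_plus: "\<And>y. y \<in> Fs s z \<Longrightarrow> y \<in> DJ_plus G S J s \<Longrightarrow> pos (\<epsilon> y)"
    and e_rest: "\<And>y. y \<in> Fs s z \<Longrightarrow> y \<in> DJ_zero G S J s \<union> DJ_minus G S J s \<Longrightarrow>
      pos (hcoef s (\<lambda>y. P y z m) y - vpow 1 \<star> P y z m - \<epsilon> y + mu_R G S L J E X p s y z \<star> Poly_Mapping.single 0 m)"
  shows "actI (T s) (canon z m) = scI (vpow 1) (canon z m) + (\<Sum>y\<in>Fs s z. tens (TT y) (\<epsilon> y))
    + (\<Sum>x\<in>{x \<in> D. bruhat_less G S x z}. canon x (mu0 s x z m))"
proof -
  have zD: "z \<in> D" using z by (auto simp: DJ_plus_iff[OF s] DJ_zero_iff[OF s])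
  let ?F = "Fs s z" and ?g = "\<lambda>y. P y z m" and ?A = "{x \<in> D. bruhat_less G S x z}" and ?m = "Poly_Mapping.single 0 m"
  note F = Fs[OF s zD]
  define M where "M = (\<lambda>y. (\<Sum>x\<in>?A. p y x * \<mu> s x z) \<star> ?m)"
  define a where "a = (\<lambda>y. hcoef s ?g y - vpow 1 \<star> ?g y - \<epsilon> y - M y)"
  have canon: "canon z m = (\<Sum>y\<in>?F. tens (TT y) (?g y))"
    using canon_superset[OF zD F(1,2) F(4)[of z]] by simp
  have act: "actI (T s) (\<Sum>y\<in>?F. tens (TT y) (?g y)) = (\<Sum>y\<in>?F. tens (TT y) (hcoef s ?g y))"
    by (rule actI_T_sum[OF s F(1,2)]) (rule F(3))
  have "canon x (mu0 s x z m) = (\<Sum>y\<in>?F. tens (TT y) ((p y x * \<mu> s x z) \<star> ?m))" if x: "x \<in> ?A" for x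
  proof -
    have "x \<in> D" "bruhat_le G S x z" using x by (auto simp: bruhat_less_def)
    then show ?thesis
      using canon_superset[OF _ F(1,2) F(4)[of x]] mu_star[OF s _ zD, of x m] by (simp add: star_mult)
  qed
  then have "(\<Sum>x\<in>?A. canon x (mu0 s x z m)) = (\<Sum>x\<in>?A. \<Sum>y\<in>?F. tens (TT y) ((p y x * \<mu> s x z) \<star> ?m))"
    by (rule sum.cong[OF HOL.refl])
  also have "\<dots> = (\<Sum>y\<in>?F. tens (TT y) (M y))"
    unfolding M_def star_sum tens_sum_right by (rule sum.swap)
  finally have mu: "(\<Sum>x\<in>?A. canon x (mu0 s x z m)) = (\<Sum>y\<in>?F. tens (TT y) (M y))" .
  have d: "(\<Sum>y\<in>?F. tens (TT y) (a y)) = (actI (T s) (canon z m) - scI (vpow 1) (canon z m))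
      - (\<Sum>y\<in>?F. tens (TT y) (\<epsilon> y)) - (\<Sum>x\<in>?A. canon x (mu0 s x z m))"
    unfolding mu canon act I.scale_sum_right a_def
    by (simp add: scale_vpow tens_diff_right sum_subtractf)
  have "(\<Sum>y\<in>?F. tens (TT y) (a y)) = 0"
  proof (rule bar_invariant_pos_zero[OF F(1,2)])
    show "\<iota>I (\<Sum>y\<in>?F. tens (TT y) (a y)) = (\<Sum>y\<in>?F. tens (TT y) (a y))"
    proof -
      have "\<iota>I (\<Sum>x\<in>?A. canon x (mu0 s x z m)) = (\<Sum>x\<in>?A. canon x (mu0 s x z m))"
        unfolding iI_sum by (rule sum.cong) (auto simp: canon_bar)
      then show ?thesis
        unfolding d iI_diff iI_actI_T(2)[OF s canon_bar[OF zD], unfolded iI_diff] e by simp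
    qed
    fix y assume y: "y \<in> ?F"
    then have yD: "y \<in> D" using F(2) by blast
    show "pos (a y)"
    proof (cases "y \<in> DJ_zero G S J s \<union> DJ_minus G S J s")
      case True
      let ?R = "mu_R G S L J E X p s y z"
      have "pos (?R + (\<Sum>x\<in>?A. p y x * \<mu> s x z))"
        using mu_props(3)[OF s yD zD z True] p_mu_sum[OF s yD zD] by (simp add: algebra_simps)
      then have "pos (?R \<star> ?m + M y)"
        using A.low_lact[of 1 "?R + (\<Sum>x\<in>?A. p y x * \<mu> s x z)" 0 ?m] by (simp add: low_single A.lact_add_left M_def)
      from low_diff[OF e_rest[OF y True] this] show ?thesis by (simp add: a_def algebra_simps)
    next
      case False
      \<comment> \<open>On D^+ the condition on \<mu> is silent; there \<open>\<mu>_y,z = 0\<close>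
        and every term is positive by itself.\<close>
      with s yD have plus: "y \<in> DJ_plus G S J s" "y \<notin> DJ_zero G S J s" "y \<notin> DJ_minus G S J s"
        "s \<otimes> y \<in> D" "s \<otimes> y \<in> DJ_minus G S J s" by (cases rule: D_cases, auto)+
      have "s \<otimes> y \<noteq> z" using plus(5) z by (auto simp: DJ_plus_iff[OF s] DJ_zero_iff[OF s] DJ_minus_iff[OF s])
      then have 1: "pos (?g (s \<otimes> y))" using pos_P[OF plus(4) zD] by simp
      have 2: "pos (vpow 1 \<star> ?g y)" using low_vpow[OF low_P[OF yD zD], of 1] by simp
      have "pos (\<Sum>x\<in>?A. p y x * \<mu> s x z)"
      proof (rule low_sum)
        fix x assume x: "x \<in> ?A"
        show "pos (p y x * \<mu> s x z)"
        proof (cases "x = y")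
          case True
          then show ?thesis using mu_props(1)[OF s yD zD] plus by simp
        next
          case False
          then have "pos (p y x)" using p_props(4)[OF yD] x by auto
          then show ?thesis using low_mult[OF _ low_mu[OF s _ zD, of x], of 1 "p y x"] x by simp
        qed
      qed
      then have 3: "pos (M y)"
        unfolding M_def using A.low_lact[of 1 _ 0 ?m] by (simp add: low_single)
      show ?thesis
        unfolding a_def hcoef_def using plus 1 2 3 e_plus[OF y plus(1)] by (simp add: low_diff)
    qed
  qed
  then show ?thesis unfolding d by (simp add: algebra_simps)
qed

lemma L_S: "s \<in> S \<Longrightarrow> L s = 1"
  using L_one by blast

text \<open>Here \<open>C_t\<close> is expanded as \<open>T_t - v\<close>, so that the terms can be
  matched with those of \<open>hcoef\<close>.\<close>

lemma mu_R_star: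
  assumes "s \<in> S" "x \<in> D" "z \<in> D"
  shows "z \<in> DJ_plus G S J s \<Longrightarrow> x \<in> DJ_zero G S J s \<Longrightarrow>
      mu_R G S L J E X p s x z \<star> u = vpow 1 \<star> p x z \<star> u - oT (conj_by G s x) \<star> p x z \<star> u"
    "z \<in> DJ_plus G S J s \<Longrightarrow> x \<in> DJ_minus G S J s \<Longrightarrow>
      mu_R G S L J E X p s x z \<star> u = vpow (- 1) \<star> p x z \<star> u"
    "z \<in> DJ_zero G S J s \<Longrightarrow> x \<in> DJ_zero G S J s \<Longrightarrow>
      mu_R G S L J E X p s x z \<star> u = p x z \<star> (oT (conj_by G s z) \<star> u - vpow 1 \<star> u)
        + vpow 1 \<star> p x z \<star> u - oT (conj_by G s x) \<star> p x z \<star> u"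
    "z \<in> DJ_zero G S J s \<Longrightarrow> x \<in> DJ_minus G S J s \<Longrightarrow>
      mu_R G S L J E X p s x z \<star> u = p x z \<star> (oT (conj_by G s z) \<star> u - vpow 1 \<star> u) + vpow (- 1) \<star> p x z \<star> u"
proof -
  have C: "omega_C L E X (conj_by G s y) = oT (conj_by G s y) - vpow 1" if "y \<in> DJ_zero G S J s" "y \<in> D" for y
    using that DJ_zero_conj[OF J_subset that(2) assms(1)] by (intro oC_eq) (simp add: DJ_zero_iff[OF assms(1)])
  have disj: "y \<in> DJ_zero G S J s \<Longrightarrow> y \<notin> DJ_plus G S J s" "y \<in> DJ_minus G S J s \<Longrightarrow> y \<notin> DJ_zero G S J s" for y
    using DJ_plus_iff[OF assms(1)] DJ_zero_iff[OF assms(1)] DJ_minus_iff[OF assms(1)] by auto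
  show "z \<in> DJ_plus G S J s \<Longrightarrow> x \<in> DJ_zero G S J s \<Longrightarrow>
      mu_R G S L J E X p s x z \<star> u = vpow 1 \<star> p x z \<star> u - oT (conj_by G s x) \<star> p x z \<star> u"
    "z \<in> DJ_plus G S J s \<Longrightarrow> x \<in> DJ_minus G S J s \<Longrightarrow>
      mu_R G S L J E X p s x z \<star> u = vpow (- 1) \<star> p x z \<star> u"
    "z \<in> DJ_zero G S J s \<Longrightarrow> x \<in> DJ_zero G S J s \<Longrightarrow>
      mu_R G S L J E X p s x z \<star> u = p x z \<star> (oT (conj_by G s z) \<star> u - vpow 1 \<star> u)
        + vpow 1 \<star> p x z \<star> u - oT (conj_by G s x) \<star> p x z \<star> u"
    "z \<in> DJ_zero G S J s \<Longrightarrow> x \<in> DJ_minus G S J s \<Longrightarrow>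
      mu_R G S L J E X p s x z \<star> u = p x z \<star> (oT (conj_by G s z) \<star> u - vpow 1 \<star> u) + vpow (- 1) \<star> p x z \<star> u"
    using disj[of z] disj[of x] C[of z] C[of x] assms(2,3) L_S[OF assms(1)]
    by (simp_all add: mu_R_def star_mult star_diff star_minus A.lact_add_left)
qed

text \<open>Downward induction on x removes the sum. Since \<open>T_t m = -v^-1 m\<close> for
  \<open>t = s^z\<close>, the term R m is 0 for x in D^0, by the second part of
  \<open>T_canon_descent\<close>, and \<open>-v p_x,z m\<close> for x in D^-. So \<mu>_x,z m is
  positive; being constant, it is 0.\<close>

lemma mu0_vanish:
  assumes s: "s \<in> S" and z: "z \<in> DJ_zero G S J s" and m: "act (E (conj_by G s z)) m = m" and x: "x \<in> D"
  shows "mu0 s x z m = 0"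
  using x
proof (induction "l z - l x" arbitrary: x rule: less_induct)
  case less
  have zD: "z \<in> D" using z by (simp add: DJ_zero_iff[OF s])
  have t: "conj_by G s z \<in> J" using z DJ_zero_conj[OF J_subset zD s] by (simp add: DJ_zero_iff[OF s])
  let ?m = "Poly_Mapping.single 0 m" and ?R = "mu_R G S L J E X p s x z"
    and ?S = "\<Sum>y\<in>{y \<in> D. bruhat_less G S x y \<and> bruhat_less G S y z}. p x y * \<mu> s y z"
  show ?case
  proof (cases "bruhat_less G S x z \<and> z \<in> DJ_plus G S J s \<union> DJ_zero G S J s \<and> x \<in> DJ_zero G S J s \<union> DJ_minus G S J s")
    case False
    then show ?thesis using mu_props(1)[OF s less.prems zD] by simp
  next
    case True
    have "(p x y * \<mu> s y z) \<star> ?m = 0" if y: "y \<in> {y \<in> D. bruhat_less G S x y \<and> bruhat_less G S y z}" for y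
    proof -
      have "l z - l y < l z - l x" using y bruhat_less_len[of x y] bruhat_less_len[of y z] by auto
      then have "mu0 s y z m = 0" using less.hyps y by blast
      then show ?thesis using mu_star[OF s _ zD, of y m] y by (simp add: star_mult)
    qed
    then have S: "?S \<star> ?m = 0" unfolding star_sum by (rule sum.neutral[rule_format])
    have oTm: "oT (conj_by G s z) \<star> ?m - vpow 1 \<star> ?m = - (vpow (- 1) \<star> ?m) - vpow 1 \<star> ?m"
      using oT_fixed[OF t m] by simp
    have R: "pos (?R \<star> ?m)"
    proof (cases "x \<in> DJ_zero G S J s")
      case x0: True
      have "(oT (conj_by G s x) + vpow (- 1)) \<star> P x z m = 0"
        using T_canon_descent(2)[OF s zD _ x0] z m by blast
      then have oTP: "oT (conj_by G s x) \<star> P x z m = - (vpow (- 1) \<star> P x z m)"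
        by (simp add: A.lact_add_left eq_neg_iff_add_eq_0)
      have "?R \<star> ?m = 0"
        unfolding mu_R_star(3)[OF s less.prems zD z x0] oTm
        by (simp only: star_diff_right star_minus_right vpow_star[symmetric] oTP) simp
      then show ?thesis by simp
    next
      case False
      then have xm: "x \<in> DJ_minus G S J s" using True by blast
      have "?R \<star> ?m = - (vpow 1 \<star> P x z m)"
        unfolding mu_R_star(4)[OF s less.prems zD z xm] oTm
        by (simp only: star_diff_right star_minus_right vpow_star[symmetric]) (simp add: algebra_simps)
      moreover have "pos (vpow 1 \<star> P x z m)" using low_vpow[OF low_P[OF less.prems zD], of 1] by simp
      ultimately show ?thesis by (simp add: low_minus)
    qed
    have "pos ((\<mu> s x z + ?R + ?S) \<star> ?m)"
      using A.low_lact[OF mu_props(3)[OF s less.prems zD], of 0 ?m] True by (simp add: low_single)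
    then have "pos (\<mu> s x z \<star> ?m + ?R \<star> ?m)" using S by (simp add: A.lact_add_left)
    from low_diff[OF this R] have "pos (Poly_Mapping.single 0 (mu0 s x z m))"
      using mu_star[OF s less.prems zD, of m] by simp
    then have "\<forall>k<1. Poly_Mapping.lookup (Poly_Mapping.single 0 (mu0 s x z m)) (k :: int) = 0" unfolding low_def .
    from spec[OF this, of 0] show ?thesis by simp
  qed
qed

lemma T_canon_plus:
  assumes s: "s \<in> S" and z: "z \<in> DJ_plus G S J s"
  shows "actI (T s) (canon z m) = scI (vpow 1) (canon z m) + canon (s \<otimes> z) m
    + (\<Sum>x\<in>{x \<in> D. bruhat_less G S x z}. canon x (mu0 s x z m))"
proof -
  have zD: "z \<in> D" and szD: "s \<otimes> z \<in> D" using z by (simp_all add: DJ_plus_iff[OF s])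
  note F = Fs[OF s zD]
  have ss: "s \<otimes> (s \<otimes> z) = z" using s DG[OF zD] by simp
  have szm: "s \<otimes> z \<in> DJ_minus G S J s"
    using s zD z by (cases rule: D_cases) auto
  have e: "canon (s \<otimes> z) m = (\<Sum>y\<in>Fs s z. tens (TT y) (P y (s \<otimes> z) m))"
    by (rule canon_superset[OF szD F(1,2,5)])
  have "actI (T s) (canon z m) = scI (vpow 1) (canon z m) + (\<Sum>y\<in>Fs s z. tens (TT y) (P y (s \<otimes> z) m))
    + (\<Sum>x\<in>{x \<in> D. bruhat_less G S x z}. canon x (mu0 s x z m))"
  proof (rule T_canon_ascent[OF s])
    show "z \<in> DJ_plus G S J s \<union> DJ_zero G S J s" using z by blast
    show "\<iota>I (\<Sum>y\<in>Fs s z. tens (TT y) (P y (s \<otimes> z) m)) = (\<Sum>y\<in>Fs s z. tens (TT y) (P y (s \<otimes> z) m))"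
      unfolding e[symmetric] by (rule canon_bar[OF szD])
    fix y assume y: "y \<in> Fs s z"
    then have yD: "y \<in> D" using F(2) by blast
    show "pos (P y (s \<otimes> z) m)" if "y \<in> DJ_plus G S J s"
    proof (rule pos_P[OF yD szD])
      show "y \<noteq> s \<otimes> z" using szm that DG[OF zD] s by (auto simp: DJ_plus_iff[OF s] DJ_minus_iff[OF s])
    qed
    assume yc: "y \<in> DJ_zero G S J s \<union> DJ_minus G S J s"
    from s yD show "pos (hcoef s (\<lambda>y. P y z m) y - vpow 1 \<star> P y z m - P y (s \<otimes> z) m
      + mu_R G S L J E X p s y z \<star> Poly_Mapping.single 0 m)"
    proof (cases rule: D_cases)
      case plus
      then show ?thesis using yc by blast
    next
      case zero
      then have "y \<noteq> s \<otimes> z" using szm by auto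
      then have "pos (P y (s \<otimes> z) m)" using pos_P[OF yD szD] by blast
      then show ?thesis
        unfolding mu_R_star(1)[OF s yD zD z zero(1)] hcoef_def using zero low_minus by fastforce
    next
      case minus
      have "pos (P (s \<otimes> y) z m - P y (s \<otimes> z) m)"
      \<comment> \<open>At \<open>y = sz\<close> both terms equal m and cancel; elsewhere each is
        positive.\<close>
      proof (cases "y = s \<otimes> z")
        case True
        then show ?thesis using ss P_self[OF zD] P_self[OF szD] by simp
      next
        case False
        then have "s \<otimes> y \<noteq> z" using s DG[OF yD] by auto
        then show ?thesis using False pos_P[OF minus(5) zD] pos_P[OF yD szD] low_diff by blast
      qed
      then show ?thesis
        unfolding mu_R_star(2)[OF s yD zD z minus(1)] hcoef_def using minus by (simp add: star_diff)
    qed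
  qed
  then show ?thesis unfolding e .
qed

text \<open>If e_t m = 0 then \<open>C_t m = x_t m\<close>, which lies in M as L(t) = 1, so the
  extra term is again of the form \<open>c(z|n)\<close>. For y in D^0 the terms to be compared
  cancel completely.\<close>

lemma T_canon_zero:
  assumes s: "s \<in> S" and z: "z \<in> DJ_zero G S J s" and m: "act (E (conj_by G s z)) m = 0"
  shows "actI (T s) (canon z m) = scI (vpow 1) (canon z m) + canon z (act (X (conj_by G s z) 0) m)
    + (\<Sum>x\<in>{x \<in> D. bruhat_less G S x z}. canon x (mu0 s x z m))"
proof -
  have zD: "z \<in> D" using z by (simp add: DJ_zero_iff[OF s])
  let ?t = "conj_by G s z"
  let ?n = "act (X ?t 0) m"
  have t: "?t \<in> J" using z DJ_zero_conj[OF J_subset zD s] by (simp add: DJ_zero_iff[OF s])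
  note F = Fs[OF s zD]
  have oTm: "oT ?t \<star> Poly_Mapping.single 0 m - vpow 1 \<star> Poly_Mapping.single 0 m = Poly_Mapping.single 0 ?n"
    using m by (simp add: oT_eq[OF t] A.lact_add_left star_diff A.act_diff_left)
  have e: "canon z ?n = (\<Sum>y\<in>Fs s z. tens (TT y) (P y z ?n))"
    using canon_superset[OF zD F(1,2) F(4)[of z]] by simp
  have "actI (T s) (canon z m) = scI (vpow 1) (canon z m) + (\<Sum>y\<in>Fs s z. tens (TT y) (P y z ?n))
    + (\<Sum>x\<in>{x \<in> D. bruhat_less G S x z}. canon x (mu0 s x z m))"
  proof (rule T_canon_ascent[OF s])
    show "z \<in> DJ_plus G S J s \<union> DJ_zero G S J s" using z by blast
    show "\<iota>I (\<Sum>y\<in>Fs s z. tens (TT y) (P y z ?n)) = (\<Sum>y\<in>Fs s z. tens (TT y) (P y z ?n))"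
      unfolding e[symmetric] by (rule canon_bar[OF zD])
    fix y assume y: "y \<in> Fs s z"
    then have yD: "y \<in> D" using F(2) by blast
    show "pos (P y z ?n)" if "y \<in> DJ_plus G S J s"
      using pos_P[OF yD zD] z that by (auto simp: DJ_plus_iff[OF s] DJ_zero_iff[OF s])
    assume yc: "y \<in> DJ_zero G S J s \<union> DJ_minus G S J s"
    from s yD show "pos (hcoef s (\<lambda>y. P y z m) y - vpow 1 \<star> P y z m - P y z ?n
      + mu_R G S L J E X p s y z \<star> Poly_Mapping.single 0 m)"
    proof (cases rule: D_cases)
      case plus
      then show ?thesis using yc by blast
    next
      case zero
      then show ?thesis
        unfolding mu_R_star(3)[OF s yD zD z zero(1)] oTm hcoef_def using zero by simp
    next
      case minus
      have "s \<otimes> y \<noteq> z" using minus(5,6) z by (auto simp: DJ_plus_iff[OF s] DJ_zero_iff[OF s])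
      then have "pos (P (s \<otimes> y) z m)" using pos_P[OF minus(5) zD] by blast
      then show ?thesis
        unfolding mu_R_star(4)[OF s yD zD z minus(1)] oTm hcoef_def using minus by (simp add: star_diff)
    qed
  qed
  then show ?thesis unfolding e .
qed

section \<open>The matrix of T_s with respect to the basis C\<close>

lemma canon_add: "canon z (m + n) = canon z m + canon z n"
  by (simp add: canon_def single_add A.lact_add_right tens_add_right sum.distrib)

lemma canon_zero [simp]: "canon z 0 = 0"
  by (simp add: canon_def)

lemma canon_scale: "canon z (sM k m) = scI (Poly_Mapping.single 0 k) (canon z m)"
proof -
  have "a \<star> Poly_Mapping.single 0 (sM k m) = lact sM (Poly_Mapping.single 0 k) (a \<star> Poly_Mapping.single 0 m)" for a
    using star_scale[of a "Poly_Mapping.single 0 k" "Poly_Mapping.single 0 m"] by simp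
  then show ?thesis by (simp add: canon_def I.scale_sum_right)
qed

lemma coordC_canon:
  assumes "x \<in> D" "b \<in> B" "y \<in> D"
  shows "coordC x b (canon y m) = (if x = y then Poly_Mapping.single 0 (M.representation B m b) else 0)"
proof -
  have "m \<in> M.span B" by (simp add: span_B)
  then show ?thesis
  proof (induction rule: M.span_induct_alt)
    case (step c b' n)
    have rep: "M.representation B (sM c b') b = c * (if b' = b then 1 else 0)"
      using step by (simp add: M.representation_scale[OF independent_B] M.representation_basis[OF independent_B] span_B)
    have "coordC x b (canon y b') = (if x = y \<and> b = b' then 1 else 0)"
      using canon_eq_C[OF assms(3)] coordC_C[OF assms] step by simp
    then show ?case using step rep
      by (auto simp: canon_add canon_scale coordC_add coordC_scale repB_add single_add)
  qed simp
qed

abbreviation hx :: "'w \<Rightarrow> ('w \<Rightarrow>\<^sub>0 'm) \<Rightarrow> ('w \<Rightarrow>\<^sub>0 'm)" where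
  "hx s \<equiv> hy_x G S J X \<mu> act s 0"

definition canonH :: "('w \<Rightarrow>\<^sub>0 'm) \<Rightarrow> 'i" where
  "canonH f = (\<Sum>z\<in>Poly_Mapping.keys f. canon z (Poly_Mapping.lookup f z))"

lemma canonH_add: "canonH (f + g) = canonH f + canonH g"
  unfolding canonH_def by (rule setsum_keys_plus_distrib) (simp_all add: canon_add)

lemma canonH_zero [simp]: "canonH 0 = 0"
  by (simp add: canonH_def)

lemma canonH_single [simp]: "canonH (Poly_Mapping.single z m) = canon z m"
  by (simp add: canonH_def)

lemma canonH_sum: "canonH (sum f F) = (\<Sum>i\<in>F. canonH (f i))"
  by (induction F rule: infinite_finite_induct) (auto simp: canonH_add)

lemma coordC_canonH:
  assumes "x \<in> D" "b \<in> B" "Poly_Mapping.keys f \<subseteq> D"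
  shows "coordC x b (canonH f) = Poly_Mapping.single 0 (M.representation B (Poly_Mapping.lookup f x) b)"
proof -
  have "coordC x b (canonH f) = (\<Sum>z\<in>Poly_Mapping.keys f.
    if z = x then Poly_Mapping.single 0 (M.representation B (Poly_Mapping.lookup f x) b) else 0)"
    unfolding canonH_def coordC_sum using assms by (intro sum.cong) (auto simp: coordC_canon)
  also have "\<dots> = (if x \<in> Poly_Mapping.keys f then Poly_Mapping.single 0 (M.representation B (Poly_Mapping.lookup f x) b) else 0)"
    by (simp add: sum.delta)
  finally show ?thesis by (auto simp: in_keys_iff)
qed

lemma basis_nonzero: "b \<in> B \<Longrightarrow> b \<noteq> 0"
  using independent_B M.dependent_zero by blast

text \<open>As e_t x_t = x_t, the vector x_t b lies in the image of e_t, which is spanned by the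
  basis elements fixed by e_t; b is not one of them.\<close>

lemma X_diag:
  assumes t: "t \<in> J" and b: "b \<in> B" and e: "act (E t) b = 0"
  shows "M.representation B (act (X t 0) b) b = 0"
proof -
  let ?n = "act (X t 0) b"
  have "M.representation B (act (E t) n) b = 0" for n
  proof -
    have "n \<in> M.span B" by (simp add: span_B)
    then show ?thesis
    proof (induction rule: M.span_induct_alt)
      case base
      then show ?case by simp
    next
      case (step c b' n)
      have "M.representation B (sM c (act (E t) b')) b = 0"
      proof (cases "act (E t) b' = 0")
        case False
        then have "act (E t) b' = b'" using diag_B[OF t step(1)] by blast
        moreover from this have "b' \<noteq> b" using e False by auto
        ultimately show ?thesis using step
          by (simp add: M.representation_scale[OF independent_B] M.representation_basis[OF independent_B] span_B)
      qed simp
      then show ?case using step by (simp add: A.act_add_right act_scale repB_add)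
    qed
  qed
  moreover have "act (E t) ?n = ?n" using omega_relation(2)[OF t] by (simp flip: act_mult)
  ultimately show ?thesis by metis
qed

lemma hx_single:
  assumes s: "s \<in> S" and z: "z \<in> D" and m: "m \<noteq> 0"
  shows "z \<in> DJ_plus G S J s \<Longrightarrow> hx s (Poly_Mapping.single z m) =
      (\<Sum>x\<in>{x \<in> D. bruhat_less G S x z}. Poly_Mapping.single x (mu0 s x z m)) + Poly_Mapping.single (s \<otimes> z) m"
    "z \<in> DJ_zero G S J s \<Longrightarrow> hx s (Poly_Mapping.single z m) =
      (\<Sum>x\<in>{x \<in> D. bruhat_less G S x z}. Poly_Mapping.single x (mu0 s x z m))
        + Poly_Mapping.single z (act (X (conj_by G s z) 0) m)"
    "z \<in> DJ_minus G S J s \<Longrightarrow> hx s (Poly_Mapping.single z m) = 0"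
  using m DJ_plus_iff[OF s] DJ_zero_iff[OF s] DJ_minus_iff[OF s]
  by (auto simp: hy_x_def Let_def)

lemma lookup_sum_singles:
  assumes "finite F"
  shows "Poly_Mapping.lookup (\<Sum>x\<in>F. Poly_Mapping.single x (h x)) y = (if y \<in> F then h y else 0)"
  using assms by (simp add: lookup_sum lookup_single when_def sum.delta)

text \<open>What the comparison of weights requires: up to a multiple of \<open>C_z,b\<close>, T_s
  acts as x_s does, and x_s has no diagonal entry. The multiple is v or \<open>-v^-1\<close>,
  according to whether e_s kills or fixes z|b.\<close>

lemma T_C:
  assumes s: "s \<in> S" and z: "z \<in> D" and b: "b \<in> B"
  shows "\<exists>a. actI (T s) (C z b) = scI a (C z b) + canonH (hx s (Poly_Mapping.single z b))"
    and "Poly_Mapping.keys (hx s (Poly_Mapping.single z b)) \<subseteq> D"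
    and "M.representation B (Poly_Mapping.lookup (hx s (Poly_Mapping.single z b)) z) b = 0"
proof -
  let ?n = "hx s (Poly_Mapping.single z b)" and ?A = "{x \<in> D. bruhat_less G S x z}"
  let ?q = "\<Sum>x\<in>?A. Poly_Mapping.single x (mu0 s x z b)"
  have b0: "b \<noteq> 0" using basis_nonzero[OF b] .
  have c: "C z b = canon z b" using canon_eq_C[OF z b] by simp
  have fin: "finite ?A" using finite_less_D[OF z] .
  have qz: "Poly_Mapping.lookup ?q z = 0" by (subst lookup_sum_singles[OF fin]) (simp add: bruhat_less_def)
  have kq: "Poly_Mapping.keys ?q \<subseteq> D"
  proof
    fix y assume "y \<in> Poly_Mapping.keys ?q"
    then show "y \<in> D" unfolding in_keys_iff lookup_sum_singles[OF fin] by (simp split: if_splits)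
  qed
  have cq: "canonH ?q = (\<Sum>x\<in>?A. canon x (mu0 s x z b))" by (simp add: canonH_sum)
  have neg: "actI (T s) (C z b) = scI (- vpow (- 1)) (C z b)"
    if "actI (T s) (canon z b) + scI (vpow (- 1)) (canon z b) = 0"
    using that by (simp add: c I.scale_minus_left eq_neg_iff_add_eq_0)
  have "(\<exists>a. actI (T s) (C z b) = scI a (C z b) + canonH ?n) \<and> Poly_Mapping.keys ?n \<subseteq> D
    \<and> M.representation B (Poly_Mapping.lookup ?n z) b = 0"
    using s z
  proof (cases rule: D_cases)
    case plus
    have n: "?n = ?q + Poly_Mapping.single (s \<otimes> z) b" by (rule hx_single(1)[OF s z b0 plus(1)])
    have "s \<otimes> z \<noteq> z" using plus(4) by auto
    then have "Poly_Mapping.lookup ?n z = 0" unfolding n by (simp add: lookup_add qz lookup_single)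
    moreover have "Poly_Mapping.keys (Poly_Mapping.single (s \<otimes> z) b) \<subseteq> D" using plus(5) by simp
    with kq have "Poly_Mapping.keys ?n \<subseteq> D"
      unfolding n by (rule order_trans[OF keys_add Un_least])
    moreover have "actI (T s) (C z b) = scI (vpow 1) (C z b) + canonH ?n"
      unfolding n canonH_add cq c T_canon_plus[OF s plus(1)] by simp
    ultimately show ?thesis by auto
  next
    case zero
    let ?t = "conj_by G s z"
    have n: "?n = ?q + Poly_Mapping.single z (act (X ?t 0) b)" by (rule hx_single(2)[OF s z b0 zero(1)])
    have "Poly_Mapping.keys (Poly_Mapping.single z (act (X ?t 0) b)) \<subseteq> D" using z by simp
    with kq have keys: "Poly_Mapping.keys ?n \<subseteq> D"
      unfolding n by (rule order_trans[OF keys_add Un_least])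
    show ?thesis
    proof (cases "act (E ?t) b = 0")
      case True
      have "M.representation B (Poly_Mapping.lookup ?n z) b = 0"
        unfolding n using X_diag[OF zero(6) b True] by (simp add: lookup_add qz)
      moreover have "actI (T s) (C z b) = scI (vpow 1) (C z b) + canonH ?n"
        unfolding n canonH_add cq c T_canon_zero[OF s zero(1) True] by simp
      ultimately show ?thesis using keys by blast
    next
      case False
      then have e: "act (E ?t) b = b" using diag_B[OF zero(6) b] by blast
      have "act (X ?t 0) b = act (X ?t 0 * E ?t) b" using e by (simp add: act_mult)
      then have "act (X ?t 0) b = 0" using omega_relation(3)[OF zero(6)] by simp
      moreover have "?q = 0" using mu0_vanish[OF s zero(1) e] by (intro sum.neutral) auto
      ultimately have n0: "?n = 0" unfolding n by simp
      have "actI (T s) (C z b) = scI (- vpow (- 1)) (C z b) + canonH 0"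
        using neg T_canon_descent(1)[OF s z] zero(1) e by simp
      then show ?thesis unfolding n0 by (intro conjI exI[of _ "- vpow (- 1)"]) simp_all
    qed
  next
    case minus
    have n0: "?n = 0" by (rule hx_single(3)[OF s z b0 minus(1)])
    have "actI (T s) (C z b) = scI (- vpow (- 1)) (C z b) + canonH 0"
      using neg T_canon_descent(1)[OF s z] minus(1) by simp
    then show ?thesis unfolding n0 by (intro conjI exI[of _ "- vpow (- 1)"]) simp_all
  qed
  then show "\<exists>a. actI (T s) (C z b) = scI a (C z b) + canonH ?n" "Poly_Mapping.keys ?n \<subseteq> D"
    "M.representation B (Poly_Mapping.lookup ?n z) b = 0" by blast+
qed

lemma mat_entry_C:
  assumes "s \<in> S" "x \<in> D" "b \<in> B" "z \<in> D" "b' \<in> B" "\<not> (x = z \<and> b = b')"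
  shows "mat_entry scI CB (actI (T s)) (C x b) (C z b') =
    Poly_Mapping.single 0 (M.representation B (Poly_Mapping.lookup (hx s (Poly_Mapping.single z b')) x) b)"
proof -
  obtain a where "actI (T s) (C z b') = scI a (C z b') + canonH (hx s (Poly_Mapping.single z b'))"
    using T_C(1)[OF assms(1,4,5)] by blast
  then show ?thesis
    using coordC_canonH[OF assms(2,3) T_C(2)[OF assms(1,4,5)]] coordC_C[OF assms(2-5)] assms(6)
    by (simp add: mat_entry_def coordC_add coordC_scale flip: coordC_def)
qed

section \<open>Comparison of the W-graphs\<close>

abbreviation sH :: "'k laurent \<Rightarrow> ('w \<Rightarrow>\<^sub>0 'm) laurent \<Rightarrow> ('w \<Rightarrow>\<^sub>0 'm) laurent" where
  "sH \<equiv> lact (hy_scale sM)"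

lemma lookup_hy_scale: "Poly_Mapping.lookup (hy_scale sM k f) x = sM k (Poly_Mapping.lookup f x)"
  unfolding hy_scale_def by (rule map_additive) (rule M.scale_right_distrib)

sublocale HA: laurent_action "hy_scale sM"
  by unfold_locales
    (auto intro!: poly_mapping_eqI simp: lookup_hy_scale lookup_add M.scale_left_distrib M.scale_right_distrib)

sublocale H: Modules.module sH
proof
  fix a b :: "'k laurent" and x y :: "('w \<Rightarrow>\<^sub>0 'm) laurent"
  show "sH a (x + y) = sH a x + sH a y" by (rule HA.lact_add_right)
  show "sH (a + b) x = sH a x + sH b x" by (rule HA.lact_add_left)
  show "sH a (sH b x) = sH (a * b) x"
    by (rule lact_mult[symmetric]) (unfold_locales, rule poly_mapping_eqI, simp add: lookup_hy_scale)
  show "sH 1 x = x"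
    by (rule lact_one) (unfold_locales, rule poly_mapping_eqI, simp add: lookup_hy_scale)
qed

text \<open>Explicit coordinate functionals, from which independence and the values of
  \<open>representation\<close> are read off.\<close>

definition coordH :: "'w \<Rightarrow> 'm \<Rightarrow> ('w \<Rightarrow>\<^sub>0 'm) laurent \<Rightarrow> 'k laurent" where
  "coordH x b F = Poly_Mapping.map (\<lambda>f. M.representation B (Poly_Mapping.lookup f x) b) F"

lemma lookup_coordH:
  "Poly_Mapping.lookup (coordH x b F) k = M.representation B (Poly_Mapping.lookup (Poly_Mapping.lookup F k) x) b"
  unfolding coordH_def by (rule map_additive) (simp add: lookup_add repB_add)

lemma coordH_add: "coordH x b (F + F') = coordH x b F + coordH x b F'"
  by (rule poly_mapping_eqI) (simp add: lookup_coordH lookup_add repB_add)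

lemma coordH_zero [simp]: "coordH x b 0 = 0"
  using coordH_add[of x b 0 0] by simp

lemma coordH_sum: "coordH x b (sum f A) = (\<Sum>i\<in>A. coordH x b (f i))"
  by (induction A rule: infinite_finite_induct) (auto simp: coordH_add)

lemma coordH_single: "coordH x b (Poly_Mapping.single k f) = Poly_Mapping.single k (M.representation B (Poly_Mapping.lookup f x) b)"
  by (rule poly_mapping_eqI) (simp add: lookup_coordH lookup_single when_def)

lemma coordH_scale: "coordH x b (sH a F) = a * coordH x b F"
proof (induction a rule: poly_mapping_add_induct)
  case (single i c)
  show ?case
  proof (induction F rule: poly_mapping_add_induct)
    case (single j f)
    show ?case by (simp add: coordH_single lookup_hy_scale mult_single M.representation_scale[OF independent_B] span_B)
  qed (simp_all add: HA.lact_add_right coordH_add distrib_left)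
qed (simp_all add: HA.lact_add_left coordH_add distrib_right)

abbreviation "HYB \<equiv> {Poly_Mapping.single x b | x b. x \<in> D \<and> b \<in> B}"

lemma coordH_basis:
  assumes "b \<in> B" "b' \<in> B"
  shows "coordH x b (Poly_Mapping.single 0 (Poly_Mapping.single y b')) = (if x = y \<and> b = b' then 1 else 0)"
  using assms by (auto simp: coordH_single lookup_single when_def M.representation_basis[OF independent_B])

lemma single_basis_eq_iff:
  assumes "b \<in> B" shows "Poly_Mapping.single x b = Poly_Mapping.single y b' \<longleftrightarrow> x = y \<and> b = b'"
proof
  assume e: "Poly_Mapping.single x b = Poly_Mapping.single y b'"
  have "Poly_Mapping.lookup (Poly_Mapping.single y b') x = b" using e by (metis lookup_single_eq)
  then show "x = y \<and> b = b'" using basis_nonzero[OF assms] by (auto simp: lookup_single when_def split: if_splits)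
qed auto

lemma HYB_cases:
  assumes "v \<in> Poly_Mapping.single 0 ` HYB"
  shows "\<exists>x b. x \<in> D \<and> b \<in> B \<and> v = Poly_Mapping.single 0 (Poly_Mapping.single x b)"
proof -
  from assms obtain f where f: "v = Poly_Mapping.single 0 f" "f \<in> HYB" by (rule imageE)
  from f(2) obtain x b where "f = Poly_Mapping.single x b \<and> x \<in> D \<and> b \<in> B" by (elim CollectE exE)
  with f(1) show ?thesis by blast
qed

lemma coordH_combination:
  assumes "finite U" "U \<subseteq> Poly_Mapping.single 0 ` HYB" "x \<in> D" "b \<in> B"
  shows "coordH x b (\<Sum>v\<in>U. sH (u v) v) =
    (if Poly_Mapping.single 0 (Poly_Mapping.single x b) \<in> U then u (Poly_Mapping.single 0 (Poly_Mapping.single x b)) else 0)"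
proof -
  let ?w = "Poly_Mapping.single 0 (Poly_Mapping.single x b) :: ('w \<Rightarrow>\<^sub>0 'm) laurent"
  have "coordH x b (sH (u v) v) = (if v = ?w then u v else 0)" if v: "v \<in> U" for v
  proof -
    obtain y b' where y: "b' \<in> B" "v = Poly_Mapping.single 0 (Poly_Mapping.single y b')"
      using HYB_cases[OF subsetD[OF assms(2) v]] by metis
    have "v = ?w \<longleftrightarrow> Poly_Mapping.single y b' = Poly_Mapping.single x b"
      unfolding y(2) by (rule single_eq_iff)
    then have "v = ?w \<longleftrightarrow> y = x \<and> b' = b" by (simp only: single_basis_eq_iff[OF y(1)])
    then have "coordH x b v = (if v = ?w then 1 else 0)"
      using coordH_basis[OF assms(4) y(1), of x y] unfolding y(2)[symmetric] by simp
    then show ?thesis by (simp only: coordH_scale) simp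
  qed
  then show ?thesis using assms(1) by (simp add: coordH_sum sum.delta)
qed

lemma independent_HYB: "\<not> H.dependent (Poly_Mapping.single 0 ` HYB)"
proof
  assume "H.dependent (Poly_Mapping.single 0 ` HYB)"
  then obtain U u v where U: "finite U" "U \<subseteq> Poly_Mapping.single 0 ` HYB" "(\<Sum>v\<in>U. sH (u v) v) = 0" "v \<in> U" "u v \<noteq> 0"
    unfolding H.dependent_explicit by blast
  from HYB_cases[OF subsetD[OF U(2,4)]] obtain x b where
    x: "x \<in> D" "b \<in> B" "v = Poly_Mapping.single 0 (Poly_Mapping.single x b)" by metis
  then have "u v = coordH x b 0" using coordH_combination[OF U(1,2) x(1,2), of u] U by simp
  then show False using U(5) by simp
qed

lemma span_HYB:
  assumes "Poly_Mapping.keys f \<subseteq> D" shows "Poly_Mapping.single 0 f \<in> H.span (Poly_Mapping.single 0 ` HYB)"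
proof -
  have single: "Poly_Mapping.single 0 (Poly_Mapping.single x m) \<in> H.span (Poly_Mapping.single 0 ` HYB)" if x: "x \<in> D" for x m
  proof -
    have "m \<in> M.span B" by (simp add: span_B)
    then show ?thesis
    proof (induction rule: M.span_induct_alt)
      case (step c b n)
      have "hy_scale sM c (Poly_Mapping.single x b) = Poly_Mapping.single x (sM c b)"
        by (rule poly_mapping_eqI) (simp add: lookup_hy_scale lookup_single when_def)
      then have e: "Poly_Mapping.single 0 (Poly_Mapping.single x (sM c b + n)) =
        sH (Poly_Mapping.single 0 c) (Poly_Mapping.single 0 (Poly_Mapping.single x b)) + Poly_Mapping.single 0 (Poly_Mapping.single x n)"
        by (simp add: single_add)
      have "Poly_Mapping.single 0 (Poly_Mapping.single x b) \<in> Poly_Mapping.single 0 ` HYB"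
        by (rule imageI) (use x step(1) in blast)
      then show ?case unfolding e by (rule H.span_add[OF H.span_scale[OF H.span_base] step(2)])
    qed (simp add: H.span_zero)
  qed
  have "Poly_Mapping.single 0 f = (\<Sum>x\<in>Poly_Mapping.keys f. Poly_Mapping.single 0 (Poly_Mapping.single x (Poly_Mapping.lookup f x)))"
    by (subst poly_mapping_sum_single[of f]) (rule poly_mapping_eqI, simp add: lookup_sum lookup_single when_def)
  also have "\<dots> \<in> H.span (Poly_Mapping.single 0 ` HYB)" using assms single by (intro H.span_sum) auto
  finally show ?thesis .
qed

lemma representation_HYB:
  assumes "F \<in> H.span (Poly_Mapping.single 0 ` HYB)" "x \<in> D" "b \<in> B"
  shows "H.representation (Poly_Mapping.single 0 ` HYB) F (Poly_Mapping.single 0 (Poly_Mapping.single x b)) = coordH x b F"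
proof -
  let ?r = "H.representation (Poly_Mapping.single 0 ` HYB) F" and ?w = "Poly_Mapping.single 0 (Poly_Mapping.single x b)"
  have "(\<Sum>v\<in>{v. ?r v \<noteq> 0}. sH (?r v) v) = F"
    by (rule H.sum_nonzero_representation_eq[OF independent_HYB assms(1)])
  moreover have "{v. ?r v \<noteq> 0} \<subseteq> Poly_Mapping.single 0 ` HYB"
    by (rule subsetI) (rule H.representation_ne_zero, erule CollectD)
  moreover have "finite {v. ?r v \<noteq> 0}" by (rule H.finite_representation)
  ultimately show ?thesis
    using coordH_combination[OF _ _ assms(2,3), of "{v. ?r v \<noteq> 0}" ?r] by simp
qed

lemma mat_entry_HY:
  assumes "s \<in> S" "x \<in> D" "b \<in> B" "z \<in> D" "b' \<in> B"
  shows "mat_entry sH (Poly_Mapping.single 0 ` HYB) (x_total (L s) (hy_x G S J X \<mu> act s))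
      (Poly_Mapping.single 0 (Poly_Mapping.single x b)) (Poly_Mapping.single 0 (Poly_Mapping.single z b')) =
    Poly_Mapping.single 0 (M.representation B (Poly_Mapping.lookup (hx s (Poly_Mapping.single z b')) x) b)"
proof -
  have "Poly_Mapping.single z b' \<noteq> 0" using basis_nonzero[OF assms(5)]
    by (metis keys_single keys_zero insert_not_empty)
  \<comment> \<open>For L(s) = 1 the sum defining x_s consists of the term with exponent 0.\<close>
  moreover have "{-1<..<1::int} = {0}" by auto
  ultimately have "x_total (L s) (hy_x G S J X \<mu> act s) (Poly_Mapping.single 0 (Poly_Mapping.single z b')) =
    Poly_Mapping.single 0 (hx s (Poly_Mapping.single z b'))"
    using L_S[OF assms(1)] by (simp add: x_total_def)
  then show ?thesis
    using representation_HYB[OF span_HYB[OF T_C(2)[OF assms(1,4,5)]] assms(2,3)]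
    by (simp add: mat_entry_def coordH_single)
qed

section \<open>The canonicalisation as an isomorphism of W-graphs\<close>

lemma canonicalisation_eq:
  assumes "x \<in> D" "b \<in> B"
  shows "canonicalisation G S J T p act tens scI (Poly_Mapping.single 0 (Poly_Mapping.single x b)) = C x b"
proof -
  have b0: "b \<noteq> 0" using basis_nonzero[OF assms(2)] .
  then have s0: "Poly_Mapping.single x b \<noteq> 0" by (metis keys_single keys_zero insert_not_empty)
  have "Sum_any (\<lambda>y. if y \<in> D then tens (TT y) (P y x b) else 0) = canon x b"
    unfolding canon_def using finite_lower_D[OF DG[OF assms(1)]] p_props(3)[OF _ assms(1)]
    by (subst Sum_any.expand_superset[of "{y \<in> D. bruhat_le G S y x}"]) (auto intro!: sum.cong intro: ccontr)
  moreover have "Poly_Mapping.keys (Poly_Mapping.single 0 (Poly_Mapping.single x b) :: ('w \<Rightarrow>\<^sub>0 'm) laurent) = {0}"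
    "Poly_Mapping.keys (Poly_Mapping.single x b) = {x}" using b0 s0 by simp_all
  moreover have "scI (vpow 0) i = i" for i by simp
  ultimately show ?thesis
    using canon_eq_C[OF assms] by (simp only: canonicalisation_def lookup_single_eq sum.insert finite.emptyI empty_iff not_False_eq_True sum.empty add_0_right)
qed

lemma hy_e_single:
  assumes s: "s \<in> S" and x: "x \<in> D" and b: "b \<in> B"
  shows "hy_e G S J E act s (Poly_Mapping.single x b) = Poly_Mapping.single x b \<longleftrightarrow>
    bruhat_less G S (s \<otimes> x) x \<or> (bruhat_less G S x (s \<otimes> x) \<and> s \<otimes> x \<notin> D \<and> conj_by G s x \<in> {t \<in> J. act (E t) b = b})"
proof -
  have b0: "b \<noteq> 0" using basis_nonzero[OF b] .
  then have s0: "Poly_Mapping.single x b \<noteq> 0" by (metis keys_single keys_zero insert_not_empty)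
  have lt: "bruhat_less G S x (s \<otimes> x) \<longleftrightarrow> l x < l (s \<otimes> x)" "bruhat_less G S (s \<otimes> x) x \<longleftrightarrow> l (s \<otimes> x) < l x"
    using bruhat_less_S_mult_iff[OF DG[OF x] s] bruhat_less_S_mult_iff'[OF DG[OF x] s] by simp_all
  from s x show ?thesis
  proof (cases rule: D_cases)
    case plus
    \<comment> \<open>Here e_s kills the vertex, and since b is nonzero this excludes that it fixes
      it.\<close>
    then show ?thesis using b0 s0[symmetric] by (simp add: hy_e_def lt)
  next
    case zero
    have "Poly_Mapping.single x (act (E (conj_by G s x)) b) = Poly_Mapping.single x b \<longleftrightarrow> act (E (conj_by G s x)) b = b"
      by (metis lookup_single_eq)
    then show ?thesis using b0 zero by (simp add: hy_e_def lt)
  next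
    case minus
    then show ?thesis using b0 by (simp add: hy_e_def lt)
  qed
qed

lemma same_wgraph:
  "same_wgraph_via S (\<lambda>n. canonicalisation G S J T p act tens scI (Poly_Mapping.single 0 n))
    (module_wgraph S L (hy_scale sM) (hy_e G S J E act) (hy_x G S J X \<mu> act) HYB)
    (hy_wgraph G S J T E act B scI actI C)"
proof -
  let ?\<phi> = "\<lambda>n. canonicalisation G S J T p act tens scI (Poly_Mapping.single 0 n)"
  have C_eq: "C x b = C y b' \<longleftrightarrow> x = y \<and> b = b'" if "x \<in> D" "b \<in> B" "y \<in> D" "b' \<in> B" for x b y b'
    using inj_onD[OF inj_C, of "(x, b)" "(y, b')"] that by auto
  have "bij_betw ?\<phi> HYB CB"
  proof (rule bij_betw_imageI)
    show "inj_on ?\<phi> HYB"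
      by (rule inj_onI) (auto simp: canonicalisation_eq C_eq)
    show "?\<phi> ` HYB = CB"
    proof
      show "?\<phi> ` HYB \<subseteq> CB" by (auto simp: canonicalisation_eq)
      show "CB \<subseteq> ?\<phi> ` HYB"
      proof
        fix i assume "i \<in> CB"
        then obtain x b where xb: "x \<in> D" "b \<in> B" "i = C x b" by auto
        then have "i = ?\<phi> (Poly_Mapping.single x b)" by (simp add: canonicalisation_eq)
        then show "i \<in> ?\<phi> ` HYB" using xb by blast
      qed
    qed
  qed
  \<comment> \<open>The label in \<open>hy_wgraph\<close> refers to any pair (x, b) that names the
    vertex; by injectivity of C there is one such pair.\<close>
  moreover have labels: "{s \<in> S. \<exists>x\<in>D. \<exists>b\<in>B. C z b0 = C x b \<and> (bruhat_less G S (s \<otimes> x) x \<or>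
      (bruhat_less G S x (s \<otimes> x) \<and> s \<otimes> x \<notin> D \<and> conj_by G s x \<in> {t \<in> J. act (E t) b = b}))} =
      {s \<in> S. hy_e G S J E act s (Poly_Mapping.single z b0) = Poly_Mapping.single z b0}" if "z \<in> D" "b0 \<in> B" for z b0
    using that C_eq[OF that] hy_e_single[OF _ that] by auto
  \<comment> \<open>On the diagonal \<open>hy_wgraph\<close> puts 0, which agrees with x_s by the
    last part of \<open>T_C\<close>.\<close>
  moreover have weights: "(if C x b = C z b' then 0 else mat_entry scI CB (actI (T s)) (C x b) (C z b')) =
      mat_entry sH (Poly_Mapping.single 0 ` HYB) (x_total (L s) (hy_x G S J X \<mu> act s))
      (Poly_Mapping.single 0 (Poly_Mapping.single x b)) (Poly_Mapping.single 0 (Poly_Mapping.single z b'))"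
    if "s \<in> S" "x \<in> D" "b \<in> B" "z \<in> D" "b' \<in> B" for s x b z b'
    unfolding mat_entry_HY[OF that] C_eq[OF that(2-5)]
    using mat_entry_C[OF that] T_C(3)[OF that(1,4,5)] by auto
  let ?A = "module_wgraph S L (hy_scale sM) (hy_e G S J E act) (hy_x G S J X \<mu> act) HYB"
    and ?B = "hy_wgraph G S J T E act B scI actI C"
  have verts: "\<exists>x b. n = Poly_Mapping.single x b \<and> x \<in> D \<and> b \<in> B" if "n \<in> verts ?A" for n
    using that by (simp add: module_wgraph_def)
  show ?thesis
    unfolding same_wgraph_via_def
  proof (intro conjI ballI)
    show "bij_betw ?\<phi> (verts ?A) (verts ?B)"
      using \<open>bij_betw ?\<phi> HYB CB\<close> by (simp add: module_wgraph_def hy_wgraph_def)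
    fix n assume "n \<in> verts ?A"
    with verts obtain x b where n: "n = Poly_Mapping.single x b" "x \<in> D" "b \<in> B" by blast
    show "vlabel ?B (?\<phi> n) = vlabel ?A n"
      unfolding n(1) canonicalisation_eq[OF n(2,3)] module_wgraph_def hy_wgraph_def wgraph.select_convs
      by (rule labels[OF n(2,3)])
    fix s n' assume s: "s \<in> S" and "n' \<in> verts ?A"
    with verts obtain y b' where n': "n' = Poly_Mapping.single y b'" "y \<in> D" "b' \<in> B" by blast
    show "weight ?B s (?\<phi> n) (?\<phi> n') = weight ?A s n n'"
      unfolding n(1) n'(1) canonicalisation_eq[OF n(2,3)] canonicalisation_eq[OF n'(2,3)]
        module_wgraph_def hy_wgraph_def wgraph.select_convs
      by (rule weights[OF s n(2,3) n'(2,3)])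
  qed
qed

end

theorem proposition4p10:
  fixes G :: "('w, 'c) monoid_scheme" and S J :: "'w set" and L :: "'w \<Rightarrow> int"
    and sc :: "int laurent \<Rightarrow> 'h::ring_1" and T :: "'w \<Rightarrow> 'h" and \<iota> :: "'h \<Rightarrow> 'h"
    and E :: "'w \<Rightarrow> 'o::ring_1" and X :: "'w \<Rightarrow> int \<Rightarrow> 'o"
    and p :: "'w \<Rightarrow> 'w \<Rightarrow> 'o laurent" and \<mu> :: "'w \<Rightarrow> 'w \<Rightarrow> 'w \<Rightarrow> 'o laurent"
    and sM :: "'k::comm_ring_1 \<Rightarrow> 'm::ab_group_add \<Rightarrow> 'm" and act :: "'o \<Rightarrow> 'm \<Rightarrow> 'm" and B :: "'m set"
    and tens :: "'h \<Rightarrow> 'm laurent \<Rightarrow> 'i::ab_group_add" and scI :: "'k laurent \<Rightarrow> 'i \<Rightarrow> 'i"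
    and actI :: "'h \<Rightarrow> 'i \<Rightarrow> 'i" and \<iota>I :: "'i \<Rightarrow> 'i" and C :: "'w \<Rightarrow> 'm \<Rightarrow> 'i"
  assumes "coxeter_system G S"
    and "weight_function G S L" and "\<forall>s\<in>S. L s = 1"
    and "J \<subseteq> S"
    and "hecke_algebra G S L sc T" and "hecke_bar S sc T \<iota>"
    and "omega_algebra G J L E X"
    and "p_family G S L J sc T \<iota> E X p"
    and "mu_family G S L J E X p \<mu>"
    and "omega_module sM act"
    and "basis_of sM UNIV B" and "\<forall>s\<in>J. \<forall>b\<in>B. act (E s) b = 0 \<or> act (E s) b = b"
    and "induced_module G S L J sc T \<iota> E X sM act tens scI actI \<iota>I"
    and "hy_basis G S J T B tens scI \<iota>I C"
  defines "c \<equiv> canonicalisation G S J T p act tens scI"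
  shows "(\<forall>x\<in>DJ G S J. \<forall>b\<in>B.
            c (Poly_Mapping.single 0 (Poly_Mapping.single x b)) = C x b)
       \<and> same_wgraph_via S (\<lambda>n. c (Poly_Mapping.single 0 n))
           (module_wgraph S L (hy_scale sM) (hy_e G S J E act) (hy_x G S J X \<mu> act)
              {Poly_Mapping.single x b | x b. x \<in> DJ G S J \<and> b \<in> B})
           (hy_wgraph G S J T E act B scI actI C)"
proof -
  interpret hy_data G S L sc T \<iota> J E X p \<mu> sM act B tens scI actI \<iota>I C
    by unfold_locales (use assms in auto)
  show ?thesis
    unfolding c_def using canonicalisation_eq same_wgraph by blast
qed

end
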